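(* Let $\mathcal D$ be an $R$-coring and let $B\subseteq A$ be a $\mathcal D$-cleft algebra extension. If there exist finite sets $\{v_i\}\subseteq{}_R\mathrm{Hom}_R(\mathcal D,B)$ and $\{d_i\}\subseteq\mathcal D$ satisfying $\sum_iv_i(d_i)=1_B$, then the category $\mathcal M_B$ of right $B$-modules is equivalent to the category $\mathcal M^{\mathcal C}$ of right comodules for the $A$-coring $\mathcal C:=A\otimes_R\mathcal D$, via the induction functor $-\otimes_BA:\mathcal M_B\to\mathcal M^{\mathcal C}$.
   Context: $k$ is a commutative, associative, unital ring; algebras are associative unital $k$-algebras. For an algebra $R$, an $R$-ring is a monoid in the category of $R$-$R$ bimodules (equivalently an algebra $A$ with an algebra map $\eta:R\to A$), an $R$-coring is a comonoid in that category, and a right comodule of an $R$-coring $\mathcal D$ is a right $R$-module $M$ with a right $R$-linear coassociative counital coaction $M\to M\otimes_R\mathcal D$. ${}_R\mathrm{Hom}_R$ denotes $R$-$R$ bimodule maps. Algebra extension by a coring: let $A$ be an $R$-ring with unit map $\eta$, which is also a right $\mathcal D$-comodule via $\varrho^A:A\to A\otimes_R\mathcal D$ (with the same right $R$-action), where $\mathcal D=(\mathcal D,\Delta,\epsilon)$. The coinvariants are $A^{co\mathcal D}=\{b\in A\mid \varrho^A(ba)=b\varrho^A(a)\ \forall a\in A\}$. $B\subseteq A$ is an extension by $\mathcal D$ if $B=A^{co\mathcal D}$. $\mathcal D$-cleft extension: $B\subseteq A$ (with $B=A^{co\mathcal D}$) is $\mathcal D$-cleft if (1) $\mathcal C:=A\otimes_R\mathcal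 D$ is an $A$-coring, with the left regular $A$-module structure of the first factor, some right $A$-module structure, coproduct $A\otimes_R\Delta$ (using $(A\otimes_R\mathcal D)\otimes_A(A\otimes_R\mathcal D)\cong A\otimes_R\mathcal D\otimes_R\mathcal D$) and counit $A\otimes_R\epsilon$. Then $\mathcal C$ is a right $\mathcal D$-comodule via $A\otimes_R\Delta$, written $c\mapsto c_{[0]}\otimes_Rc_{[1]}$, and the coproduct of $\mathcal C$, written $c\mapsto c^{(1)}\otimes_Ac^{(2)}$, is a right $\mathcal D$-comodule map. (2) The right regular $A$-module, with $\varrho^A:A\to A\otimes_R\mathcal D\cong A\otimes_A\mathcal C$, $x\mapsto x^{[0]}\otimes_Ax^{[1]}$, and the left $R$-action given by left multiplication by $\eta$, is a cleft $R$-$\mathcal C$ bicomodule. That is, $A$ is a right $\mathcal C$-comodule via this coaction, which is left $R$-linear, and with $T:=\mathrm{End}^{\mathcal C}(A)$ (right $\mathcal C$-comodule endomorphisms) there exist a left $R$-linear right $\mathcal D$-comodule map $j:\mathcal D\to A$ and a map $\widetilde j:\mathcal C\to\mathrm{Hom}_A(A,A)$ that is left $A$-linear and right $R$-linear (where $(a\varphi r)(x)=a\varphi(rx)$), satisfying $c^{(1)}\,\widetilde j(c^{(2)})(x)=\widetilde j(c)(x^{[0]})\,x^{[1]}$ for all $x\in A$, $c\in\mathcal C$, such that $j(d)^{[0]}\,\widetilde j(j(d)^{[1]})(-)$ equals the element $x\mapsto\epsilon(d)x$ of $T$ for all $d\in\mathcal D$, and $c^{(1)}\,\widetilde j({c^{(2)}}_{[0]})\big(j({c^{(2)}}_{[1]})\big)=c$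 for all $c\in\mathcal C$. In a $\mathcal D$-cleft extension $B$ contains $\eta(R)$, so that $B$ is an $R$-ring, and ${}_R\mathrm{Hom}_R(\mathcal D,B)$ is defined with respect to this structure. For a right $B$-module $N$, $N\otimes_BA$ is a right $\mathcal C$-comodule via the second factor. *)

theory Defs
  imports "HOL-Algebra.Module"
begin

section \<open>Algebras and modules over non-commutative rings\<close>

text \<open>The locale \<^locale>\<open>algebra\<close> of the library concerns commutative algebras only, and modules of the
  library are modules over commutative rings.\<close>

locale k_algebra = module k R + ring R for k (structure) and R (structure) +
  assumes smult_mult_left:
      "\<lbrakk>a \<in> carrier k; x \<in> carrier R; y \<in> carrier R\<rbrakk> \<Longrightarrow>
        (a \<odot>\<^bsub>R\<^esub> x) \<otimes>\<^bsub>R\<^esub> y = a \<odot>\<^bsub>R\<^esub> (x \<otimes>\<^bsub>R\<^esub> y)"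
    and smult_mult_right:
      "\<lbrakk>a \<in> carrier k; x \<in> carrier R; y \<in> carrier R\<rbrakk> \<Longrightarrow>
        x \<otimes>\<^bsub>R\<^esub> (a \<odot>\<^bsub>R\<^esub> y) = a \<odot>\<^bsub>R\<^esub> (x \<otimes>\<^bsub>R\<^esub> y)"

definition algebra_map ::
  "('k, 'e) ring_scheme \<Rightarrow> ('k, 'r) module \<Rightarrow> ('k, 'a) module \<Rightarrow> ('r \<Rightarrow> 'a) \<Rightarrow> bool"
  where "algebra_map k R A f \<longleftrightarrow> f \<in> ring_hom R A \<and>
    (\<forall>a\<in>carrier k. \<forall>x\<in>carrier R. f (a \<odot>\<^bsub>R\<^esub> x) = a \<odot>\<^bsub>A\<^esub> f x)"

text \<open>As in the record \<^type>\<open>module\<close> of the library, the fields \<^const>\<open>mult\<close> and \<^const>\<open>one\<close> of a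
  module are not used.\<close>

record ('m, 's) rmod = "'m ring" +
  ract :: "'m \<Rightarrow> 's \<Rightarrow> 'm"

record ('m, 's, 'l) bimod = "('m, 's) rmod" +
  lact :: "'l \<Rightarrow> 'm \<Rightarrow> 'm"

locale right_module = S: ring S + M: abelian_group M
  for S :: "('s, 'e) ring_scheme" and M :: "('m, 's, 'f) rmod_scheme" +
  assumes ract_closed: "\<lbrakk>x \<in> carrier M; s \<in> carrier S\<rbrakk> \<Longrightarrow> ract M x s \<in> carrier M"
    and ract_add_left: "\<lbrakk>x \<in> carrier M; y \<in> carrier M; s \<in> carrier S\<rbrakk> \<Longrightarrow>
      ract M (x \<oplus>\<^bsub>M\<^esub> y) s = ract M x s \<oplus>\<^bsub>M\<^esub> ract M y s"
    and ract_add_right: "\<lbrakk>x \<in> carrier M; s \<in> carrier S; t \<in> carrier S\<rbrakk> \<Longrightarrow>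
      ract M x (s \<oplus>\<^bsub>S\<^esub> t) = ract M x s \<oplus>\<^bsub>M\<^esub> ract M x t"
    and ract_mult: "\<lbrakk>x \<in> carrier M; s \<in> carrier S; t \<in> carrier S\<rbrakk> \<Longrightarrow>
      ract M x (s \<otimes>\<^bsub>S\<^esub> t) = ract M (ract M x s) t"
    and ract_one: "x \<in> carrier M \<Longrightarrow> ract M x \<one>\<^bsub>S\<^esub> = x"

text \<open>Bimodules over \<open>k\<close>-algebras: the two actions of \<open>k\<close> are required to coincide.\<close>

locale bimodule = right_module S M + L: ring L
  for k :: "('k, 'e) ring_scheme" and L :: "('k, 'l) module" and S :: "('k, 's) module"
    and M :: "('m, 's, 'l, 'f) bimod_scheme" +
  assumes lact_closed: "\<lbrakk>l \<in> carrier L; x \<in> carrier M\<rbrakk> \<Longrightarrow> lact M l x \<in> carrier M"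
    and lact_add_right: "\<lbrakk>l \<in> carrier L; x \<in> carrier M; y \<in> carrier M\<rbrakk> \<Longrightarrow>
      lact M l (x \<oplus>\<^bsub>M\<^esub> y) = lact M l x \<oplus>\<^bsub>M\<^esub> lact M l y"
    and lact_add_left: "\<lbrakk>l \<in> carrier L; l' \<in> carrier L; x \<in> carrier M\<rbrakk> \<Longrightarrow>
      lact M (l \<oplus>\<^bsub>L\<^esub> l') x = lact M l x \<oplus>\<^bsub>M\<^esub> lact M l' x"
    and lact_mult: "\<lbrakk>l \<in> carrier L; l' \<in> carrier L; x \<in> carrier M\<rbrakk> \<Longrightarrow>
      lact M (l \<otimes>\<^bsub>L\<^esub> l') x = lact M l (lact M l' x)"
    and lact_one: "x \<in> carrier M \<Longrightarrow> lact M \<one>\<^bsub>L\<^esub> x = x"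
    and lact_ract: "\<lbrakk>l \<in> carrier L; x \<in> carrier M; s \<in> carrier S\<rbrakk> \<Longrightarrow>
      lact M l (ract M x s) = ract M (lact M l x) s"
    and k_symmetric: "\<lbrakk>a \<in> carrier k; x \<in> carrier M\<rbrakk> \<Longrightarrow>
      lact M (a \<odot>\<^bsub>L\<^esub> \<one>\<^bsub>L\<^esub>) x = ract M x (a \<odot>\<^bsub>S\<^esub> \<one>\<^bsub>S\<^esub>)"

text \<open>The bimodule on the algebra \<open>A\<close> obtained by restricting the regular actions along algebra maps
  \<open>f\<close> (left) and \<open>g\<close> (right) into \<open>A\<close>.\<close>

definition alg_bimod ::
  "('a, 'e) ring_scheme \<Rightarrow> ('l \<Rightarrow> 'a) \<Rightarrow> ('s \<Rightarrow> 'a) \<Rightarrow> ('a, 's, 'l) bimod"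
  where "alg_bimod A f g = \<lparr>carrier = carrier A, mult = mult A, one = one A, zero = zero A,
    add = add A, ract = (\<lambda>x s. x \<otimes>\<^bsub>A\<^esub> g s), lact = (\<lambda>l x. f l \<otimes>\<^bsub>A\<^esub> x)\<rparr>"

definition with_ract ::
  "('m, 's, 'l) bimod \<Rightarrow> ('m \<Rightarrow> 't \<Rightarrow> 'm) \<Rightarrow> ('m, 't, 'l) bimod"
  where "with_ract M f = \<lparr>carrier = carrier M, mult = mult M, one = one M, zero = zero M,
    add = add M, ract = f, lact = lact M\<rparr>"

definition additive_map ::
  "('m, 'e) ring_scheme \<Rightarrow> ('n, 'f) ring_scheme \<Rightarrow> ('m \<Rightarrow> 'n) \<Rightarrow> bool"
  where "additive_map M N f \<longleftrightarrow> f \<in> carrier M \<rightarrow> carrier N \<and>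
    (\<forall>x\<in>carrier M. \<forall>y\<in>carrier M. f (x \<oplus>\<^bsub>M\<^esub> y) = f x \<oplus>\<^bsub>N\<^esub> f y)"

definition right_linear ::
  "('s, 'e) ring_scheme \<Rightarrow> ('m, 's, 'f) rmod_scheme \<Rightarrow> ('n, 's, 'g) rmod_scheme \<Rightarrow>
    ('m \<Rightarrow> 'n) \<Rightarrow> bool"
  where "right_linear S M N f \<longleftrightarrow> additive_map M N f \<and>
    (\<forall>x\<in>carrier M. \<forall>s\<in>carrier S. f (ract M x s) = ract N (f x) s)"

definition left_linear ::
  "('l, 'e) ring_scheme \<Rightarrow> ('m, 's, 'l, 'f) bimod_scheme \<Rightarrow> ('n, 't, 'l, 'g) bimod_scheme \<Rightarrow>
    ('m \<Rightarrow> 'n) \<Rightarrow> bool"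
  where "left_linear L M N f \<longleftrightarrow> additive_map M N f \<and>
    (\<forall>l\<in>carrier L. \<forall>x\<in>carrier M. f (lact M l x) = lact N l (f x))"

definition bimodule_map ::
  "('l, 'e) ring_scheme \<Rightarrow> ('s, 'h) ring_scheme \<Rightarrow> ('m, 's, 'l, 'f) bimod_scheme \<Rightarrow>
    ('n, 's, 'l, 'g) bimod_scheme \<Rightarrow> ('m \<Rightarrow> 'n) \<Rightarrow> bool"
  where "bimodule_map L S M N f \<longleftrightarrow> left_linear L M N f \<and> right_linear S M N f"


section \<open>Tensor products\<close>

text \<open>An element of \<open>M \<otimes>\<^sub>S N\<close> is a formal finite sum of pairs, i.e.\ a list over
  \<open>carrier M \<times> carrier N\<close>, modulo the congruence below; negatives need not be added, since
  \<open>(\<ominus> m) \<otimes> n\<close> is inverse to \<open>m \<otimes> n\<close>.\<close>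

inductive tens_eq ::
  "('s, 'e) ring_scheme \<Rightarrow> ('m, 's, 'f) rmod_scheme \<Rightarrow> ('n, 't, 's, 'g) bimod_scheme \<Rightarrow>
    ('m \<times> 'n) list \<Rightarrow> ('m \<times> 'n) list \<Rightarrow> bool"
  for S M N where
  refl: "w \<in> lists (carrier M \<times> carrier N) \<Longrightarrow> tens_eq S M N w w"
| sym: "tens_eq S M N u w \<Longrightarrow> tens_eq S M N w u"
| trans: "tens_eq S M N u v \<Longrightarrow> tens_eq S M N v w \<Longrightarrow> tens_eq S M N u w"
| append: "tens_eq S M N u u' \<Longrightarrow> tens_eq S M N w w' \<Longrightarrow> tens_eq S M N (u @ w) (u' @ w')"
| commute: "u \<in> lists (carrier M \<times> carrier N) \<Longrightarrow> w \<in> lists (carrier M \<times> carrier N) \<Longrightarrow>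
    tens_eq S M N (u @ w) (w @ u)"
| zero: "n \<in> carrier N \<Longrightarrow> tens_eq S M N [(\<zero>\<^bsub>M\<^esub>, n)] []"
| add_left: "m \<in> carrier M \<Longrightarrow> m' \<in> carrier M \<Longrightarrow> n \<in> carrier N \<Longrightarrow>
    tens_eq S M N [(m \<oplus>\<^bsub>M\<^esub> m', n)] [(m, n), (m', n)]"
| add_right: "m \<in> carrier M \<Longrightarrow> n \<in> carrier N \<Longrightarrow> n' \<in> carrier N \<Longrightarrow>
    tens_eq S M N [(m, n \<oplus>\<^bsub>N\<^esub> n')] [(m, n), (m, n')]"
| balanced: "m \<in> carrier M \<Longrightarrow> s \<in> carrier S \<Longrightarrow> n \<in> carrier N \<Longrightarrow>
    tens_eq S M N [(ract M m s, n)] [(m, lact N s n)]"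

text \<open>Every class is represented by one chosen member.  Thus elements of tensor products are lists
  themselves (and not sets of lists), which keeps the cardinality of the type small; see the type
  \<open>univ\<close> below.\<close>

definition trep ::
  "('s, 'e) ring_scheme \<Rightarrow> ('m, 's, 'f) rmod_scheme \<Rightarrow> ('n, 't, 's, 'g) bimod_scheme \<Rightarrow>
    ('m \<times> 'n) list \<Rightarrow> ('m \<times> 'n) list"
  where "trep S M N w = (SOME w'. tens_eq S M N w w')"

definition tpure ::
  "('s, 'e) ring_scheme \<Rightarrow> ('m, 's, 'f) rmod_scheme \<Rightarrow> ('n, 't, 's, 'g) bimod_scheme \<Rightarrow>
    'm \<Rightarrow> 'n \<Rightarrow> ('m \<times> 'n) list"
  where "tpure S M N m n = trep S M N [(m, n)]"

definition rtens ::
  "('s, 'e) ring_scheme \<Rightarrow> ('m, 's, 'f) rmod_scheme \<Rightarrow> ('n, 't, 's, 'g) bimod_scheme \<Rightarrow>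
    (('m \<times> 'n) list, 't) rmod"
  where "rtens S M N = \<lparr>carrier = trep S M N ` lists (carrier M \<times> carrier N),
    mult = undefined, one = undefined, zero = trep S M N [], add = (\<lambda>u w. trep S M N (u @ w)),
    ract = (\<lambda>u t. trep S M N (map (\<lambda>(m, n). (m, ract N n t)) u))\<rparr>"

definition tens ::
  "('s, 'e) ring_scheme \<Rightarrow> ('m, 's, 'l, 'f) bimod_scheme \<Rightarrow> ('n, 't, 's, 'g) bimod_scheme \<Rightarrow>
    (('m \<times> 'n) list, 't, 'l) bimod"
  where "tens S M N = rmod.extend (rtens S M N)
    (bimod.fields (\<lambda>l u. trep S M N (map (\<lambda>(m, n). (lact M l m, n)) u)))"

text \<open>\<open>tsum Z f u\<close> is the value at \<open>u\<close> of the additive map induced by \<open>f\<close>, that is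
  \<open>\<Sum>\<^sub>i f m\<^sub>i n\<^sub>i\<close> if \<open>u = \<Sum>\<^sub>i m\<^sub>i \<otimes> n\<^sub>i\<close>.  It is used only for balanced biadditive
  \<open>f\<close>, where the value does not depend on the representative.  Sweedler notation is
  rendered by this function: \<open>tsum Z (\<lambda>x y. \<dots>) (\<Delta> d)\<close> is the sum over \<open>d\<^sub>1 = x\<close>, \<open>d\<^sub>2 = y\<close>.\<close>

definition tsum ::
  "('z, 'e) ring_scheme \<Rightarrow> ('m \<Rightarrow> 'n \<Rightarrow> 'z) \<Rightarrow> ('m \<times> 'n) list \<Rightarrow> 'z"
  where "tsum Z f u = foldr (\<lambda>(m, n) z. f m n \<oplus>\<^bsub>Z\<^esub> z) u \<zero>\<^bsub>Z\<^esub>"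

text \<open>\<open>f \<otimes> g\<close>, with codomain \<open>M \<otimes>\<^sub>S N\<close>\<close>

definition tmap ::
  "('s, 'e) ring_scheme \<Rightarrow> ('m, 's, 'f) rmod_scheme \<Rightarrow> ('n, 't, 's, 'g) bimod_scheme \<Rightarrow>
    ('x \<Rightarrow> 'm) \<Rightarrow> ('y \<Rightarrow> 'n) \<Rightarrow> ('x \<times> 'y) list \<Rightarrow> ('m \<times> 'n) list"
  where "tmap S M N f g u = trep S M N (map (map_prod f g) u)"

text \<open>The canonical isomorphism \<open>(M \<otimes>\<^sub>S N) \<otimes>\<^sub>T P \<rightarrow> M \<otimes>\<^sub>S (N \<otimes>\<^sub>T P)\<close>\<close>

definition tassoc ::
  "('s, 'e) ring_scheme \<Rightarrow> ('t, 'h) ring_scheme \<Rightarrow> ('m, 's, 'f) rmod_scheme \<Rightarrow>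
    ('n, 't, 's, 'g) bimod_scheme \<Rightarrow> ('p, 'v, 't, 'i) bimod_scheme \<Rightarrow>
    (('m \<times> 'n) list \<times> 'p) list \<Rightarrow> ('m \<times> ('n \<times> 'p) list) list"
  where "tassoc S T M N P =
    (let Q = rtens S M (tens T N P)
     in tsum Q (\<lambda>u p. tsum Q (\<lambda>m n. tpure S M (tens T N P) m (tpure T N P n p)) u))"


section \<open>Corings and comodules\<close>

definition coring ::
  "('k, 'e) ring_scheme \<Rightarrow> ('k, 'r) module \<Rightarrow> ('d, 'r, 'r) bimod \<Rightarrow>
    ('d \<Rightarrow> ('d \<times> 'd) list) \<Rightarrow> ('d \<Rightarrow> 'r) \<Rightarrow> bool"
  where "coring k R D \<Delta> \<epsilon> \<longleftrightarrow>
    k_algebra k R \<and> bimodule k R R D \<and>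
    bimodule_map R R D (tens R D D) \<Delta> \<and>
    bimodule_map R R D (alg_bimod R id id) \<epsilon> \<and>
    (\<forall>d\<in>carrier D.
      tassoc R R D D D (tmap R (rtens R D D) D \<Delta> id (\<Delta> d)) = tmap R D (tens R D D) id \<Delta> (\<Delta> d) \<and>
      tsum D (\<lambda>x y. lact D (\<epsilon> x) y) (\<Delta> d) = d \<and>
      tsum D (\<lambda>x y. ract D x (\<epsilon> y)) (\<Delta> d) = d)"

definition right_comodule ::
  "('r, 'e) ring_scheme \<Rightarrow> ('d, 'r, 'r) bimod \<Rightarrow> ('d \<Rightarrow> ('d \<times> 'd) list) \<Rightarrow> ('d \<Rightarrow> 'r) \<Rightarrow>
    ('m, 'r, 'f) rmod_scheme \<Rightarrow> ('m \<Rightarrow> ('m \<times> 'd) list) \<Rightarrow> bool"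
  where "right_comodule R D \<Delta> \<epsilon> M \<rho> \<longleftrightarrow>
    right_module R M \<and> right_linear R M (rtens R M D) \<rho> \<and>
    (\<forall>x\<in>carrier M.
      tassoc R R M D D (tmap R (rtens R M D) D \<rho> id (\<rho> x)) = tmap R M (tens R D D) id \<Delta> (\<rho> x) \<and>
      tsum M (\<lambda>y d. ract M y (\<epsilon> d)) (\<rho> x) = x)"

definition comodule_map ::
  "('r, 'e) ring_scheme \<Rightarrow> ('d, 'r, 'r) bimod \<Rightarrow>
    ('m, 'r, 'f) rmod_scheme \<Rightarrow> ('m \<Rightarrow> ('m \<times> 'd) list) \<Rightarrow>
    ('n, 'r, 'g) rmod_scheme \<Rightarrow> ('n \<Rightarrow> ('n \<times> 'd) list) \<Rightarrow> ('m \<Rightarrow> 'n) \<Rightarrow> bool"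
  where "comodule_map R D M \<rho> N \<sigma> f \<longleftrightarrow>
    right_linear R M N f \<and> (\<forall>x\<in>carrier M. \<sigma> (f x) = tmap R N D f id (\<rho> x))"


section \<open>Extensions by a coring and cleft extensions\<close>

text \<open>\<open>A\<close> as an \<open>A\<close>-\<open>R\<close> bimodule is \<open>alg_bimod A id \<eta>\<close>; this bimodule also provides the right
  \<open>R\<close>-module underlying the right \<open>D\<close>-comodule \<open>A\<close>.\<close>

definition coinvariants ::
  "('k, 'r) module \<Rightarrow> ('d, 'r, 'r) bimod \<Rightarrow> ('k, 'a) module \<Rightarrow> ('r \<Rightarrow> 'a) \<Rightarrow>
    ('a \<Rightarrow> ('a \<times> 'd) list) \<Rightarrow> 'a set"
  where "coinvariants R D A \<eta> \<rho> = {b \<in> carrier A. \<forall>a\<in>carrier A.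
    \<rho> (b \<otimes>\<^bsub>A\<^esub> a) = lact (tens R (alg_bimod A id \<eta>) D) b (\<rho> a)}"

definition extension_by_coring ::
  "('k, 'e) ring_scheme \<Rightarrow> ('k, 'r) module \<Rightarrow>
    ('d, 'r, 'r) bimod \<Rightarrow> ('d \<Rightarrow> ('d \<times> 'd) list) \<Rightarrow> ('d \<Rightarrow> 'r) \<Rightarrow>
    ('k, 'a) module \<Rightarrow> ('r \<Rightarrow> 'a) \<Rightarrow> ('a \<Rightarrow> ('a \<times> 'd) list) \<Rightarrow> 'a set \<Rightarrow> bool"
  where "extension_by_coring k R D \<Delta> \<epsilon> A \<eta> \<rho> B \<longleftrightarrow>
    coring k R D \<Delta> \<epsilon> \<and> k_algebra k A \<and> algebra_map k R A \<eta> \<and>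
    right_comodule R D \<Delta> \<epsilon> (alg_bimod A id \<eta>) \<rho> \<and>
    B = coinvariants R D A \<eta> \<rho>"

text \<open>\<open>C = A \<otimes>\<^sub>R D\<close>, first as an \<open>A\<close>-\<open>R\<close> bimodule and then, given a right \<open>A\<close>-action \<open>\<alpha>\<close>, as an
  \<open>A\<close>-\<open>A\<close> bimodule\<close>

definition AD ::
  "('k, 'r) module \<Rightarrow> ('d, 'r, 'r) bimod \<Rightarrow> ('k, 'a) module \<Rightarrow> ('r \<Rightarrow> 'a) \<Rightarrow>
    (('a \<times> 'd) list, 'r, 'a) bimod"
  where "AD R D A \<eta> = tens R (alg_bimod A id \<eta>) D"

abbreviation AD_pure ::
  "('k, 'r) module \<Rightarrow> ('d, 'r, 'r) bimod \<Rightarrow> ('k, 'a) module \<Rightarrow> ('r \<Rightarrow> 'a) \<Rightarrow>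
    'a \<Rightarrow> 'd \<Rightarrow> ('a \<times> 'd) list"
  where "AD_pure R D A \<eta> \<equiv> tpure R (alg_bimod A id \<eta>) D"

definition ADbi ::
  "('k, 'r) module \<Rightarrow> ('d, 'r, 'r) bimod \<Rightarrow> ('k, 'a) module \<Rightarrow> ('r \<Rightarrow> 'a) \<Rightarrow>
    (('a \<times> 'd) list \<Rightarrow> 'a \<Rightarrow> ('a \<times> 'd) list) \<Rightarrow> (('a \<times> 'd) list, 'a, 'a) bimod"
  where "ADbi R D A \<eta> \<alpha> = with_ract (AD R D A \<eta>) \<alpha>"

text \<open>The coproduct \<open>A \<otimes>\<^sub>R \<Delta>\<close>, transported along
  \<open>A \<otimes>\<^sub>R D \<otimes>\<^sub>R D \<cong> (A \<otimes>\<^sub>R D) \<otimes>\<^sub>A (A \<otimes>\<^sub>R D)\<close>, \<open>a \<otimes> d \<otimes> d' \<mapsto> (a \<otimes> d) \<otimes> (1 \<otimes> d')\<close>;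
  and the counit \<open>A \<otimes>\<^sub>R \<epsilon>\<close>, transported along \<open>A \<otimes>\<^sub>R R \<cong> A\<close>\<close>

definition AD_comult ::
  "('k, 'r) module \<Rightarrow> ('d, 'r, 'r) bimod \<Rightarrow> ('d \<Rightarrow> ('d \<times> 'd) list) \<Rightarrow>
    ('k, 'a) module \<Rightarrow> ('r \<Rightarrow> 'a) \<Rightarrow> (('a \<times> 'd) list \<Rightarrow> 'a \<Rightarrow> ('a \<times> 'd) list) \<Rightarrow>
    ('a \<times> 'd) list \<Rightarrow> (('a \<times> 'd) list \<times> ('a \<times> 'd) list) list"
  where "AD_comult R D \<Delta> A \<eta> \<alpha> =
    (let C = ADbi R D A \<eta> \<alpha>; CC = tens A C C
     in tsum CC (\<lambda>a d. tsum CC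
          (\<lambda>x y. tpure A C C (AD_pure R D A \<eta> a x) (AD_pure R D A \<eta> \<one>\<^bsub>A\<^esub> y)) (\<Delta> d)))"

definition AD_counit ::
  "('d \<Rightarrow> 'r) \<Rightarrow> ('k, 'a) module \<Rightarrow> ('r \<Rightarrow> 'a) \<Rightarrow> ('a \<times> 'd) list \<Rightarrow> 'a"
  where "AD_counit \<epsilon> A \<eta> = tsum A (\<lambda>a d. a \<otimes>\<^bsub>A\<^esub> \<eta> (\<epsilon> d))"

text \<open>The right \<open>D\<close>-coaction \<open>A \<otimes>\<^sub>R \<Delta>\<close> on \<open>C\<close>, and the right \<open>D\<close>-coaction on \<open>C \<otimes>\<^sub>A C\<close> that it
  induces on the second factor\<close>

definition AD_coact ::
  "('k, 'r) module \<Rightarrow> ('d, 'r, 'r) bimod \<Rightarrow> ('d \<Rightarrow> ('d \<times> 'd) list) \<Rightarrow>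
    ('k, 'a) module \<Rightarrow> ('r \<Rightarrow> 'a) \<Rightarrow> ('a \<times> 'd) list \<Rightarrow> (('a \<times> 'd) list \<times> 'd) list"
  where "AD_coact R D \<Delta> A \<eta> =
    (let C = AD R D A \<eta>; CD = tens R C D
     in tsum CD (\<lambda>a d. tsum CD (\<lambda>x y. tpure R C D (AD_pure R D A \<eta> a x) y) (\<Delta> d)))"

definition ADAD_coact ::
  "('k, 'r) module \<Rightarrow> ('d, 'r, 'r) bimod \<Rightarrow> ('d \<Rightarrow> ('d \<times> 'd) list) \<Rightarrow>
    ('k, 'a) module \<Rightarrow> ('r \<Rightarrow> 'a) \<Rightarrow> (('a \<times> 'd) list \<Rightarrow> 'a \<Rightarrow> ('a \<times> 'd) list) \<Rightarrow>
    (('a \<times> 'd) list \<times> ('a \<times> 'd) list) list \<Rightarrow>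
    ((('a \<times> 'd) list \<times> ('a \<times> 'd) list) list \<times> 'd) list"
  where "ADAD_coact R D \<Delta> A \<eta> \<alpha> =
    (let C = ADbi R D A \<eta> \<alpha>; CR = AD R D A \<eta>; CC = tens A C CR; CCD = tens R CC D
     in tsum CCD (\<lambda>c c'. tsum CCD
          (\<lambda>x d. tpure R CC D (tpure A C CR c x) d) (AD_coact R D \<Delta> A \<eta> c')))"

text \<open>The second conjunct says that the right \<open>A\<close>-action extends the right
  \<open>R\<close>-action on \<open>D\<close>; this is what makes the isomorphism
  \<open>(A \<otimes>\<^sub>R D) \<otimes>\<^sub>A (A \<otimes>\<^sub>R D) \<cong> A \<otimes>\<^sub>R D \<otimes>\<^sub>R D\<close> meaningful.\<close>

definition AD_is_coring ::
  "('k, 'e) ring_scheme \<Rightarrow> ('k, 'r) module \<Rightarrow>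
    ('d, 'r, 'r) bimod \<Rightarrow> ('d \<Rightarrow> ('d \<times> 'd) list) \<Rightarrow> ('d \<Rightarrow> 'r) \<Rightarrow>
    ('k, 'a) module \<Rightarrow> ('r \<Rightarrow> 'a) \<Rightarrow> (('a \<times> 'd) list \<Rightarrow> 'a \<Rightarrow> ('a \<times> 'd) list) \<Rightarrow> bool"
  where "AD_is_coring k R D \<Delta> \<epsilon> A \<eta> \<alpha> \<longleftrightarrow>
    (let C = ADbi R D A \<eta> \<alpha>; CR = AD R D A \<eta>
     in coring k A C (AD_comult R D \<Delta> A \<eta> \<alpha>) (AD_counit \<epsilon> A \<eta>) \<and>
        (\<forall>c\<in>carrier C. \<forall>r\<in>carrier R. ract C c (\<eta> r) = ract CR c r) \<and>
        comodule_map R D CR (AD_coact R D \<Delta> A \<eta>) (tens A C CR) (ADAD_coact R D \<Delta> A \<eta> \<alpha>)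
          (AD_comult R D \<Delta> A \<eta> \<alpha>))"

text \<open>The coaction \<open>A \<rightarrow> A \<otimes>\<^sub>A C \<cong> A \<otimes>\<^sub>R D\<close> corresponding to \<open>\<rho>\<close>\<close>

definition A_coact ::
  "('k, 'r) module \<Rightarrow> ('d, 'r, 'r) bimod \<Rightarrow>
    ('k, 'a) module \<Rightarrow> ('r \<Rightarrow> 'a) \<Rightarrow> ('a \<Rightarrow> ('a \<times> 'd) list) \<Rightarrow>
    (('a \<times> 'd) list \<Rightarrow> 'a \<Rightarrow> ('a \<times> 'd) list) \<Rightarrow> 'a \<Rightarrow> ('a \<times> ('a \<times> 'd) list) list"
  where "A_coact R D A \<eta> \<rho> \<alpha> a =
    tpure A (alg_bimod A id id) (ADbi R D A \<eta> \<alpha>) \<one>\<^bsub>A\<^esub> (\<rho> a)"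

text \<open>\<open>j : D \<rightarrow> A\<close> and \<open>j' : C \<rightarrow> Hom\<^sub>A(A, A)\<close> make the bicomodule \<open>A\<close> cleft.  The last condition but one
  is an equation in \<open>End\<^sup>C(A)\<close>, stated pointwise.\<close>

definition cleaving ::
  "('k, 'r) module \<Rightarrow> ('d, 'r, 'r) bimod \<Rightarrow> ('d \<Rightarrow> ('d \<times> 'd) list) \<Rightarrow> ('d \<Rightarrow> 'r) \<Rightarrow>
    ('k, 'a) module \<Rightarrow> ('r \<Rightarrow> 'a) \<Rightarrow> ('a \<Rightarrow> ('a \<times> 'd) list) \<Rightarrow>
    (('a \<times> 'd) list \<Rightarrow> 'a \<Rightarrow> ('a \<times> 'd) list) \<Rightarrow>
    ('d \<Rightarrow> 'a) \<Rightarrow> (('a \<times> 'd) list \<Rightarrow> 'a \<Rightarrow> 'a) \<Rightarrow> bool"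
  where "cleaving R D \<Delta> \<epsilon> A \<eta> \<rho> \<alpha> j j' \<longleftrightarrow>
    (let C = ADbi R D A \<eta> \<alpha>; \<Delta>C = AD_comult R D \<Delta> A \<eta> \<alpha>;
         \<rho>C = A_coact R D A \<eta> \<rho> \<alpha>; \<Delta>D = AD_coact R D \<Delta> A \<eta>
     in left_linear R D (alg_bimod A \<eta> \<eta>) j \<and>
        comodule_map R D D \<Delta> (alg_bimod A id \<eta>) \<rho> j \<and>
        (\<forall>c\<in>carrier C. right_linear A (alg_bimod A id id) (alg_bimod A id id) (j' c)) \<and>
        (\<forall>c\<in>carrier C. \<forall>c'\<in>carrier C. \<forall>x\<in>carrier A. j' (c \<oplus>\<^bsub>C\<^esub> c') x = j' c x \<oplus>\<^bsub>A\<^esub> j' c' x) \<and>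
        (\<forall>a\<in>carrier A. \<forall>c\<in>carrier C. \<forall>x\<in>carrier A. j' (lact C a c) x = a \<otimes>\<^bsub>A\<^esub> j' c x) \<and>
        (\<forall>c\<in>carrier C. \<forall>r\<in>carrier R. \<forall>x\<in>carrier A.
          j' (ract (AD R D A \<eta>) c r) x = j' c (\<eta> r \<otimes>\<^bsub>A\<^esub> x)) \<and>
        (\<forall>c\<in>carrier C. \<forall>x\<in>carrier A.
          tsum C (\<lambda>c1 c2. ract C c1 (j' c2 x)) (\<Delta>C c) =
          tsum C (\<lambda>x0 x1. lact C (j' c x0) x1) (\<rho>C x)) \<and>
        (\<forall>d\<in>carrier D. \<forall>x\<in>carrier A.
          tsum A (\<lambda>a c. a \<otimes>\<^bsub>A\<^esub> j' c x) (\<rho>C (j d)) = \<eta> (\<epsilon> d) \<otimes>\<^bsub>A\<^esub> x) \<and>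
        (\<forall>c\<in>carrier C.
          tsum C (\<lambda>c1 c2. ract C c1 (tsum A (\<lambda>y d. j' y (j d)) (\<Delta>D c2))) (\<Delta>C c) = c))"

definition cleft_extension ::
  "('k, 'e) ring_scheme \<Rightarrow> ('k, 'r) module \<Rightarrow>
    ('d, 'r, 'r) bimod \<Rightarrow> ('d \<Rightarrow> ('d \<times> 'd) list) \<Rightarrow> ('d \<Rightarrow> 'r) \<Rightarrow>
    ('k, 'a) module \<Rightarrow> ('r \<Rightarrow> 'a) \<Rightarrow> ('a \<Rightarrow> ('a \<times> 'd) list) \<Rightarrow> 'a set \<Rightarrow>
    (('a \<times> 'd) list \<Rightarrow> 'a \<Rightarrow> ('a \<times> 'd) list) \<Rightarrow> bool"
  where "cleft_extension k R D \<Delta> \<epsilon> A \<eta> \<rho> B \<alpha> \<longleftrightarrow>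
    extension_by_coring k R D \<Delta> \<epsilon> A \<eta> \<rho> B \<and>
    AD_is_coring k R D \<Delta> \<epsilon> A \<eta> \<alpha> \<and>
    right_comodule A (ADbi R D A \<eta> \<alpha>) (AD_comult R D \<Delta> A \<eta> \<alpha>) (AD_counit \<epsilon> A \<eta>)
      (alg_bimod A id id) (A_coact R D A \<eta> \<rho> \<alpha>) \<and>
    left_linear R (alg_bimod A \<eta> id) (tens A (alg_bimod A \<eta> id) (ADbi R D A \<eta> \<alpha>))
      (A_coact R D A \<eta> \<rho> \<alpha>) \<and>
    (\<exists>j j'. cleaving R D \<Delta> \<epsilon> A \<eta> \<rho> \<alpha> j j')"


section \<open>Categories and equivalences\<close>

text \<open>Composition and the action of functors on morphisms take the objects as arguments, since
  morphisms (extensional functions) do not determine their domain and codomain modules.\<close>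

record ('o, 'm) cat =
  Obj :: "'o set"
  Hom :: "'o \<Rightarrow> 'o \<Rightarrow> 'm set"
  Id :: "'o \<Rightarrow> 'm"
  Comp :: "'o \<Rightarrow> 'o \<Rightarrow> 'o \<Rightarrow> 'm \<Rightarrow> 'm \<Rightarrow> 'm"  \<comment> \<open>\<open>Comp X Y Z g f\<close> for \<open>f : X \<rightarrow> Y\<close>, \<open>g : Y \<rightarrow> Z\<close>\<close>

locale category =
  fixes \<A> :: "('o, 'm) cat"
  assumes Id_Hom: "X \<in> Obj \<A> \<Longrightarrow> Id \<A> X \<in> Hom \<A> X X"
    and Comp_Hom: "\<lbrakk>X \<in> Obj \<A>; Y \<in> Obj \<A>; Z \<in> Obj \<A>; f \<in> Hom \<A> X Y; g \<in> Hom \<A> Y Z\<rbrakk> \<Longrightarrow>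
      Comp \<A> X Y Z g f \<in> Hom \<A> X Z"
    and Comp_Id: "\<lbrakk>X \<in> Obj \<A>; Y \<in> Obj \<A>; f \<in> Hom \<A> X Y\<rbrakk> \<Longrightarrow> Comp \<A> X X Y f (Id \<A> X) = f"
    and Id_Comp: "\<lbrakk>X \<in> Obj \<A>; Y \<in> Obj \<A>; f \<in> Hom \<A> X Y\<rbrakk> \<Longrightarrow> Comp \<A> X Y Y (Id \<A> Y) f = f"
    and Comp_assoc: "\<lbrakk>X \<in> Obj \<A>; Y \<in> Obj \<A>; Z \<in> Obj \<A>; W \<in> Obj \<A>;
        f \<in> Hom \<A> X Y; g \<in> Hom \<A> Y Z; h \<in> Hom \<A> Z W\<rbrakk> \<Longrightarrow>
      Comp \<A> X Y W (Comp \<A> Y Z W h g) f = Comp \<A> X Z W h (Comp \<A> X Y Z g f)"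

locale functor_between = A: category \<A> + B: category \<B>
  for \<A> :: "('o, 'm) cat" and \<B> :: "('p, 'n) cat"
    and Fo :: "'o \<Rightarrow> 'p" and Fm :: "'o \<Rightarrow> 'o \<Rightarrow> 'm \<Rightarrow> 'n" +
  assumes functor_Obj: "X \<in> Obj \<A> \<Longrightarrow> Fo X \<in> Obj \<B>"
    and functor_Hom: "\<lbrakk>X \<in> Obj \<A>; Y \<in> Obj \<A>; f \<in> Hom \<A> X Y\<rbrakk> \<Longrightarrow> Fm X Y f \<in> Hom \<B> (Fo X) (Fo Y)"
    and functor_Id: "X \<in> Obj \<A> \<Longrightarrow> Fm X X (Id \<A> X) = Id \<B> (Fo X)"
    and functor_Comp: "\<lbrakk>X \<in> Obj \<A>; Y \<in> Obj \<A>; Z \<in> Obj \<A>; f \<in> Hom \<A> X Y; g \<in> Hom \<A> Y Z\<rbrakk> \<Longrightarrow>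
      Fm X Z (Comp \<A> X Y Z g f) = Comp \<B> (Fo X) (Fo Y) (Fo Z) (Fm Y Z g) (Fm X Y f)"

definition isos :: "('o, 'm) cat \<Rightarrow> 'o \<Rightarrow> 'o \<Rightarrow> 'm set"
  where "isos \<A> X Y = {f \<in> Hom \<A> X Y. \<exists>g\<in>Hom \<A> Y X.
    Comp \<A> X Y X g f = Id \<A> X \<and> Comp \<A> Y X Y f g = Id \<A> Y}"

definition natural_iso ::
  "('o, 'm) cat \<Rightarrow> ('p, 'n) cat \<Rightarrow> ('o \<Rightarrow> 'p) \<Rightarrow> ('o \<Rightarrow> 'o \<Rightarrow> 'm \<Rightarrow> 'n) \<Rightarrow>
    ('o \<Rightarrow> 'p) \<Rightarrow> ('o \<Rightarrow> 'o \<Rightarrow> 'm \<Rightarrow> 'n) \<Rightarrow> ('o \<Rightarrow> 'n) \<Rightarrow> bool"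
  where "natural_iso \<A> \<B> Fo Fm Go Gm \<tau> \<longleftrightarrow>
    (\<forall>X\<in>Obj \<A>. \<tau> X \<in> isos \<B> (Fo X) (Go X)) \<and>
    (\<forall>X\<in>Obj \<A>. \<forall>Y\<in>Obj \<A>. \<forall>f\<in>Hom \<A> X Y.
      Comp \<B> (Fo X) (Fo Y) (Go Y) (\<tau> Y) (Fm X Y f) =
      Comp \<B> (Fo X) (Go X) (Go Y) (Gm X Y f) (\<tau> X))"

definition cat_equivalence ::
  "('o, 'm) cat \<Rightarrow> ('p, 'n) cat \<Rightarrow> ('o \<Rightarrow> 'p) \<Rightarrow> ('o \<Rightarrow> 'o \<Rightarrow> 'm \<Rightarrow> 'n) \<Rightarrow> bool"
  where "cat_equivalence \<A> \<B> Fo Fm \<longleftrightarrow>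
    functor_between \<A> \<B> Fo Fm \<and>
    (\<exists>Go Gm \<sigma> \<tau>. functor_between \<B> \<A> Go Gm \<and>
      natural_iso \<A> \<A> (\<lambda>X. X) (\<lambda>X Y f. f) (\<lambda>X. Go (Fo X)) (\<lambda>X Y f. Gm (Fo X) (Fo Y) (Fm X Y f)) \<sigma> \<and>
      natural_iso \<B> \<B> (\<lambda>X. Fo (Go X)) (\<lambda>X Y f. Fm (Go X) (Go Y) (Gm X Y f)) (\<lambda>X. X) (\<lambda>X Y f. f) \<tau>)"


section \<open>Categories of modules and comodules, and the induction functor\<close>

definition mod_cat :: "('s, 'e) ring_scheme \<Rightarrow> (('m, 's) rmod, 'm \<Rightarrow> 'm) cat"
  where "mod_cat S = \<lparr>Obj = {N. right_module S N},
    Hom = (\<lambda>N N'. {f \<in> extensional (carrier N). right_linear S N N' f}),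
    Id = (\<lambda>N. \<lambda>x\<in>carrier N. x),
    Comp = (\<lambda>N N' N'' g f. compose (carrier N) g f)\<rparr>"

definition comod_cat ::
  "('r, 'e) ring_scheme \<Rightarrow> ('d, 'r, 'r) bimod \<Rightarrow> ('d \<Rightarrow> ('d \<times> 'd) list) \<Rightarrow> ('d \<Rightarrow> 'r) \<Rightarrow>
    (('m, 'r) rmod \<times> ('m \<Rightarrow> ('m \<times> 'd) list), 'm \<Rightarrow> 'm) cat"
  where "comod_cat R D \<Delta> \<epsilon> = \<lparr>Obj = {(M, \<rho>). right_comodule R D \<Delta> \<epsilon> M \<rho>},
    Hom = (\<lambda>(M, \<rho>) (M', \<rho>'). {f \<in> extensional (carrier M). comodule_map R D M \<rho> M' \<rho>' f}),
    Id = (\<lambda>(M, \<rho>). \<lambda>x\<in>carrier M. x),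
    Comp = (\<lambda>(M, \<rho>) Y Z g f. compose (carrier M) g f)\<rparr>"

text \<open>No HOL type contains all modules.  The carriers of the modules considered are subsets of the
  following type, which contains an arbitrary type \<open>'x\<close> and is closed under forming (representatives
  of) elements of tensor products with \<open>A\<close>.  As \<open>'x\<close> is arbitrary, every module is isomorphic to one
  with such a carrier.\<close>

datatype ('x, 'a) univ = Atom 'x | Tensor (summands: "(('x, 'a) univ \<times> 'a) list")

text \<open>The induction functor \<open>N \<mapsto> N \<otimes>\<^sub>B A\<close>, with \<open>A\<close> as a \<open>B\<close>-\<open>A\<close> bimodule; the elements of the
  tensor product are tagged by \<^const>\<open>Tensor\<close> so as to lie in the same universe as those of \<open>N\<close>.\<close>

definition ind_mod ::
  "('k, 'a) module \<Rightarrow> 'a set \<Rightarrow> (('x, 'a) univ, 'a) rmod \<Rightarrow> (('x, 'a) univ, 'a) rmod"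
  where "ind_mod A B N =
    (let T = rtens (A\<lparr>carrier := B\<rparr>) N (alg_bimod A id id)
     in \<lparr>carrier = Tensor ` carrier T, mult = undefined, one = undefined, zero = Tensor \<zero>\<^bsub>T\<^esub>,
         add = (\<lambda>x y. Tensor (summands x \<oplus>\<^bsub>T\<^esub> summands y)),
         ract = (\<lambda>x a. Tensor (ract T (summands x) a))\<rparr>)"

text \<open>The coaction \<open>n \<otimes> a \<mapsto> (n \<otimes> a\<^bsup>[0]\<^esup>) \<otimes>\<^sub>A a\<^bsup>[1]\<^esup>\<close> via the second factor, for a right
  coaction \<open>\<sigma> : A \<rightarrow> A \<otimes>\<^sub>A C\<close>\<close>

definition ind_coact ::
  "('k, 'a) module \<Rightarrow> 'a set \<Rightarrow> ('c, 'a, 'a) bimod \<Rightarrow> ('a \<Rightarrow> ('a \<times> 'c) list) \<Rightarrow>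
    (('x, 'a) univ, 'a) rmod \<Rightarrow> ('x, 'a) univ \<Rightarrow> (('x, 'a) univ \<times> 'c) list"
  where "ind_coact A B C \<sigma> N z =
    (let F = ind_mod A B N; FC = rtens A F C
     in tsum FC (\<lambda>n a. tsum FC
          (\<lambda>a0 c. tpure A F C (Tensor (tpure (A\<lparr>carrier := B\<rparr>) N (alg_bimod A id id) n a0)) c) (\<sigma> a))
        (summands z))"

definition ind_obj ::
  "('k, 'a) module \<Rightarrow> 'a set \<Rightarrow> ('c, 'a, 'a) bimod \<Rightarrow> ('a \<Rightarrow> ('a \<times> 'c) list) \<Rightarrow>
    (('x, 'a) univ, 'a) rmod \<Rightarrow>
    (('x, 'a) univ, 'a) rmod \<times> (('x, 'a) univ \<Rightarrow> (('x, 'a) univ \<times> 'c) list)"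
  where "ind_obj A B C \<sigma> N = (ind_mod A B N, ind_coact A B C \<sigma> N)"

definition ind_map ::
  "('k, 'a) module \<Rightarrow> 'a set \<Rightarrow> (('x, 'a) univ, 'a) rmod \<Rightarrow> (('x, 'a) univ, 'a) rmod \<Rightarrow>
    (('x, 'a) univ \<Rightarrow> ('x, 'a) univ) \<Rightarrow> ('x, 'a) univ \<Rightarrow> ('x, 'a) univ"
  where "ind_map A B N N' f = (\<lambda>z\<in>carrier (ind_mod A B N).
    Tensor (tmap (A\<lparr>carrier := B\<rparr>) N' (alg_bimod A id id) f id (summands z)))"

end

theory Submission
  imports Defs "HOL-Algebra.Subrings"
begin

text \<open>The induction functor is left adjoint to the coinvariants functor
  \<open>M \<mapsto> M\<^sup>c\<^sup>o = {m. \<sigma> m = m \<otimes> \<rho> 1}\<close>; the point is that unit and counit are bijective.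
  Put \<open>J c = j' c 1\<close>.  The identity relating \<open>j'\<close> to the coproduct says that \<open>p m = m\<^sub>0 J(m\<^sub>1)\<close> maps any
  comodule \<open>M\<close> into \<open>M\<^sup>c\<^sup>o\<close>, and the last cleaving identity that \<open>j\<close> is a right convolution inverse of
  \<open>J(1 \<otimes> -)\<close>.  Hence \<open>m \<mapsto> p(m\<^sub>0) \<otimes>\<^sub>B j(m\<^sub>1)\<close>, with \<open>m\<^sub>0 \<otimes> m\<^sub>1 \<in> M \<otimes>\<^sub>R D\<close>, inverts the counit
  \<open>M\<^sup>c\<^sup>o \<otimes>\<^sub>B A \<rightarrow> M\<close>.
  As \<open>J(\<rho>(j d)) = \<eta>(\<epsilon> d)\<close>, the \<open>v\<^sub>i\<close> and \<open>d\<^sub>i\<close> yield finitely many \<open>a\<^sub>l \<in> A\<close> and \<open>u\<^sub>l \<in> B\<close> such that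
  \<open>\<Sum> J(\<rho> a\<^sub>l) u\<^sub>l = 1\<close>.  A coinvariant \<open>z = \<Sum> n \<otimes> a\<close> of \<open>N \<otimes>\<^sub>B A\<close> satisfies
  \<open>z J(\<rho> x) = p(z x) = \<Sum> n J(\<rho>(a x)) \<otimes> 1\<close>; taking \<open>x = a\<^sub>l\<close>, multiplying by \<open>u\<^sub>l\<close> and summing
  over \<open>l\<close> shows that \<open>z\<close> is in the image of the unit.\<close>

text \<open>The data live over two base rings: \<open>C\<close>-comodules use tensors over
  \<open>A\<close>, while \<open>j\<close> is defined on \<open>D\<close>, whose tensors are over
  \<open>R\<close>. Two devices bridge this. \<open>kap\<close> extends (c', 1 \<otimes> d) |->
  J(c') j(d) to an \<open>A\<close>-balanced map on pairs from \<open>C\<close>, so that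
  coassociativity of a \<open>C\<close>-comodule applies to it. And left \<open>R\<close>-linearity
  of the coaction of \<open>A\<close> forces \<eta>(R) into \<open>B\<close> (\<open>eta_B\<close>),
  which lets scalars from \<open>R\<close> cross the tensor sign over \<open>B\<close> in the
  inverse of the counit. The pairs (a, u) behind the unit are (j x, v y) for v one of the given maps
  and x \<otimes> y running through a word for \<Delta> d: then \<eta>(\<epsilon> x) v(y) =
  v(\<epsilon>(x) y) sums to v(d). Elements of a tensor product are chosen words without a usable
  normal form. Maps out of it are therefore always \<open>tsum\<close> of a balanced function, and
  equations between additive maps are checked on pure tensors. Coinvariants offer no such
  generators; surjectivity of the unit is therefore drawn from an identity valid for every element
  of the induced module (\<open>ind_pure_unit_inv\<close>).\<close>

section \<open>Tensor products and balanced maps\<close>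

text \<open>These rules turn membership in \<^term>\<open>lists X\<close> into a bounded quantifier, which hides the
  structure that the rules for \<^const>\<open>Cons\<close> and append need.\<close>

declare in_listsD [rule del] in_listsI [rule del]

lemma alg_bimod_simps [simp]:
  "carrier (alg_bimod A f g) = carrier A" "zero (alg_bimod A f g) = zero A"
  "add (alg_bimod A f g) = add A" "ract (alg_bimod A f g) x s = x \<otimes>\<^bsub>A\<^esub> g s"
  "lact (alg_bimod A f g) l x = f l \<otimes>\<^bsub>A\<^esub> x"
  by (simp_all add: alg_bimod_def)

lemma with_ract_simps [simp]:
  "carrier (with_ract M f) = carrier M" "zero (with_ract M f) = zero M"
  "add (with_ract M f) = add M" "ract (with_ract M f) = f" "lact (with_ract M f) = lact M"
  by (simp_all add: with_ract_def)

lemma tens_simps [simp]: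
  "carrier (tens S M N) = carrier (rtens S M N)" "zero (tens S M N) = zero (rtens S M N)"
  "add (tens S M N) = add (rtens S M N)" "ract (tens S M N) = ract (rtens S M N)"
  "lact (tens S M N) l u = trep S M N (map (\<lambda>(m, n). (lact M l m, n)) u)"
  by (simp_all add: tens_def rmod.defs bimod.defs)

section \<open>Finite sums over words of pairs, and additive maps\<close>

lemma tsum_Nil [simp]: "tsum Z f [] = \<zero>\<^bsub>Z\<^esub>"
  and tsum_Cons [simp]: "tsum Z f ((m, n) # u) = f m n \<oplus>\<^bsub>Z\<^esub> tsum Z f u"
  by (simp_all add: tsum_def)

text \<open>Lets one sum be read in structures that differ in carrier or in actions only, such as
  \<open>tens\<close> and \<open>rtens\<close>, or a ring and its restriction to
  \<open>B\<close>.\<close>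

lemma tsum_cong_target:
  "zero Z = zero Z' \<Longrightarrow> add Z = add Z' \<Longrightarrow> tsum Z f u = tsum Z' f u"
  by (simp add: tsum_def)

lemma tsum_tens [simp]: "tsum (tens S M N) f u = tsum (rtens S M N) f u"
  by (rule tsum_cong_target) simp_all

lemma tsum_alg_bimod [simp]: "tsum (alg_bimod A h h') f u = tsum A f u"
  by (rule tsum_cong_target) simp_all

lemma tsum_cong:
  assumes "u \<in> lists (X \<times> Y)" "\<And>x y. x \<in> X \<Longrightarrow> y \<in> Y \<Longrightarrow> f x y = f' x y"
  shows "tsum Z f u = tsum Z f' u"
  using assms(1) by (induction u) (auto simp: assms(2))

lemma tsum_map: "tsum Z f (map (map_prod h h') u) = tsum Z (\<lambda>x y. f (h x) (h' y)) u"
  by (induction u) auto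

lemma tsum_closed:
  assumes "abelian_group Z" "u \<in> lists (X \<times> Y)" "\<And>x y. x \<in> X \<Longrightarrow> y \<in> Y \<Longrightarrow> f x y \<in> carrier Z"
  shows "tsum Z f u \<in> carrier Z"
proof -
  interpret Z: abelian_group Z by fact
  show ?thesis using assms(2) by (induction u) (auto simp: assms(3))
qed

lemma tsum_append:
  assumes "abelian_group Z" "u \<in> lists (X \<times> Y)" "w \<in> lists (X \<times> Y)"
    and "\<And>x y. x \<in> X \<Longrightarrow> y \<in> Y \<Longrightarrow> f x y \<in> carrier Z"
  shows "tsum Z f (u @ w) = tsum Z f u \<oplus>\<^bsub>Z\<^esub> tsum Z f w"
proof -
  interpret Z: abelian_group Z by fact
  note cl = tsum_closed[OF assms(1) _ assms(4), of _ X Y]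
  show ?thesis using assms(2)
  proof (induction u)
    case Nil
    show ?case using cl[OF assms(3)] by simp
  next
    case (Cons a u)
    then obtain m n where "a = (m, n)" "m \<in> X" "n \<in> Y" "u \<in> lists (X \<times> Y)" by auto
    then show ?case using Cons.IH cl[OF assms(3)] cl[of u] assms(4) by (simp add: Z.a_assoc)
  qed
qed

lemma tsum_add_fun:
  assumes "abelian_group Z" "u \<in> lists (X \<times> Y)"
    and "\<And>x y. x \<in> X \<Longrightarrow> y \<in> Y \<Longrightarrow> f x y \<in> carrier Z"
    and "\<And>x y. x \<in> X \<Longrightarrow> y \<in> Y \<Longrightarrow> f' x y \<in> carrier Z"
  shows "tsum Z (\<lambda>x y. f x y \<oplus>\<^bsub>Z\<^esub> f' x y) u = tsum Z f u \<oplus>\<^bsub>Z\<^esub> tsum Z f' u"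
  using assms(2)
proof (induction u)
  interpret Z: abelian_group Z by fact
  case Nil
  show ?case by simp
next
  interpret Z: abelian_group Z by fact
  case (Cons a u)
  then obtain m n where mn: "a = (m, n)" "m \<in> X" "n \<in> Y" and u: "u \<in> lists (X \<times> Y)" by auto
  have "tsum Z f u \<in> carrier Z" "tsum Z f' u \<in> carrier Z"
    using tsum_closed[OF assms(1) u] assms(3,4) by blast+
  then show ?case using mn Cons.IH assms(3,4) by (simp add: Z.a_ac)
qed

lemma tsum_zero_fun:
  "abelian_group Z \<Longrightarrow> tsum Z (\<lambda>x y. \<zero>\<^bsub>Z\<^esub>) u = \<zero>\<^bsub>Z\<^esub>"
proof -
  assume "abelian_group Z"
  then interpret Z: abelian_group Z .
  show ?thesis by (induction u) auto
qed

text \<open>Needed where a sum over a word in A \<otimes> D meets a sum over a coaction, in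
  \<open>counit_counit_inv\<close>.\<close>

lemma tsum_swap:
  assumes Z: "abelian_group Z" and u: "u \<in> lists (X \<times> Y)" and w: "w \<in> lists (V \<times> W)"
    and f: "\<And>x y a b. x \<in> X \<Longrightarrow> y \<in> Y \<Longrightarrow> a \<in> V \<Longrightarrow> b \<in> W \<Longrightarrow> f x y a b \<in> carrier Z"
  shows "tsum Z (\<lambda>x y. tsum Z (f x y) w) u = tsum Z (\<lambda>a b. tsum Z (\<lambda>x y. f x y a b) u) w"
  using u
proof (induction u rule: lists.induct)
  case Nil
  show ?case by (simp add: tsum_zero_fun[OF Z])
next
  case (Cons c u)
  then obtain x y where c: "c = (x, y)" "x \<in> X" "y \<in> Y" by auto
  have "tsum Z (\<lambda>a b. f x y a b \<oplus>\<^bsub>Z\<^esub> tsum Z (\<lambda>x y. f x y a b) u) w =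
      tsum Z (f x y) w \<oplus>\<^bsub>Z\<^esub> tsum Z (\<lambda>a b. tsum Z (\<lambda>x y. f x y a b) u) w"
    by (rule tsum_add_fun[OF Z w]) (simp_all add: f c tsum_closed[OF Z Cons(2)])
  then show ?case using Cons.IH by (simp add: c)
qed

lemma additive_mapD:
  assumes "additive_map M N f"
  shows "x \<in> carrier M \<Longrightarrow> f x \<in> carrier N"
    and "x \<in> carrier M \<Longrightarrow> y \<in> carrier M \<Longrightarrow> f (x \<oplus>\<^bsub>M\<^esub> y) = f x \<oplus>\<^bsub>N\<^esub> f y"
  using assms by (auto simp: additive_map_def)

lemma additive_mapI:
  assumes "\<And>x. x \<in> carrier M \<Longrightarrow> f x \<in> carrier N"
    and "\<And>x y. x \<in> carrier M \<Longrightarrow> y \<in> carrier M \<Longrightarrow> f (x \<oplus>\<^bsub>M\<^esub> y) = f x \<oplus>\<^bsub>N\<^esub> f y"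
  shows "additive_map M N f"
  using assms by (auto simp: additive_map_def)

lemma abelian_group_add_self:
  assumes "abelian_group G" "x \<in> carrier G" "x \<oplus>\<^bsub>G\<^esub> x = x"
  shows "x = \<zero>\<^bsub>G\<^esub>"
proof -
  interpret G: abelian_group G by fact
  have "x = \<ominus>\<^bsub>G\<^esub> x \<oplus>\<^bsub>G\<^esub> (x \<oplus>\<^bsub>G\<^esub> x)" using G.r_neg1[OF assms(2,2)] by simp
  then show ?thesis using G.l_neg[OF assms(2)] unfolding assms(3) by simp
qed

lemma additive_map_zero:
  assumes "abelian_group M" "abelian_group N" "additive_map M N f"
  shows "f \<zero>\<^bsub>M\<^esub> = \<zero>\<^bsub>N\<^esub>"
proof -
  interpret M: abelian_group M by fact
  have "f \<zero>\<^bsub>M\<^esub> \<oplus>\<^bsub>N\<^esub> f \<zero>\<^bsub>M\<^esub> = f \<zero>\<^bsub>M\<^esub>"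
    using additive_mapD(2)[OF assms(3), of "\<zero>\<^bsub>M\<^esub>" "\<zero>\<^bsub>M\<^esub>"] by simp
  then show ?thesis
    using abelian_group_add_self[OF assms(2) additive_mapD(1)[OF assms(3) M.zero_closed]] by simp
qed

lemma additive_map_minus:
  assumes "abelian_group M" "abelian_group N" "additive_map M N f" "x \<in> carrier M"
  shows "f (\<ominus>\<^bsub>M\<^esub> x) = \<ominus>\<^bsub>N\<^esub> f x"
proof -
  interpret M: abelian_group M by fact
  interpret N: abelian_group N by fact
  note f = additive_mapD[OF assms(3)]
  have "f (\<ominus>\<^bsub>M\<^esub> x) \<oplus>\<^bsub>N\<^esub> f x = \<zero>\<^bsub>N\<^esub>"
    using f(2)[of "\<ominus>\<^bsub>M\<^esub> x" x] additive_map_zero[OF assms(1-3)] assms(4) by (simp add: M.l_neg)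
  then show ?thesis using N.minus_equality f(1) assms(4) by simp
qed

lemma additive_map_tsum:
  assumes "abelian_group Z" "abelian_group Z'" "additive_map Z Z' h" "u \<in> lists (X \<times> Y)"
    and "\<And>x y. x \<in> X \<Longrightarrow> y \<in> Y \<Longrightarrow> f x y \<in> carrier Z"
  shows "h (tsum Z f u) = tsum Z' (\<lambda>x y. h (f x y)) u"
  using assms(4)
proof (induction u)
  case Nil then show ?case by (simp add: additive_map_zero[OF assms(1-3)])
next
  case (Cons a u)
  then show ?case using tsum_closed[OF assms(1) _ assms(5), of u]
    by (cases a) (auto simp: additive_mapD(2)[OF assms(3)] assms(5))
qed

lemma additive_map_comp:
  "additive_map M N f \<Longrightarrow> additive_map N P g \<Longrightarrow> additive_map M P (\<lambda>x. g (f x))"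
  by (auto simp: additive_map_def Pi_iff)

lemma abelian_group_cong:
  assumes "abelian_group M" "carrier N = carrier M" "zero N = zero M" "add N = add M"
  shows "abelian_group N"
proof -
  interpret abelian_group M by fact
  show ?thesis
    by (rule abelian_groupI) (auto simp: assms(2-4) a_ac intro: l_neg)
qed

lemma right_module_cong:
  assumes "right_module S M" "carrier M' = carrier M" "zero M' = zero M" "add M' = add M" "ract M' = ract M"
  shows "right_module S M'"
proof -
  interpret M: right_module S M by fact
  interpret M': abelian_group M' by (rule abelian_group_cong[OF M.M.abelian_group_axioms assms(2-4)])
  show ?thesis
    by unfold_locales
      (simp_all add: assms(2-5) M.ract_closed M.ract_add_left M.ract_add_right M.ract_mult M.ract_one)
qed

text \<open>The tensor sign over \<open>L\<close> involves only this structure of the second factor;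
  a right action on that factor matters later, as an outer action on the tensor product.\<close>

locale left_module = L: ring L + N: abelian_group N
  for L :: "('l, 'e) ring_scheme" and N :: "('n, 's, 'l, 'f) bimod_scheme" +
  assumes lact_closed: "\<lbrakk>l \<in> carrier L; x \<in> carrier N\<rbrakk> \<Longrightarrow> lact N l x \<in> carrier N"
    and lact_add_right: "\<lbrakk>l \<in> carrier L; x \<in> carrier N; y \<in> carrier N\<rbrakk> \<Longrightarrow>
      lact N l (x \<oplus>\<^bsub>N\<^esub> y) = lact N l x \<oplus>\<^bsub>N\<^esub> lact N l y"
    and lact_add_left: "\<lbrakk>l \<in> carrier L; l' \<in> carrier L; x \<in> carrier N\<rbrakk> \<Longrightarrow>
      lact N (l \<oplus>\<^bsub>L\<^esub> l') x = lact N l x \<oplus>\<^bsub>N\<^esub> lact N l' x"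
    and lact_mult: "\<lbrakk>l \<in> carrier L; l' \<in> carrier L; x \<in> carrier N\<rbrakk> \<Longrightarrow>
      lact N (l \<otimes>\<^bsub>L\<^esub> l') x = lact N l (lact N l' x)"
    and lact_one: "x \<in> carrier N \<Longrightarrow> lact N \<one>\<^bsub>L\<^esub> x = x"

text \<open>Unlike \<^locale>\<open>bimodule\<close>, this does not involve the ground ring, so that it applies to the
  coinvariants without making them a \<open>k\<close>-algebra.\<close>

locale lr_bimodule = left_module L N + right_module T N
  for L :: "('l, 'e) ring_scheme" and T :: "('t, 'h) ring_scheme"
    and N :: "('n, 't, 'l, 'f) bimod_scheme" +
  assumes lact_ract: "\<lbrakk>l \<in> carrier L; x \<in> carrier N; t \<in> carrier T\<rbrakk> \<Longrightarrow>
      lact N l (ract N x t) = ract N (lact N l x) t"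

lemma (in bimodule) lr_bimodule: "lr_bimodule L S M"
  by unfold_locales (use lact_closed lact_add_right lact_add_left lact_mult lact_one lact_ract in auto)

definition balanced_map ::
  "('s, 'e) ring_scheme \<Rightarrow> ('m, 's, 'f) rmod_scheme \<Rightarrow> ('n, 't, 's, 'g) bimod_scheme \<Rightarrow>
    ('z, 'h) ring_scheme \<Rightarrow> ('m \<Rightarrow> 'n \<Rightarrow> 'z) \<Rightarrow> bool"
  where "balanced_map S M N Z f \<longleftrightarrow>
    (\<forall>n\<in>carrier N. additive_map M Z (\<lambda>m. f m n)) \<and>
    (\<forall>m\<in>carrier M. additive_map N Z (f m)) \<and>
    (\<forall>m\<in>carrier M. \<forall>s\<in>carrier S. \<forall>n\<in>carrier N. f (ract M m s) n = f m (lact N s n))"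

lemma balanced_mapI:
  assumes "\<And>m n. \<lbrakk>m \<in> carrier M; n \<in> carrier N\<rbrakk> \<Longrightarrow> f m n \<in> carrier Z"
    and "\<And>m m' n. \<lbrakk>m \<in> carrier M; m' \<in> carrier M; n \<in> carrier N\<rbrakk> \<Longrightarrow>
      f (m \<oplus>\<^bsub>M\<^esub> m') n = f m n \<oplus>\<^bsub>Z\<^esub> f m' n"
    and "\<And>m n n'. \<lbrakk>m \<in> carrier M; n \<in> carrier N; n' \<in> carrier N\<rbrakk> \<Longrightarrow>
      f m (n \<oplus>\<^bsub>N\<^esub> n') = f m n \<oplus>\<^bsub>Z\<^esub> f m n'"
    and "\<And>m s n. \<lbrakk>m \<in> carrier M; s \<in> carrier S; n \<in> carrier N\<rbrakk> \<Longrightarrow>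
      f (ract M m s) n = f m (lact N s n)"
  shows "balanced_map S M N Z f"
  using assms by (auto simp: balanced_map_def additive_map_def)

lemma balanced_mapD:
  assumes "balanced_map S M N Z f"
  shows "\<And>m n. \<lbrakk>m \<in> carrier M; n \<in> carrier N\<rbrakk> \<Longrightarrow> f m n \<in> carrier Z"
    and "\<And>m m' n. \<lbrakk>m \<in> carrier M; m' \<in> carrier M; n \<in> carrier N\<rbrakk> \<Longrightarrow>
      f (m \<oplus>\<^bsub>M\<^esub> m') n = f m n \<oplus>\<^bsub>Z\<^esub> f m' n"
    and "\<And>m n n'. \<lbrakk>m \<in> carrier M; n \<in> carrier N; n' \<in> carrier N\<rbrakk> \<Longrightarrow>
      f m (n \<oplus>\<^bsub>N\<^esub> n') = f m n \<oplus>\<^bsub>Z\<^esub> f m n'"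
    and "\<And>m s n. \<lbrakk>m \<in> carrier M; s \<in> carrier S; n \<in> carrier N\<rbrakk> \<Longrightarrow>
      f (ract M m s) n = f m (lact N s n)"
    and "\<And>n. n \<in> carrier N \<Longrightarrow> additive_map M Z (\<lambda>m. f m n)"
    and "\<And>m. m \<in> carrier M \<Longrightarrow> additive_map N Z (f m)"
  using assms by (auto simp: balanced_map_def additive_map_def)

section \<open>The abelian group of a tensor product and its universal property\<close>

locale tensor = M: right_module S M + N: left_module S N
  for S :: "('s, 'e) ring_scheme" and M :: "('m, 's, 'f) rmod_scheme"
    and N :: "('n, 't, 's, 'g) bimod_scheme"
begin

abbreviation "PL \<equiv> lists (carrier M \<times> carrier N)"

lemma tens_eq_lists:
  assumes "tens_eq S M N u w"
  shows "u \<in> PL \<and> w \<in> PL"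
  using assms by induction (auto intro: M.ract_closed N.lact_closed)

lemma tens_eq_trep: "w \<in> PL \<Longrightarrow> tens_eq S M N w (trep S M N w)"
  unfolding trep_def by (rule someI) (rule tens_eq.refl)

lemma trep_lists: "w \<in> PL \<Longrightarrow> trep S M N w \<in> PL"
  using tens_eq_trep tens_eq_lists by blast

text \<open>Equivalent words satisfy the same predicate under the choice operator, so the same word
  is chosen for both.\<close>

lemma trep_cong: "tens_eq S M N u w \<Longrightarrow> trep S M N u = trep S M N w"
  unfolding trep_def by (rule arg_cong[where f = Eps]) (blast intro: tens_eq.sym tens_eq.trans)

lemma trep_trep: "w \<in> PL \<Longrightarrow> trep S M N (trep S M N w) = trep S M N w"
  using tens_eq_trep trep_cong by force

lemma rtens_carrierD:
  assumes "u \<in> carrier (rtens S M N)"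
  shows "u \<in> PL" "trep S M N u = u"
  using assms trep_lists trep_trep by (auto simp: rtens_def)

lemma trep_closed: "w \<in> PL \<Longrightarrow> trep S M N w \<in> carrier (rtens S M N)"
  by (simp add: rtens_def)

lemma tpure_closed:
  "m \<in> carrier M \<Longrightarrow> n \<in> carrier N \<Longrightarrow> tpure S M N m n \<in> carrier (rtens S M N)"
  unfolding tpure_def by (rule trep_closed) auto

lemma trep_append:
  assumes "u \<in> PL" "w \<in> PL"
  shows "trep S M N (u @ w) = trep S M N u \<oplus>\<^bsub>rtens S M N\<^esub> trep S M N w"
  using assms by (auto simp: rtens_def intro!: trep_cong tens_eq.append tens_eq_trep)

text \<open>Pairs cancel one at a time: in the induction step (m, n) is commuted past the negatives
  of the tail until it stands next to its own negative.\<close>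

lemma tens_eq_inverse:
  assumes "u \<in> PL"
  shows "tens_eq S M N (map (\<lambda>(m, n). (\<ominus>\<^bsub>M\<^esub> m, n)) u @ u) []"
  using assms
proof (induction u)
  case Nil then show ?case using tens_eq.refl by auto
next
  case (Cons a u)
  obtain m n where a: "a = (m, n)" by force
  then have mn: "m \<in> carrier M" "n \<in> carrier N" and u: "u \<in> PL" using Cons by auto
  let ?u = "map (\<lambda>(m, n). (\<ominus>\<^bsub>M\<^esub> m, n)) u"
  have u': "?u \<in> PL" using u by (induction u) auto
  have "tens_eq S M N [(\<ominus>\<^bsub>M\<^esub> m, n), (m, n)] []"
  proof -
    have "tens_eq S M N [(\<ominus>\<^bsub>M\<^esub> m \<oplus>\<^bsub>M\<^esub> m, n)] [(\<ominus>\<^bsub>M\<^esub> m, n), (m, n)]"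
      using mn by (intro tens_eq.add_left) auto
    moreover have "tens_eq S M N [(\<ominus>\<^bsub>M\<^esub> m \<oplus>\<^bsub>M\<^esub> m, n)] []"
      using mn by (simp add: M.M.l_neg tens_eq.zero)
    ultimately show ?thesis using tens_eq.sym tens_eq.trans by metis
  qed
  moreover have "tens_eq S M N (?u @ [(m, n)] @ u) ([(m, n)] @ ?u @ u)"
    using tens_eq.append[OF tens_eq.commute[of ?u M N "[(m, n)]"] tens_eq.refl[OF u]] u' mn by simp
  ultimately have "tens_eq S M N ([(\<ominus>\<^bsub>M\<^esub> m, n)] @ ?u @ [(m, n)] @ u)
      ([(\<ominus>\<^bsub>M\<^esub> m, n)] @ [(m, n)] @ ?u @ u)"
    using tens_eq.append[OF tens_eq.refl, of "[(\<ominus>\<^bsub>M\<^esub> m, n)]"] mn by fastforce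
  moreover have "tens_eq S M N ([(\<ominus>\<^bsub>M\<^esub> m, n), (m, n)] @ ?u @ u) []"
    using tens_eq.append[OF \<open>tens_eq S M N [(\<ominus>\<^bsub>M\<^esub> m, n), (m, n)] []\<close> Cons.IH] by simp
  ultimately have "tens_eq S M N ([(\<ominus>\<^bsub>M\<^esub> m, n)] @ ?u @ [(m, n)] @ u) []"
    using tens_eq.trans by fastforce
  then show ?case by (simp add: a)
qed

lemma abelian_group_rtens: "abelian_group (rtens S M N)"
proof (rule abelian_groupI)
  have z: "\<zero>\<^bsub>rtens S M N\<^esub> = trep S M N []" by (simp add: rtens_def)
  show "\<zero>\<^bsub>rtens S M N\<^esub> \<in> carrier (rtens S M N)" unfolding z by (rule trep_closed) simp
  fix x assume x: "x \<in> carrier (rtens S M N)"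
  note xl = rtens_carrierD[OF x]
  show "\<zero>\<^bsub>rtens S M N\<^esub> \<oplus>\<^bsub>rtens S M N\<^esub> x = x"
    using trep_append[of "[]" x] xl by (simp add: z)
  let ?y = "map (\<lambda>(m, n). (\<ominus>\<^bsub>M\<^esub> m, n)) x"
  have y: "?y \<in> PL" using xl(1) by (induction x) auto
  then have "trep S M N ?y \<oplus>\<^bsub>rtens S M N\<^esub> x = \<zero>\<^bsub>rtens S M N\<^esub>"
    using trep_append[OF y xl(1)] trep_cong[OF tens_eq_inverse[OF xl(1)]] xl(2) z by simp
  then show "\<exists>y\<in>carrier (rtens S M N). y \<oplus>\<^bsub>rtens S M N\<^esub> x = \<zero>\<^bsub>rtens S M N\<^esub>"
    using trep_closed[OF y] by blast
  fix y assume y: "y \<in> carrier (rtens S M N)"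
  note yl = rtens_carrierD[OF y]
  show xy: "x \<oplus>\<^bsub>rtens S M N\<^esub> y \<in> carrier (rtens S M N)"
    using trep_append[OF xl(1) yl(1)] trep_closed[of "x @ y"] xl yl by auto
  show "x \<oplus>\<^bsub>rtens S M N\<^esub> y = y \<oplus>\<^bsub>rtens S M N\<^esub> x"
    using trep_append[OF xl(1) yl(1)] trep_append[OF yl(1) xl(1)]
      trep_cong[OF tens_eq.commute[OF xl(1) yl(1)]] xl(2) yl(2) by simp
  fix z assume z: "z \<in> carrier (rtens S M N)"
  note zl = rtens_carrierD[OF z]
  have "x @ y \<in> PL" "y @ z \<in> PL" using xl yl zl by auto
  then show "x \<oplus>\<^bsub>rtens S M N\<^esub> y \<oplus>\<^bsub>rtens S M N\<^esub> z = x \<oplus>\<^bsub>rtens S M N\<^esub> (y \<oplus>\<^bsub>rtens S M N\<^esub> z)"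
    using trep_append[OF xl(1) yl(1)] trep_append[OF yl(1) zl(1)]
      trep_append[of "x @ y" z] trep_append[of x "y @ z"] xl yl zl by simp
qed

lemma trep_Cons:
  "m \<in> carrier M \<Longrightarrow> n \<in> carrier N \<Longrightarrow> u \<in> PL \<Longrightarrow>
    trep S M N ((m, n) # u) = tpure S M N m n \<oplus>\<^bsub>rtens S M N\<^esub> trep S M N u"
  using trep_append[of "[(m, n)]" u] by (auto simp: tpure_def)

lemma tsum_tpure_eq_trep: "u \<in> PL \<Longrightarrow> tsum (rtens S M N) (tpure S M N) u = trep S M N u"
proof (induction u rule: lists.induct)
  case Nil
  show ?case by (simp add: rtens_def)
next
  case (Cons a u)
  then show ?case by (auto simp: trep_Cons)
qed

lemma tsum_tpure_self: "u \<in> carrier (rtens S M N) \<Longrightarrow> tsum (rtens S M N) (tpure S M N) u = u"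
  using tsum_tpure_eq_trep[of u] rtens_carrierD[of u] by simp

lemma balanced_tpure: "balanced_map S M N (rtens S M N) (tpure S M N)"
proof (rule balanced_mapI)
  fix m n s assume m: "m \<in> carrier M" and n: "n \<in> carrier N"
  show "tpure S M N m n \<in> carrier (rtens S M N)" using m n by (rule tpure_closed)
  show "tpure S M N (ract M m s) n = tpure S M N m (lact N s n)" if "s \<in> carrier S"
    unfolding tpure_def using m n that by (intro trep_cong tens_eq.balanced)
next
  fix m m' n assume a: "m \<in> carrier M" "m' \<in> carrier M" "n \<in> carrier N"
  show "tpure S M N (m \<oplus>\<^bsub>M\<^esub> m') n = tpure S M N m n \<oplus>\<^bsub>rtens S M N\<^esub> tpure S M N m' n"
    unfolding tpure_def using trep_append[of "[(m, n)]" "[(m', n)]"] trep_cong[OF tens_eq.add_left] a by simp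
next
  fix m n n' assume a: "m \<in> carrier M" "n \<in> carrier N" "n' \<in> carrier N"
  show "tpure S M N m (n \<oplus>\<^bsub>N\<^esub> n') = tpure S M N m n \<oplus>\<^bsub>rtens S M N\<^esub> tpure S M N m n'"
    unfolding tpure_def using trep_append[of "[(m, n)]" "[(m, n')]"] trep_cong[OF tens_eq.add_right] a by simp
qed

lemmas tpure_add_left = balanced_mapD(2)[OF balanced_tpure]
  and tpure_add_right = balanced_mapD(3)[OF balanced_tpure]
  and tpure_balanced = balanced_mapD(4)[OF balanced_tpure]

text \<open>The universal property of the tensor product: each generating relation of
  \<open>tens_eq\<close> is respected by a balanced function. The relation \<open>zero\<close> uses
  that an additive map of groups preserves zero.\<close>

lemma tsum_tens_eq:
  assumes "abelian_group Z" "balanced_map S M N Z f" "tens_eq S M N u w"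
  shows "tsum Z f u = tsum Z f w"
  using assms(3)
proof induction
  interpret Z: abelian_group Z by fact
  note f = balanced_mapD[OF assms(2)]
  note app = tsum_append[OF assms(1) _ _ f(1)]
  note cl = tsum_closed[OF assms(1) _ f(1)]
  {
    case (append u u' w w')
    have "u \<in> PL" "u' \<in> PL" "w \<in> PL" "w' \<in> PL"
      using tens_eq_lists[OF append(1)] tens_eq_lists[OF append(2)] by simp_all
    then show ?case using append.IH by (simp add: app)
  next
    case (commute u w)
    then show ?case by (simp add: app Z.a_comm cl)
  next
    case (zero n)
    have "f \<zero>\<^bsub>M\<^esub> n = \<zero>\<^bsub>Z\<^esub>"
      using additive_map_zero[OF M.M.abelian_group_axioms assms(1) f(5)[OF zero]] .
    then show ?case by simp
  next
    case (add_left m m' n)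
    then show ?case by (simp add: f Z.a_assoc)
  next
    case (add_right m n n')
    then show ?case by (simp add: f Z.a_assoc)
  next
    case (balanced m s n)
    then show ?case by (simp add: f)
  }
qed simp_all

lemma tsum_trep:
  assumes "abelian_group Z" "balanced_map S M N Z f" "u \<in> PL"
  shows "tsum Z f (trep S M N u) = tsum Z f u"
  using tsum_tens_eq[OF assms(1,2) tens_eq_trep[OF assms(3)]] by simp

lemma tsum_tpure:
  assumes "abelian_group Z" "balanced_map S M N Z f" "m \<in> carrier M" "n \<in> carrier N"
  shows "tsum Z f (tpure S M N m n) = f m n"
proof -
  interpret Z: abelian_group Z by fact
  show ?thesis unfolding tpure_def
    using tsum_trep[OF assms(1,2), of "[(m, n)]"] assms(3,4) balanced_mapD(1)[OF assms(2)] by auto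
qed

lemma additive_tsum:
  assumes "abelian_group Z" "balanced_map S M N Z f"
  shows "additive_map (rtens S M N) Z (tsum Z f)"
proof (rule additive_mapI)
  note f = balanced_mapD[OF assms(2)]
  fix u assume "u \<in> carrier (rtens S M N)"
  note u = rtens_carrierD[OF this]
  show "tsum Z f u \<in> carrier Z" by (rule tsum_closed[OF assms(1) u(1) f(1)])
  fix w assume "w \<in> carrier (rtens S M N)"
  note w = rtens_carrierD[OF this]
  have uw: "u @ w \<in> PL" using u w by simp
  show "tsum Z f (u \<oplus>\<^bsub>rtens S M N\<^esub> w) = tsum Z f u \<oplus>\<^bsub>Z\<^esub> tsum Z f w"
    using tsum_trep[OF assms uw] tsum_append[where f = f, OF assms(1) u(1) w(1) f(1)] trep_append[OF u(1) w(1)] u(2) w(2)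
    by simp
qed

lemma tsum_in_carrier:
  assumes "abelian_group Z" "balanced_map S M N Z f" "u \<in> carrier (rtens S M N)"
  shows "tsum Z f u \<in> carrier Z"
  using additive_mapD(1)[OF additive_tsum[OF assms(1,2)] assms(3)] .

lemma tsum_cong_carrier:
  assumes "u \<in> carrier (rtens S M N)" "\<And>m n. m \<in> carrier M \<Longrightarrow> n \<in> carrier N \<Longrightarrow> f m n = f' m n"
  shows "tsum Z f u = tsum Z f' u"
  using tsum_cong[OF rtens_carrierD(1)[OF assms(1)] assms(2)] .

lemma additive_map_tsum_carrier:
  assumes "abelian_group Z" "abelian_group Z'" "additive_map Z Z' h" "u \<in> carrier (rtens S M N)"
    and "\<And>m n. m \<in> carrier M \<Longrightarrow> n \<in> carrier N \<Longrightarrow> f m n \<in> carrier Z"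
  shows "h (tsum Z f u) = tsum Z' (\<lambda>x y. h (f x y)) u"
  using additive_map_tsum[OF assms(1-3) rtens_carrierD(1)[OF assms(4)] assms(5)] .

lemma additive_map_expand:
  assumes "abelian_group Z" "additive_map (rtens S M N) Z h" "u \<in> carrier (rtens S M N)"
  shows "h u = tsum Z (\<lambda>m n. h (tpure S M N m n)) u"
  using additive_map_tsum_carrier[where f = "tpure S M N", OF abelian_group_rtens assms(1,2,3) tpure_closed]
    tsum_tpure_self[OF assms(3)] by simp

text \<open>Each element is the sum of the pure tensors of its own word, so pure tensors generate.
  Nearly all identities in tensor products below are reduced to generators by this rule.\<close>

lemma additive_map_eqI:
  assumes "abelian_group Z" "additive_map (rtens S M N) Z h" "additive_map (rtens S M N) Z h'"
    and "\<And>m n. m \<in> carrier M \<Longrightarrow> n \<in> carrier N \<Longrightarrow> h (tpure S M N m n) = h' (tpure S M N m n)"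
    and u: "u \<in> carrier (rtens S M N)"
  shows "h u = h' u"
  using additive_map_expand[OF assms(1,2) u] additive_map_expand[OF assms(1,3) u]
    tsum_cong_carrier[where Z = Z, OF u assms(4)] by simp

lemma tmap_eq_tsum:
  assumes "u \<in> lists (X \<times> Y)" "\<And>x. x \<in> X \<Longrightarrow> f x \<in> carrier M" "\<And>y. y \<in> Y \<Longrightarrow> g y \<in> carrier N"
  shows "tmap S M N f g u = tsum (rtens S M N) (\<lambda>x y. tpure S M N (f x) (g y)) u"
proof -
  have "map (map_prod f g) u \<in> PL" using assms(1) by (induction u) (auto simp: assms)
  then show ?thesis
    using tsum_tpure_eq_trep tsum_map[of "rtens S M N" "tpure S M N" f g u] by (simp add: tmap_def)
qed

lemma tsum_tmap:
  assumes "abelian_group Z" "balanced_map S M N Z F"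
    and "u \<in> lists (X \<times> Y)" "\<And>x. x \<in> X \<Longrightarrow> f x \<in> carrier M" "\<And>y. y \<in> Y \<Longrightarrow> g y \<in> carrier N"
  shows "tsum Z F (tmap S M N f g u) = tsum Z (\<lambda>x y. F (f x) (g y)) u"
proof -
  have "map (map_prod f g) u \<in> PL" using assms(3) by (induction u) (auto simp: assms)
  then show ?thesis using tsum_trep[OF assms(1,2)] by (simp add: tmap_def tsum_map)
qed

lemma trep_map_eq_tsum:
  assumes "u \<in> PL" "\<And>m n. m \<in> carrier M \<Longrightarrow> n \<in> carrier N \<Longrightarrow> f m \<in> carrier M \<and> g n \<in> carrier N"
  shows "trep S M N (map (\<lambda>(m, n). (f m, g n)) u) = tsum (rtens S M N) (\<lambda>m n. tpure S M N (f m) (g n)) u"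
  using assms(1)
proof (induction u rule: lists.induct)
  case Nil
  show ?case by (simp add: rtens_def)
next
  case (Cons a u)
  then obtain m n where a: "a = (m, n)" "m \<in> carrier M" "n \<in> carrier N" by auto
  have "map (\<lambda>(m, n). (f m, g n)) u \<in> PL"
    using Cons(2) by (induction u rule: lists.induct) (auto simp: assms(2))
  then show ?case using a Cons.IH assms(2) by (simp add: trep_Cons)
qed

end

section \<open>Outer actions on a tensor product\<close>

locale tensor_right = tensor S M N + lr_bimodule S T N
  for S :: "('s, 'e) ring_scheme" and T :: "('t, 'h) ring_scheme"
    and M :: "('m, 's, 'f) rmod_scheme" and N :: "('n, 't, 's, 'g) bimod_scheme"
begin

lemma balanced_ract:
  "t \<in> carrier T \<Longrightarrow> balanced_map S M N (rtens S M N) (\<lambda>m n. tpure S M N m (ract N n t))"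
  by (rule balanced_mapI)
    (auto simp: tpure_closed ract_closed ract_add_left tpure_add_left tpure_add_right tpure_balanced lact_ract)

text \<open>The action is defined on the chosen word. Rewriting it as the sum of a balanced function
  brings it under the universal property, which yields its additivity and its value on pure
  tensors.\<close>

lemma rtens_ract:
  assumes "u \<in> carrier (rtens S M N)" "t \<in> carrier T"
  shows "ract (rtens S M N) u t = tsum (rtens S M N) (\<lambda>m n. tpure S M N m (ract N n t)) u"
  using trep_map_eq_tsum[of u "\<lambda>m. m" "\<lambda>n. ract N n t"] rtens_carrierD[OF assms(1)] assms(2)
  by (simp add: rtens_def ract_closed)

lemma tpure_ract:
  assumes "m \<in> carrier M" "n \<in> carrier N" "t \<in> carrier T"
  shows "ract (rtens S M N) (tpure S M N m n) t = tpure S M N m (ract N n t)"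
  using tsum_tpure[OF abelian_group_rtens balanced_ract] rtens_ract[OF tpure_closed] assms by simp

lemma additive_ract:
  assumes "t \<in> carrier T"
  shows "additive_map (rtens S M N) (rtens S M N) (\<lambda>u. ract (rtens S M N) u t)"
proof (rule additive_mapI)
  note ad = additive_tsum[OF abelian_group_rtens balanced_ract[OF assms]]
  note ag = abelian_monoid.a_closed[OF abelian_group.axioms(1)[OF abelian_group_rtens]]
  fix u assume u: "u \<in> carrier (rtens S M N)"
  show "ract (rtens S M N) u t \<in> carrier (rtens S M N)"
    using additive_mapD(1)[OF ad u] rtens_ract[OF u assms] by simp
  fix w assume w: "w \<in> carrier (rtens S M N)"
  show "ract (rtens S M N) (u \<oplus>\<^bsub>rtens S M N\<^esub> w) t =
      ract (rtens S M N) u t \<oplus>\<^bsub>rtens S M N\<^esub> ract (rtens S M N) w t"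
    using additive_mapD(2)[OF ad u w] rtens_ract[OF _ assms] u w ag[OF u w] by simp
qed

text \<open>Every module axiom, for fixed scalars, equates two additive maps and so follows from the
  same axiom of \<open>N\<close> on pure tensors.\<close>

lemma right_module_rtens: "right_module T (rtens S M N)"
proof -
  interpret P: abelian_group "rtens S M N" by (rule abelian_group_rtens)
  show ?thesis
  proof
    fix x s assume x: "x \<in> carrier (rtens S M N)" and s: "s \<in> carrier T"
    note adD = additive_mapD[OF additive_ract]
    show "ract (rtens S M N) x s \<in> carrier (rtens S M N)" using adD(1)[OF s x] .
    show "ract (rtens S M N) (x \<oplus>\<^bsub>rtens S M N\<^esub> y) s =
      ract (rtens S M N) x s \<oplus>\<^bsub>rtens S M N\<^esub> ract (rtens S M N) y s"
      if "y \<in> carrier (rtens S M N)" for y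
      using adD(2)[OF s x that] .
    fix t assume t: "t \<in> carrier T"
    have "additive_map (rtens S M N) (rtens S M N)
        (\<lambda>x. ract (rtens S M N) x s \<oplus>\<^bsub>rtens S M N\<^esub> ract (rtens S M N) x t)"
      by (rule additive_mapI) (auto simp: adD s t P.a_ac)
    from additive_map_eqI[OF P.abelian_group_axioms additive_ract this, of "s \<oplus>\<^bsub>T\<^esub> t", OF _ _ x]
    show "ract (rtens S M N) x (s \<oplus>\<^bsub>T\<^esub> t) =
        ract (rtens S M N) x s \<oplus>\<^bsub>rtens S M N\<^esub> ract (rtens S M N) x t"
      using s t by (simp add: tpure_ract ract_add_right ract_closed tpure_add_right)
    from additive_map_eqI[OF P.abelian_group_axioms additive_ract
        additive_map_comp[OF additive_ract[OF s] additive_ract[OF t]], of "s \<otimes>\<^bsub>T\<^esub> t", OF _ _ x]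
    show "ract (rtens S M N) x (s \<otimes>\<^bsub>T\<^esub> t) = ract (rtens S M N) (ract (rtens S M N) x s) t"
      using s t by (simp add: tpure_ract ract_mult ract_closed)
  next
    fix x assume x: "x \<in> carrier (rtens S M N)"
    have "additive_map (rtens S M N) (rtens S M N) (\<lambda>x. x)" by (rule additive_mapI) auto
    from additive_map_eqI[OF P.abelian_group_axioms additive_ract this, of "\<one>\<^bsub>T\<^esub>", OF _ _ x]
    show "ract (rtens S M N) x \<one>\<^bsub>T\<^esub> = x" by (simp add: tpure_ract ract_one)
  qed
qed

end

locale tensor_left = lr_bimodule L S M + tensor S M N
  for L :: "('l, 'i) ring_scheme" and S :: "('s, 'e) ring_scheme"
    and M :: "('m, 's, 'l, 'f) bimod_scheme" and N :: "('n, 't, 's, 'g) bimod_scheme"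
begin

lemma balanced_lact:
  "l \<in> carrier L \<Longrightarrow> balanced_map S M N (rtens S M N) (\<lambda>m n. tpure S M N (lact M l m) n)"
  by (rule balanced_mapI)
    (auto simp: tpure_closed lact_closed lact_add_right tpure_add_left tpure_add_right
      tpure_balanced lact_ract)

lemma tens_lact:
  assumes "u \<in> carrier (rtens S M N)" "l \<in> carrier L"
  shows "lact (tens S M N) l u = tsum (rtens S M N) (\<lambda>m n. tpure S M N (lact M l m) n) u"
  using trep_map_eq_tsum[of u "lact M l" "\<lambda>n. n"] rtens_carrierD[OF assms(1)] assms(2)
  by (simp add: lact_closed)

lemma tpure_lact:
  assumes "m \<in> carrier M" "n \<in> carrier N" "l \<in> carrier L"
  shows "lact (tens S M N) l (tpure S M N m n) = tpure S M N (lact M l m) n"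
  using tsum_tpure[OF abelian_group_rtens balanced_lact] tens_lact[OF tpure_closed] assms
  by (simp del: tens_simps)

text \<open>A balanced sum does not notice the renormalisation by \<open>trep\<close>, so the scalar
  can be carried into the first argument.\<close>

lemma tsum_lact:
  assumes "abelian_group Z" "balanced_map S M N Z h" "u \<in> carrier (rtens S M N)" "l \<in> carrier L"
  shows "tsum Z h (lact (tens S M N) l u) = tsum Z (\<lambda>m n. h (lact M l m) n) u"
proof -
  note u = rtens_carrierD[OF assms(3)]
  have "map (\<lambda>(m, n). (lact M l m, n)) u \<in> PL"
    using u(1) by (induction u rule: lists.induct) (auto simp: lact_closed assms(4))
  then show ?thesis
    using tsum_trep[OF assms(1,2)] tsum_map[of Z h "lact M l" "\<lambda>n. n" u]
    by (simp add: map_prod_def)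
qed

lemma additive_lact:
  assumes "l \<in> carrier L"
  shows "additive_map (rtens S M N) (rtens S M N) (\<lambda>u. lact (tens S M N) l u)"
proof (rule additive_mapI)
  note ad = additive_tsum[OF abelian_group_rtens balanced_lact[OF assms]]
  note ag = abelian_monoid.a_closed[OF abelian_group.axioms(1)[OF abelian_group_rtens]]
  fix u assume u: "u \<in> carrier (rtens S M N)"
  show "lact (tens S M N) l u \<in> carrier (rtens S M N)"
    using additive_mapD(1)[OF ad u] tens_lact[OF u assms] by (simp del: tens_simps)
  fix w assume w: "w \<in> carrier (rtens S M N)"
  show "lact (tens S M N) l (u \<oplus>\<^bsub>rtens S M N\<^esub> w) =
      lact (tens S M N) l u \<oplus>\<^bsub>rtens S M N\<^esub> lact (tens S M N) l w"
    using additive_mapD(2)[OF ad u w] tens_lact[OF _ assms] u w ag[OF u w] by (simp del: tens_simps)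
qed

lemma left_module_tens: "left_module L (tens S M N)"
proof -
  interpret P: abelian_group "rtens S M N" by (rule abelian_group_rtens)
  interpret P': abelian_group "tens S M N"
    by (rule abelian_group_cong[OF P.abelian_group_axioms]) simp_all
  show ?thesis
  proof (unfold_locales, unfold tens_simps(1-4))
    fix l x assume x: "x \<in> carrier (rtens S M N)" and l: "l \<in> carrier L"
    note adD = additive_mapD[OF additive_lact]
    show "lact (tens S M N) l x \<in> carrier (rtens S M N)" using adD(1)[OF l x] .
    show "lact (tens S M N) l (x \<oplus>\<^bsub>rtens S M N\<^esub> y) =
      lact (tens S M N) l x \<oplus>\<^bsub>rtens S M N\<^esub> lact (tens S M N) l y"
      if "y \<in> carrier (rtens S M N)" for y
      using adD(2)[OF l x that] .
    fix l' assume l': "l' \<in> carrier L"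
    have "additive_map (rtens S M N) (rtens S M N)
        (\<lambda>x. lact (tens S M N) l x \<oplus>\<^bsub>rtens S M N\<^esub> lact (tens S M N) l' x)"
      by (rule additive_mapI) (auto simp: adD l l' P.a_ac simp del: tens_simps)
    from additive_map_eqI[OF P.abelian_group_axioms additive_lact this, of "l \<oplus>\<^bsub>L\<^esub> l'", OF _ _ x]
    show "lact (tens S M N) (l \<oplus>\<^bsub>L\<^esub> l') x =
        lact (tens S M N) l x \<oplus>\<^bsub>rtens S M N\<^esub> lact (tens S M N) l' x"
      using l l' by (simp add: tpure_lact lact_add_left lact_closed tpure_add_left del: tens_simps)
    from additive_map_eqI[OF P.abelian_group_axioms additive_lact
        additive_map_comp[OF additive_lact[OF l'] additive_lact[OF l]], of "l \<otimes>\<^bsub>L\<^esub> l'", OF _ _ x]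
    show "lact (tens S M N) (l \<otimes>\<^bsub>L\<^esub> l') x = lact (tens S M N) l (lact (tens S M N) l' x)"
      using l l' by (simp add: tpure_lact lact_mult lact_closed del: tens_simps)
  next
    fix x assume x: "x \<in> carrier (rtens S M N)"
    have "additive_map (rtens S M N) (rtens S M N) (\<lambda>x. x)" by (rule additive_mapI) auto
    from additive_map_eqI[OF P.abelian_group_axioms additive_lact this, of "\<one>\<^bsub>L\<^esub>", OF _ _ x]
    show "lact (tens S M N) \<one>\<^bsub>L\<^esub> x = x" by (simp add: tpure_lact lact_one del: tens_simps)
  qed
qed

end

lemma right_linear_comp:
  "right_linear S M N f \<Longrightarrow> right_linear S N P g \<Longrightarrow> right_linear S M P (\<lambda>x. g (f x))"
  by (auto simp: right_linear_def intro: additive_map_comp dest: additive_mapD)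

lemma right_linear_cong:
  assumes "\<And>x. x \<in> carrier M \<Longrightarrow> f x = g x" "right_module S M"
  shows "right_linear S M N f \<longleftrightarrow> right_linear S M N g"
proof -
  interpret right_module S M by fact
  show ?thesis by (auto simp: right_linear_def additive_map_def Pi_iff assms(1) ract_closed)
qed

section \<open>Coassociativity on balanced maps\<close>

text \<open>The functions of three arguments that Sweedler notation allows on M \<otimes> N
  \<otimes> P; one conjunct for each of the two tensor signs.\<close>

definition balanced_map3 ::
  "('s, 'e) ring_scheme \<Rightarrow> ('t, 'h) ring_scheme \<Rightarrow> ('m, 's, 'f) rmod_scheme \<Rightarrow>
    ('n, 't, 's, 'g) bimod_scheme \<Rightarrow> ('p, 'v, 't, 'i) bimod_scheme \<Rightarrow> ('z, 'j) ring_scheme \<Rightarrow>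
    ('m \<Rightarrow> 'n \<Rightarrow> 'p \<Rightarrow> 'z) \<Rightarrow> bool"
  where "balanced_map3 S T M N P Z f \<longleftrightarrow>
    (\<forall>p\<in>carrier P. balanced_map S M N Z (\<lambda>m n. f m n p)) \<and>
    (\<forall>m\<in>carrier M. balanced_map T N P Z (f m))"

locale tensor3 = tensor_right S T M N + P: left_module T P
  for S :: "('s, 'e) ring_scheme" and T :: "('t, 'h) ring_scheme"
    and M :: "('m, 's, 'f) rmod_scheme" and N :: "('n, 't, 's, 'g) bimod_scheme"
    and P :: "('p, 'v, 't, 'i) bimod_scheme"
begin

sublocale NP: tensor_left S T N P ..

sublocale NP': left_module S "tens T N P" by (rule NP.left_module_tens)

sublocale MNP: tensor S M "tens T N P" ..

sublocale MN': right_module T "rtens S M N" by (rule right_module_rtens)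

sublocale MNP': tensor T "rtens S M N" P ..

text \<open>Together with \<open>balanced_map3_left\<close> this makes the sum of \<open>f\<close>
  well defined for either bracketing of the triple tensor product.\<close>

lemma balanced_map3_right:
  assumes "abelian_group Z" "balanced_map3 S T M N P Z f"
  shows "balanced_map S M (tens T N P) Z (\<lambda>m w. tsum Z (f m) w)"
proof (rule balanced_mapI, unfold tens_simps(1-4))
  note l = balanced_mapD[OF assms(2)[unfolded balanced_map3_def, THEN conjunct1, rule_format]]
  note r = assms(2)[unfolded balanced_map3_def, THEN conjunct2, rule_format]
  note rD = balanced_mapD[OF r]
  fix m w assume m: "m \<in> carrier M" and w: "w \<in> carrier (rtens T N P)"
  show "tsum Z (f m) w \<in> carrier Z" by (rule NP.tsum_in_carrier[OF assms(1) r[OF m] w])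
  show "tsum Z (f (m \<oplus>\<^bsub>M\<^esub> m')) w = tsum Z (f m) w \<oplus>\<^bsub>Z\<^esub> tsum Z (f m') w" if "m' \<in> carrier M" for m'
  proof -
    have "tsum Z (f (m \<oplus>\<^bsub>M\<^esub> m')) w = tsum Z (\<lambda>n p. f m n p \<oplus>\<^bsub>Z\<^esub> f m' n p) w"
      by (rule NP.tsum_cong_carrier[OF w]) (simp add: l(2) m that)
    also have "\<dots> = tsum Z (f m) w \<oplus>\<^bsub>Z\<^esub> tsum Z (f m') w"
      by (rule tsum_add_fun[OF assms(1) NP.rtens_carrierD(1)[OF w] rD(1)[OF m] rD(1)[OF that]])
    finally show ?thesis .
  qed
  show "tsum Z (f m) (w \<oplus>\<^bsub>rtens T N P\<^esub> w') = tsum Z (f m) w \<oplus>\<^bsub>Z\<^esub> tsum Z (f m) w'"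
    if "w' \<in> carrier (rtens T N P)" for w'
    by (rule additive_mapD(2)[OF NP.additive_tsum[OF assms(1) r[OF m]] w that])
  show "tsum Z (f (ract M m s)) w = tsum Z (f m) (lact (tens T N P) s w)" if s: "s \<in> carrier S" for s
    unfolding NP.tsum_lact[OF assms(1) r[OF m] w s]
    by (rule NP.tsum_cong_carrier[OF w]) (simp add: l(4) m s)
qed

lemma balanced_map3_left:
  assumes "abelian_group Z" "balanced_map3 S T M N P Z f"
  shows "balanced_map T (rtens S M N) P Z (\<lambda>u p. tsum Z (\<lambda>m n. f m n p) u)"
proof (rule balanced_mapI)
  note l = assms(2)[unfolded balanced_map3_def, THEN conjunct1, rule_format]
  note lD = balanced_mapD[OF l]
  note r = assms(2)[unfolded balanced_map3_def, THEN conjunct2, rule_format]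
  note rD = balanced_mapD[OF r]
  fix u p assume u: "u \<in> carrier (rtens S M N)" and p: "p \<in> carrier P"
  show "tsum Z (\<lambda>m n. f m n p) u \<in> carrier Z" by (rule tsum_in_carrier[OF assms(1) l[OF p] u])
  show "tsum Z (\<lambda>m n. f m n (p \<oplus>\<^bsub>P\<^esub> p')) u = tsum Z (\<lambda>m n. f m n p) u \<oplus>\<^bsub>Z\<^esub> tsum Z (\<lambda>m n. f m n p') u"
    if p': "p' \<in> carrier P" for p'
  proof -
    have "tsum Z (\<lambda>m n. f m n (p \<oplus>\<^bsub>P\<^esub> p')) u = tsum Z (\<lambda>m n. f m n p \<oplus>\<^bsub>Z\<^esub> f m n p') u"
      by (rule tsum_cong_carrier[OF u]) (simp add: rD(3) p p')
    also have "\<dots> = tsum Z (\<lambda>m n. f m n p) u \<oplus>\<^bsub>Z\<^esub> tsum Z (\<lambda>m n. f m n p') u"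
      by (rule tsum_add_fun[OF assms(1) rtens_carrierD(1)[OF u] lD(1)[OF p] lD(1)[OF p']])
    finally show ?thesis .
  qed
  show "tsum Z (\<lambda>m n. f m n p) (u \<oplus>\<^bsub>rtens S M N\<^esub> u') =
      tsum Z (\<lambda>m n. f m n p) u \<oplus>\<^bsub>Z\<^esub> tsum Z (\<lambda>m n. f m n p) u'"
    if "u' \<in> carrier (rtens S M N)" for u'
    by (rule additive_mapD(2)[OF additive_tsum[OF assms(1) l[OF p]] u that])
  fix t assume t: "t \<in> carrier T"
  have "tsum Z (\<lambda>m n. f m n p) (ract (rtens S M N) u t) =
      tsum Z (\<lambda>m n. tsum Z (\<lambda>m n. f m n p) (tpure S M N m (ract N n t))) u"
    unfolding rtens_ract[OF u t]
    by (rule additive_map_tsum_carrier[OF abelian_group_rtens assms(1)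
          additive_tsum[OF assms(1) l[OF p]] u]) (simp add: tpure_closed ract_closed t)
  also have "\<dots> = tsum Z (\<lambda>m n. f m n (lact P t p)) u"
    by (rule tsum_cong_carrier[OF u])
      (simp add: tsum_tpure[OF assms(1) l[OF p]] rD(4) ract_closed t p)
  finally show "tsum Z (\<lambda>m n. f m n p) (ract (rtens S M N) u t) = tsum Z (\<lambda>m n. f m n (lact P t p)) u" .
qed

lemma balanced_map3_tpure:
  "balanced_map3 S T M N P (rtens S M (tens T N P))
    (\<lambda>m n p. tpure S M (tens T N P) m (tpure T N P n p))"
proof -
  have c: "tpure T N P n p \<in> carrier (tens T N P)" if "n \<in> carrier N" "p \<in> carrier P" for n p
    using that by (simp add: NP.tpure_closed)
  have a: "tpure S M (tens T N P) m (x \<oplus>\<^bsub>rtens T N P\<^esub> y) =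
      tpure S M (tens T N P) m x \<oplus>\<^bsub>rtens S M (tens T N P)\<^esub> tpure S M (tens T N P) m y"
    if "m \<in> carrier M" "x \<in> carrier (tens T N P)" "y \<in> carrier (tens T N P)" for m x y
    using MNP.tpure_add_right[OF that] by simp
  have b: "tpure S M (tens T N P) (ract M m s) (tpure T N P n p) =
      tpure S M (tens T N P) m (tpure T N P (lact N s n) p)"
    if "m \<in> carrier M" "s \<in> carrier S" "n \<in> carrier N" "p \<in> carrier P" for m n p s
    using MNP.tpure_balanced[OF that(1,2) c[OF that(3,4)]] NP.tpure_lact[OF that(3,4,2)] by simp
  show ?thesis
    unfolding balanced_map3_def
    by (intro conjI ballI balanced_mapI)
      (simp_all only: MNP.tpure_closed MNP.tpure_add_left c a b N.N.a_closed NP.tpure_add_left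
        NP.tpure_add_right NP.tpure_balanced)
qed

lemma additive_tassoc:
  "additive_map (rtens T (rtens S M N) P) (rtens S M (tens T N P)) (tassoc S T M N P)"
  unfolding tassoc_def Let_def
  by (rule MNP'.additive_tsum[OF MNP.abelian_group_rtens
      balanced_map3_left[OF MNP.abelian_group_rtens balanced_map3_tpure]])

lemma tassoc_tpure:
  assumes "m \<in> carrier M" "n \<in> carrier N" "p \<in> carrier P"
  shows "tassoc S T M N P (tpure T (rtens S M N) P (tpure S M N m n) p) =
    tpure S M (tens T N P) m (tpure T N P n p)"
  unfolding tassoc_def Let_def
    MNP'.tsum_tpure[OF MNP.abelian_group_rtens
      balanced_map3_left[OF MNP.abelian_group_rtens balanced_map3_tpure] tpure_closed[OF assms(1,2)] assms(3)]
  using balanced_map3_tpure assms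
  by (intro tsum_tpure[OF MNP.abelian_group_rtens]) (simp_all add: balanced_map3_def)

text \<open>Two reductions to generators: from w to u \<otimes> p, and then from u to m \<otimes> n,
  where \<open>tassoc\<close> is explicit. It turns equations involving \<open>tassoc\<close> into
  equations between double sums.\<close>

lemma tsum_tassoc:
  assumes Z: "abelian_group Z" and f: "balanced_map3 S T M N P Z f"
    and w: "w \<in> carrier (rtens T (rtens S M N) P)"
  shows "tsum Z (\<lambda>m v. tsum Z (f m) v) (tassoc S T M N P w) =
    tsum Z (\<lambda>u p. tsum Z (\<lambda>m n. f m n p) u) w"
proof -
  note r = balanced_map3_right[OF Z f] and l = balanced_map3_left[OF Z f]
  note ad = MNP.additive_tsum[OF Z r]
  have 1: "additive_map (rtens T (rtens S M N) P) Z (\<lambda>w. tsum Z (\<lambda>m v. tsum Z (f m) v) (tassoc S T M N P w))"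
    by (rule additive_map_comp[OF additive_tassoc ad])
  have 2: "tsum Z (\<lambda>m v. tsum Z (f m) v) (tassoc S T M N P (tpure T (rtens S M N) P u p)) =
      tsum Z (\<lambda>m n. f m n p) u"
    if u: "u \<in> carrier (rtens S M N)" and p: "p \<in> carrier P" for u p
  proof (rule additive_map_eqI[OF Z _ _ _ u])
    note fl = f[unfolded balanced_map3_def, THEN conjunct1, rule_format, OF p]
    show "additive_map (rtens S M N) Z (tsum Z (\<lambda>m n. f m n p))" by (rule additive_tsum[OF Z fl])
    show "additive_map (rtens S M N) Z
        (\<lambda>u. tsum Z (\<lambda>m v. tsum Z (f m) v) (tassoc S T M N P (tpure T (rtens S M N) P u p)))"
      by (rule additive_map_comp[OF balanced_mapD(5)[OF MNP'.balanced_tpure p] 1])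
    fix m n assume m: "m \<in> carrier M" and n: "n \<in> carrier N"
    note fr = f[unfolded balanced_map3_def, THEN conjunct2, rule_format, OF m]
    show "tsum Z (\<lambda>m v. tsum Z (f m) v) (tassoc S T M N P (tpure T (rtens S M N) P (tpure S M N m n) p)) =
        tsum Z (\<lambda>m n. f m n p) (tpure S M N m n)"
      using m n p
      by (simp add: tassoc_tpure MNP.tsum_tpure[OF Z r] NP.tpure_closed NP.tsum_tpure[OF Z fr] tsum_tpure[OF Z fl])
  qed
  show ?thesis
    by (rule MNP'.additive_map_eqI[OF Z 1 MNP'.additive_tsum[OF Z l] _ w])
      (simp add: 2 MNP'.tsum_tpure[OF Z l])
qed

end

text \<open>Left linearity of \<open>\<Delta>\<close> is what makes m \<otimes> c |-> m \<otimes>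
  \<Delta>(c) well defined on M \<otimes> C.\<close>

locale comodule_over = C: lr_bimodule S S C + right_module S M
  for S :: "('s, 'e) ring_scheme" and C :: "('c, 's, 's) bimod"
    and \<Delta> :: "'c \<Rightarrow> ('c \<times> 'c) list" and \<epsilon> :: "'c \<Rightarrow> 's"
    and M :: "('m, 's, 'f) rmod_scheme" and \<sigma> :: "'m \<Rightarrow> ('m \<times> 'c) list" +
  assumes comult_left_linear: "left_linear S C (tens S C C) \<Delta>"
    and comodule: "right_comodule S C \<Delta> \<epsilon> M \<sigma>"
begin

sublocale MCC: tensor3 S S M C C ..

lemma coact_closed: "m \<in> carrier M \<Longrightarrow> \<sigma> m \<in> carrier (rtens S M C)"
  using comodule by (auto simp: right_comodule_def right_linear_def additive_map_def)

lemma additive_coact: "additive_map M (rtens S M C) \<sigma>"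
  using comodule by (auto simp: right_comodule_def right_linear_def)

lemma coact_ract: "m \<in> carrier M \<Longrightarrow> s \<in> carrier S \<Longrightarrow> \<sigma> (ract M m s) = ract (rtens S M C) (\<sigma> m) s"
  using comodule by (auto simp: right_comodule_def right_linear_def)

lemma counit: "m \<in> carrier M \<Longrightarrow> tsum M (\<lambda>y c. ract M y (\<epsilon> c)) (\<sigma> m) = m"
  using comodule by (auto simp: right_comodule_def)

lemma comult_closed: "c \<in> carrier C \<Longrightarrow> \<Delta> c \<in> carrier (rtens S C C)"
  using comult_left_linear by (auto simp: left_linear_def additive_map_def)

text \<open>Right linearity of \<open>\<sigma>\<close> turns a scalar on m into one on the last
  factor of \<sigma>(m), which \<open>f\<close> moves on to c. With \<open>balanced_comult\<close>
  it allows both sides of \<open>coassoc\<close> to be evaluated where the coaction is a single pure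
  tensor.\<close>

lemma balanced_coact:
  assumes Z: "abelian_group Z" and f: "balanced_map3 S S M C C Z f"
  shows "balanced_map S M C Z (\<lambda>m c. tsum Z (\<lambda>m' c'. f m' c' c) (\<sigma> m))"
proof -
  note l = balanced_mapD[OF MCC.balanced_map3_left[OF Z f]]
  show ?thesis
    by (rule balanced_mapI) (simp_all add: l coact_closed additive_mapD(2)[OF additive_coact] coact_ract)
qed

lemma balanced_comult:
  assumes Z: "abelian_group Z" and f: "balanced_map3 S S M C C Z f"
  shows "balanced_map S M C Z (\<lambda>m c. tsum Z (f m) (\<Delta> c))"
proof -
  note r = balanced_mapD[OF MCC.balanced_map3_right[OF Z f], unfolded tens_simps(1-4)]
  note ll = comult_left_linear[unfolded left_linear_def additive_map_def, unfolded tens_simps(1-4)]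
  show ?thesis
    by (rule balanced_mapI) (use ll in \<open>simp_all add: r comult_closed del: tens_simps\<close>)
qed

text \<open>Coassociativity in Sweedler form: the sum of f(m0, m1, m2) may be formed by applying the
  coaction twice or by applying \<open>\<Delta>\<close> to m1. The comodule axiom is carried through
  \<open>tmap\<close> and \<open>tassoc\<close> once and for all here.\<close>

lemma coassoc:
  assumes Z: "abelian_group Z" and f: "balanced_map3 S S M C C Z f" and m: "m \<in> carrier M"
  shows "tsum Z (\<lambda>m c. tsum Z (\<lambda>m' c'. f m' c' c) (\<sigma> m)) (\<sigma> m) =
    tsum Z (\<lambda>m c. tsum Z (f m) (\<Delta> c)) (\<sigma> m)"
proof -
  note s = MCC.rtens_carrierD(1)[OF coact_closed[OF m]]
  have "map (map_prod \<sigma> id) (\<sigma> m) \<in> lists (carrier (rtens S M C) \<times> carrier C)"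
    using s by (induction rule: lists.induct) (auto simp: coact_closed)
  then have w: "tmap S (rtens S M C) C \<sigma> id (\<sigma> m) \<in> carrier (rtens S (rtens S M C) C)"
    unfolding tmap_def by (rule MCC.MNP'.trep_closed)
  have "tsum Z (\<lambda>m c. tsum Z (\<lambda>m' c'. f m' c' c) (\<sigma> m)) (\<sigma> m) =
      tsum Z (\<lambda>u p. tsum Z (\<lambda>m n. f m n p) u) (tmap S (rtens S M C) C \<sigma> id (\<sigma> m))"
    using MCC.MNP'.tsum_tmap[OF Z MCC.balanced_map3_left[OF Z f] s] by (simp add: coact_closed)
  also have "\<dots> = tsum Z (\<lambda>m v. tsum Z (f m) v) (tassoc S S M C C (tmap S (rtens S M C) C \<sigma> id (\<sigma> m)))"
    by (rule MCC.tsum_tassoc[OF Z f w, symmetric])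
  also have "\<dots> = tsum Z (\<lambda>m v. tsum Z (f m) v) (tmap S M (tens S C C) id \<Delta> (\<sigma> m))"
    using comodule m by (simp add: right_comodule_def)
  also have "\<dots> = tsum Z (\<lambda>m c. tsum Z (f m) (\<Delta> c)) (\<sigma> m)"
    using MCC.MNP.tsum_tmap[OF Z MCC.balanced_map3_right[OF Z f] s, of id] by (simp add: comult_closed)
  finally show ?thesis .
qed

end

section \<open>Maps of tensor products\<close>

locale tensor_map_left = M: tensor S M N + M': tensor S M' N
  for S :: "('s, 'e) ring_scheme" and M :: "('m, 's, 'f) rmod_scheme"
    and M' :: "('m2, 's, 'f2) rmod_scheme" and N :: "('n, 't, 's, 'g) bimod_scheme" +
  fixes f :: "'m \<Rightarrow> 'm2"
  assumes linear: "right_linear S M M' f"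
begin

lemma closed: "m \<in> carrier M \<Longrightarrow> f m \<in> carrier M'"
  and add: "m \<in> carrier M \<Longrightarrow> m' \<in> carrier M \<Longrightarrow> f (m \<oplus>\<^bsub>M\<^esub> m') = f m \<oplus>\<^bsub>M'\<^esub> f m'"
  and ract: "m \<in> carrier M \<Longrightarrow> s \<in> carrier S \<Longrightarrow> f (ract M m s) = ract M' (f m) s"
  using linear by (auto simp: right_linear_def additive_map_def)

lemma balanced: "balanced_map S M N (rtens S M' N) (\<lambda>m n. tpure S M' N (f m) n)"
  by (rule balanced_mapI)
    (simp_all add: closed add ract M'.tpure_closed M'.tpure_add_left M'.tpure_add_right M'.tpure_balanced)

lemma tmap_eq:
  "u \<in> carrier (rtens S M N) \<Longrightarrow>
    tmap S M' N f id u = tsum (rtens S M' N) (\<lambda>m n. tpure S M' N (f m) n) u"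
  using M'.tmap_eq_tsum[OF M.rtens_carrierD(1), of u f id] by (simp add: closed)

lemma additive_tmap: "additive_map (rtens S M N) (rtens S M' N) (tmap S M' N f id)"
proof (rule additive_mapI)
  note ad = additive_mapD[OF M.additive_tsum[OF M'.abelian_group_rtens balanced]]
  interpret P: abelian_group "rtens S M N" by (rule M.abelian_group_rtens)
  fix u w assume u: "u \<in> carrier (rtens S M N)"
  show "tmap S M' N f id u \<in> carrier (rtens S M' N)" using ad(1)[OF u] tmap_eq[OF u] by simp
  assume w: "w \<in> carrier (rtens S M N)"
  show "tmap S M' N f id (u \<oplus>\<^bsub>rtens S M N\<^esub> w) =
      tmap S M' N f id u \<oplus>\<^bsub>rtens S M' N\<^esub> tmap S M' N f id w"
    using ad(2)[OF u w] tmap_eq[OF P.a_closed[OF u w]] tmap_eq[OF u] tmap_eq[OF w] by simp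
qed

lemma tmap_tpure:
  "m \<in> carrier M \<Longrightarrow> n \<in> carrier N \<Longrightarrow> tmap S M' N f id (tpure S M N m n) = tpure S M' N (f m) n"
  using tmap_eq[OF M.tpure_closed] M.tsum_tpure[OF M'.abelian_group_rtens balanced] by simp

end

locale tensor_map_right = N: tensor S M N + N': tensor S M N'
  for S :: "('s, 'e) ring_scheme" and M :: "('m, 's, 'f) rmod_scheme"
    and N :: "('n, 't, 's, 'g) bimod_scheme" and N' :: "('n2, 't2, 's, 'g2) bimod_scheme" +
  fixes f :: "'n \<Rightarrow> 'n2"
  assumes linear: "left_linear S N N' f"
begin

lemma closed: "n \<in> carrier N \<Longrightarrow> f n \<in> carrier N'"
  and add: "n \<in> carrier N \<Longrightarrow> n' \<in> carrier N \<Longrightarrow> f (n \<oplus>\<^bsub>N\<^esub> n') = f n \<oplus>\<^bsub>N'\<^esub> f n'"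
  and lact: "n \<in> carrier N \<Longrightarrow> s \<in> carrier S \<Longrightarrow> f (lact N s n) = lact N' s (f n)"
  using linear by (auto simp: left_linear_def additive_map_def)

lemma balanced: "balanced_map S M N (rtens S M N') (\<lambda>m n. tpure S M N' m (f n))"
  by (rule balanced_mapI)
    (simp_all add: closed add lact N'.tpure_closed N'.tpure_add_left N'.tpure_add_right N'.tpure_balanced)

lemma tmap_eq:
  "u \<in> carrier (rtens S M N) \<Longrightarrow>
    tmap S M N' id f u = tsum (rtens S M N') (\<lambda>m n. tpure S M N' m (f n)) u"
  using N'.tmap_eq_tsum[OF N.rtens_carrierD(1), of u id f] by (simp add: closed)

lemma additive_tmap: "additive_map (rtens S M N) (rtens S M N') (tmap S M N' id f)"
proof (rule additive_mapI)
  note ad = additive_mapD[OF N.additive_tsum[OF N'.abelian_group_rtens balanced]]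
  interpret P: abelian_group "rtens S M N" by (rule N.abelian_group_rtens)
  fix u w assume u: "u \<in> carrier (rtens S M N)"
  show "tmap S M N' id f u \<in> carrier (rtens S M N')" using ad(1)[OF u] tmap_eq[OF u] by simp
  assume w: "w \<in> carrier (rtens S M N)"
  show "tmap S M N' id f (u \<oplus>\<^bsub>rtens S M N\<^esub> w) =
      tmap S M N' id f u \<oplus>\<^bsub>rtens S M N'\<^esub> tmap S M N' id f w"
    using ad(2)[OF u w] tmap_eq[OF P.a_closed[OF u w]] tmap_eq[OF u] tmap_eq[OF w] by simp
qed

lemma tmap_tpure:
  "m \<in> carrier M \<Longrightarrow> n \<in> carrier N \<Longrightarrow> tmap S M N' id f (tpure S M N m n) = tpure S M N' m (f n)"
  using tmap_eq[OF N.tpure_closed] N.tsum_tpure[OF N'.abelian_group_rtens balanced] by simp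

end

lemma tmap_tmap:
  assumes "tensor_map_left S M M' N f" "tensor_map_left S M' M'' N g" "u \<in> carrier (rtens S M N)"
  shows "tmap S M'' N g id (tmap S M' N f id u) = tmap S M'' N (\<lambda>x. g (f x)) id u"
proof -
  interpret f: tensor_map_left S M M' N f by fact
  interpret g: tensor_map_left S M' M'' N g by fact
  interpret gf: tensor_map_left S M M'' N "\<lambda>x. g (f x)"
    by unfold_locales (rule right_linear_comp[OF f.linear g.linear])
  show ?thesis
    by (rule f.M.additive_map_eqI[OF g.M'.abelian_group_rtens
          additive_map_comp[OF f.additive_tmap g.additive_tmap] gf.additive_tmap _ assms(3)])
      (simp add: f.tmap_tpure g.tmap_tpure gf.tmap_tpure f.closed)
qed

lemma tmap_cong:
  assumes "u \<in> lists (X \<times> Y)" "\<And>x. x \<in> X \<Longrightarrow> f x = f' x"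
  shows "tmap S M N f g u = tmap S M N f' g u"
proof -
  have "map (map_prod f g) u = map (map_prod f' g) u"
    using assms(1) by (induction u rule: lists.induct) (auto simp: assms(2))
  then show ?thesis by (simp only: tmap_def)
qed

lemma (in tensor) tmap_id: "u \<in> carrier (rtens S M N) \<Longrightarrow> tmap S M N id id u = u"
  using rtens_carrierD(2)[of u] map_prod.identity by (simp add: tmap_def id_def)

lemma right_linear_inv:
  assumes "right_linear S M N f" "right_module S M" "bij_betw f (carrier M) (carrier N)"
  shows "right_linear S N M (\<lambda>y\<in>carrier N. inv_into (carrier M) f y)"
proof -
  interpret M: right_module S M by fact
  let ?g = "inv_into (carrier M) f"
  have g: "?g (f x) = x" if "x \<in> carrier M" for x
    using assms(3) that by (simp add: bij_betw_def)
  have f: "f (x \<oplus>\<^bsub>M\<^esub> x') = f x \<oplus>\<^bsub>N\<^esub> f x'" "f (ract M x s) = ract N (f x) s" "f x \<in> carrier N"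
    if "x \<in> carrier M" "x' \<in> carrier M" "s \<in> carrier S" for x x' s
    using assms(1) that by (auto simp: right_linear_def additive_map_def)
  have surj: "\<exists>x\<in>carrier M. y = f x" if "y \<in> carrier N" for y
    using assms(3) that by (auto simp: bij_betw_def)
  have "?g y \<in> carrier M" if "y \<in> carrier N" for y using surj[OF that] g by auto
  moreover have "?g (y \<oplus>\<^bsub>N\<^esub> y') = ?g y \<oplus>\<^bsub>M\<^esub> ?g y' \<and> y \<oplus>\<^bsub>N\<^esub> y' \<in> carrier N"
    if y: "y \<in> carrier N" "y' \<in> carrier N" for y y'
  proof -
    obtain x x' where x: "x \<in> carrier M" "x' \<in> carrier M" "y = f x" "y' = f x'"
      using surj y by metis
    then show ?thesis
      using f(1,3)[OF _ _ M.S.zero_closed] g M.M.a_closed by metis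
  qed
  moreover have "?g (ract N y s) = ract M (?g y) s \<and> ract N y s \<in> carrier N"
    if y: "y \<in> carrier N" and s: "s \<in> carrier S" for y s
  proof -
    obtain x where x: "x \<in> carrier M" "y = f x" using surj y by metis
    then show ?thesis using f(2,3)[OF _ _ s] g M.ract_closed s by metis
  qed
  ultimately show ?thesis by (simp add: right_linear_def additive_map_def)
qed

section \<open>The induction functor\<close>

lemma (in ring) right_module_regular: "right_module R (alg_bimod R id id)"
proof -
  interpret M: abelian_group "alg_bimod R id id"
    by (rule abelian_group_cong[OF abelian_group_axioms]) simp_all
  show ?thesis by unfold_locales (simp_all add: r_distr l_distr m_assoc)
qed

lemma (in ring) lr_bimodule_restrict:
  assumes "ring (R\<lparr>carrier := B\<rparr>)" "B \<subseteq> carrier R"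
  shows "lr_bimodule (R\<lparr>carrier := B\<rparr>) R (alg_bimod R id id)"
proof -
  interpret B: ring "R\<lparr>carrier := B\<rparr>" by fact
  interpret M: right_module R "alg_bimod R id id" by (rule right_module_regular)
  have "x \<in> carrier R" if "x \<in> B" for x using that assms(2) by blast
  then show ?thesis by unfold_locales (simp_all add: r_distr l_distr m_assoc)
qed

locale induced = A: ring A + B: ring "A\<lparr>carrier := B\<rparr>" + N: right_module "A\<lparr>carrier := B\<rparr>" N
  for A :: "('k, 'a) module" and B and N :: "(('x, 'a) univ, 'a) rmod" +
  assumes B_subset: "B \<subseteq> carrier A"
begin

sublocale BA: lr_bimodule "A\<lparr>carrier := B\<rparr>" A "alg_bimod A id id"
  by (rule A.lr_bimodule_restrict[OF B.ring_axioms B_subset])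

sublocale NA: tensor_right "A\<lparr>carrier := B\<rparr>" A N "alg_bimod A id id" ..

sublocale T: right_module A "rtens (A\<lparr>carrier := B\<rparr>) N (alg_bimod A id id)"
  by (rule NA.right_module_rtens)

abbreviation "T \<equiv> rtens (A\<lparr>carrier := B\<rparr>) N (alg_bimod A id id)"

abbreviation "F \<equiv> ind_mod A B N"

abbreviation "ind_pure n a \<equiv> Tensor (tpure (A\<lparr>carrier := B\<rparr>) N (alg_bimod A id id) n a)"

lemma ind_mod_simps:
  "carrier F = Tensor ` carrier T" "\<zero>\<^bsub>F\<^esub> = Tensor \<zero>\<^bsub>T\<^esub>"
  "x \<oplus>\<^bsub>F\<^esub> y = Tensor (summands x \<oplus>\<^bsub>T\<^esub> summands y)"
  "ract F x a = Tensor (ract T (summands x) a)"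
  by (simp_all add: ind_mod_def Let_def)

lemma summands_closed: "z \<in> carrier F \<Longrightarrow> summands z \<in> carrier T"
  by (auto simp: ind_mod_simps)

lemma Tensor_summands: "z \<in> carrier F \<Longrightarrow> Tensor (summands z) = z"
  by (auto simp: ind_mod_simps)

lemma Tensor_closed: "u \<in> carrier T \<Longrightarrow> Tensor u \<in> carrier F"
  by (simp add: ind_mod_simps)

lemma additive_Tensor: "additive_map T F Tensor"
  by (rule additive_mapI) (simp_all add: ind_mod_simps)

lemma additive_summands: "additive_map F T summands"
  by (rule additive_mapI) (auto simp: ind_mod_simps)

lemma abelian_group_ind: "abelian_group F"
  by (rule abelian_groupI) (auto simp: ind_mod_simps T.M.a_ac intro: T.M.l_neg)

lemma right_module_ind: "right_module A F"
proof -
  interpret F: abelian_group F by (rule abelian_group_ind)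
  show ?thesis
    by unfold_locales
      (auto simp: ind_mod_simps T.ract_closed T.ract_add_left T.ract_add_right T.ract_mult T.ract_one)
qed

sublocale F: right_module A F by (rule right_module_ind)

lemma ind_pure_closed: "n \<in> carrier N \<Longrightarrow> a \<in> carrier A \<Longrightarrow> ind_pure n a \<in> carrier F"
  by (simp add: Tensor_closed NA.tpure_closed)

lemma balanced_ind_pure:
  "balanced_map (A\<lparr>carrier := B\<rparr>) N (alg_bimod A id id) F ind_pure"
  by (rule balanced_mapI)
    (use NA.tpure_add_left NA.tpure_add_right NA.tpure_balanced NA.tpure_closed in
      \<open>auto simp: ind_mod_simps\<close>)

lemma ind_pure_ract:
  "n \<in> carrier N \<Longrightarrow> a \<in> carrier A \<Longrightarrow> x \<in> carrier A \<Longrightarrow>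
    ract F (ind_pure n a) x = ind_pure n (a \<otimes>\<^bsub>A\<^esub> x)"
  using NA.tpure_ract[of n a x] by (simp add: ind_mod_simps)

lemma tsum_ind_pure:
  assumes "abelian_group Z" "balanced_map (A\<lparr>carrier := B\<rparr>) N (alg_bimod A id id) Z f"
    and "n \<in> carrier N" "a \<in> carrier A"
  shows "tsum Z f (summands (ind_pure n a)) = f n a"
  using NA.tsum_tpure[OF assms(1-3)] assms(4) by simp

lemma additive_tsum_ind:
  assumes "abelian_group Z" "balanced_map (A\<lparr>carrier := B\<rparr>) N (alg_bimod A id id) Z f"
  shows "additive_map F Z (\<lambda>z. tsum Z f (summands z))"
  by (rule additive_map_comp[OF additive_summands NA.additive_tsum[OF assms]])

lemma ind_eqI:
  assumes "abelian_group Z" "additive_map F Z h" "additive_map F Z h'"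
    and "\<And>n a. n \<in> carrier N \<Longrightarrow> a \<in> carrier A \<Longrightarrow> h (ind_pure n a) = h' (ind_pure n a)"
    and z: "z \<in> carrier F"
  shows "h z = h' z"
  using NA.additive_map_eqI[OF assms(1) additive_map_comp[OF additive_Tensor assms(2)]
    additive_map_comp[OF additive_Tensor assms(3)] _ summands_closed[OF z]] assms(4) Tensor_summands[OF z]
  by simp

lemma right_linear_tsum_ind:
  assumes M: "right_module A M"
    and f: "balanced_map (A\<lparr>carrier := B\<rparr>) N (alg_bimod A id id) M f"
    and lin: "\<And>n a x. n \<in> carrier N \<Longrightarrow> a \<in> carrier A \<Longrightarrow> x \<in> carrier A \<Longrightarrow>
      f n (a \<otimes>\<^bsub>A\<^esub> x) = ract M (f n a) x"
  shows "right_linear A F M (\<lambda>z. tsum M f (summands z))"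
proof -
  interpret M: right_module A M by fact
  note ad = additive_tsum_ind[OF M.M.abelian_group_axioms f]
  show ?thesis
    unfolding right_linear_def
  proof (intro conjI ballI ad)
    fix z x assume z: "z \<in> carrier F" and x: "x \<in> carrier A"
    have r: "additive_map F F (\<lambda>z. ract F z x)" "additive_map M M (\<lambda>z. ract M z x)"
      by (rule additive_mapI; simp add: F.ract_closed F.ract_add_left M.ract_closed M.ract_add_left x)+
    show "tsum M f (summands (ract F z x)) = ract M (tsum M f (summands z)) x"
      by (rule ind_eqI[OF M.M.abelian_group_axioms additive_map_comp[OF r(1) ad]
            additive_map_comp[OF ad r(2)] _ z])
        (simp only: ind_pure_ract tsum_ind_pure[OF M.M.abelian_group_axioms f] lin x A.m_closed)
  qed
qed

end

locale induced_map = N: induced A B N + N': induced A B N'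
  for A :: "('k, 'a) module" and B and N N' :: "(('x, 'a) univ, 'a) rmod" +
  fixes f
  assumes linear: "right_linear (A\<lparr>carrier := B\<rparr>) N N' f"
begin

lemma closed: "n \<in> carrier N \<Longrightarrow> f n \<in> carrier N'"
  and add: "n \<in> carrier N \<Longrightarrow> n' \<in> carrier N \<Longrightarrow> f (n \<oplus>\<^bsub>N\<^esub> n') = f n \<oplus>\<^bsub>N'\<^esub> f n'"
  and ract: "n \<in> carrier N \<Longrightarrow> b \<in> B \<Longrightarrow> f (ract N n b) = ract N' (f n) b"
  using linear by (auto simp: right_linear_def additive_map_def)

lemma balanced: "balanced_map (A\<lparr>carrier := B\<rparr>) N (alg_bimod A id id) N'.F (\<lambda>n a. N'.ind_pure (f n) a)"
proof (rule balanced_mapI)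
  note b = balanced_mapD[OF N'.balanced_ind_pure]
  fix m s n assume "m \<in> carrier N" "s \<in> carrier (A\<lparr>carrier := B\<rparr>)" "n \<in> carrier (alg_bimod A id id)"
  then show "N'.ind_pure (f (rmod.ract N m s)) n = N'.ind_pure (f m) (lact (alg_bimod A id id) s n)"
    using b(4)[of "f m" s n] by (simp add: closed ract)
qed (use balanced_mapD[OF N'.balanced_ind_pure] in \<open>simp_all add: closed add\<close>)

lemma ind_map_eq:
  "z \<in> carrier N.F \<Longrightarrow> ind_map A B N N' f z = tsum N'.F (\<lambda>n a. N'.ind_pure (f n) a) (summands z)"
  unfolding ind_map_def
  using N'.NA.tmap_eq_tsum[OF N.NA.rtens_carrierD(1)[OF N.summands_closed], of z f id]
    additive_map_tsum[OF N'.NA.abelian_group_rtens N'.abelian_group_ind N'.additive_Tensor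
      N.NA.rtens_carrierD(1)[OF N.summands_closed], of z]
  by (simp add: closed N'.NA.tpure_closed)

lemma ind_map_pure:
  "n \<in> carrier N \<Longrightarrow> a \<in> carrier A \<Longrightarrow> ind_map A B N N' f (N.ind_pure n a) = N'.ind_pure (f n) a"
  using ind_map_eq[OF N.ind_pure_closed] N.tsum_ind_pure[OF N'.abelian_group_ind balanced] by simp

lemma right_linear_ind_map: "right_linear A N.F N'.F (ind_map A B N N' f)"
  by (subst right_linear_cong[where f = "ind_map A B N N' f", OF ind_map_eq N.right_module_ind])
    (auto intro!: N.right_linear_tsum_ind[OF N'.right_module_ind balanced] simp: N'.ind_pure_ract closed)

lemma additive_ind_map: "additive_map N.F N'.F (ind_map A B N N' f)"
  using right_linear_ind_map by (simp add: right_linear_def)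

end

text \<open>When g is the grouplike element giving the coaction of \<open>A\<close>, this is Hom(A,
  M) in the category of comodules, a map being identified with its value at 1.\<close>

definition coinv ::
  "('a, 'e) ring_scheme \<Rightarrow> ('c, 'a, 'a) bimod \<Rightarrow> 'c \<Rightarrow> ('m, 'a, 'f) rmod_scheme \<Rightarrow>
    ('m \<Rightarrow> ('m \<times> 'c) list) \<Rightarrow> 'm set"
  where "coinv A C g M \<sigma> = {m \<in> carrier M. \<sigma> m = tpure A M C m g}"

text \<open>An \<open>A\<close>-coring \<open>C\<close> with a coaction on the regular right module \<open>A\<close>.  The coaction is given by
  \<open>r : A \<rightarrow> C\<close>, under \<open>A \<otimes>\<^sub>A C \<cong> C\<close>; it amounts to the grouplike element \<open>r 1\<close>.\<close>

locale grouplike_coring = A: ring A + C: lr_bimodule A A C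
  for A :: "('k, 'a) module" and C :: "('c, 'a, 'a) bimod" +
  fixes \<Delta> :: "'c \<Rightarrow> ('c \<times> 'c) list" and \<epsilon> :: "'c \<Rightarrow> 'a" and r :: "'a \<Rightarrow> 'c" and B :: "'a set"
  assumes comult_bimodule_map: "bimodule_map A A C (tens A C C) \<Delta>"
    and counit_bimodule_map: "bimodule_map A A C (alg_bimod A id id) \<epsilon>"
    and additive_r: "additive_map A C r"
    and r_mult: "a \<in> carrier A \<Longrightarrow> x \<in> carrier A \<Longrightarrow> r (a \<otimes>\<^bsub>A\<^esub> x) = ract C (r a) x"
    and comult_r: "a \<in> carrier A \<Longrightarrow> \<Delta> (r a) = tpure A C C (r \<one>\<^bsub>A\<^esub>) (r a)"
    and counit_r: "a \<in> carrier A \<Longrightarrow> \<epsilon> (r a) = a"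
    and B_eq: "B = {b \<in> carrier A. \<forall>a\<in>carrier A. r (b \<otimes>\<^bsub>A\<^esub> a) = lact C b (r a)}"
begin

abbreviation "g \<equiv> r \<one>\<^bsub>A\<^esub>"

abbreviation "BR \<equiv> A\<lparr>carrier := B\<rparr>"

abbreviation "coact_A \<equiv> (\<lambda>a. tpure A (alg_bimod A id id) C \<one>\<^bsub>A\<^esub> (r a))"

lemmas r_closed = additive_mapD(1)[OF additive_r]
  and r_add = additive_mapD(2)[OF additive_r]

lemma r_eq: "a \<in> carrier A \<Longrightarrow> r a = ract C g a"
  using r_mult[of "\<one>\<^bsub>A\<^esub>" a] by simp

lemma B_subset: "B \<subseteq> carrier A"
  by (auto simp: B_eq)

lemma r_B_mult: "b \<in> B \<Longrightarrow> a \<in> carrier A \<Longrightarrow> r (b \<otimes>\<^bsub>A\<^esub> a) = lact C b (r a)"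
  by (simp add: B_eq)

lemma r_B: "b \<in> B \<Longrightarrow> r b = lact C b g"
  using r_B_mult[of b "\<one>\<^bsub>A\<^esub>"] B_subset by auto

text \<open>Coinvariance has to be tested at 1 only, as \<open>r\<close> is right linear: r(b a) =
  r(b) a = b g a = b r(a).\<close>

lemma mem_B:
  assumes "b \<in> carrier A" "r b = lact C b g"
  shows "b \<in> B"
proof -
  have "r (b \<otimes>\<^bsub>A\<^esub> a) = lact C b (r a)" if a: "a \<in> carrier A" for a
    using assms a by (simp add: r_mult r_eq[OF a] C.lact_ract r_closed)
  then show ?thesis using assms(1) by (simp add: B_eq)
qed

lemma additive_lact_left: "c \<in> carrier C \<Longrightarrow> additive_map A C (\<lambda>a. lact C a c)"
  by (rule additive_mapI) (simp_all add: C.lact_closed C.lact_add_left)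

text \<open>By \<open>mem_B\<close>, \<open>B\<close> is the set where the additive maps r and b |->
  b g agree, hence a subgroup; for products, r(b b') = b r(b') = b b' g.\<close>

lemma ring_BR: "ring BR"
proof (rule A.subring_is_ring[OF A.subringI[OF B_subset]])
  have one: "r \<one>\<^bsub>A\<^esub> = lact C \<one>\<^bsub>A\<^esub> g" by (simp add: C.lact_one r_closed)
  show "\<one>\<^bsub>A\<^esub> \<in> B" by (rule mem_B) (simp_all add: one[symmetric])
  fix b assume b: "b \<in> B"
  then have bA: "b \<in> carrier A" using B_subset by blast
  note am = additive_map_minus[OF A.abelian_group_axioms C.N.abelian_group_axioms _ bA]
  show "\<ominus>\<^bsub>A\<^esub> b \<in> B"
    by (rule mem_B)
      (simp_all add: bA am[OF additive_r] am[OF additive_lact_left] r_B[OF b] r_closed)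
  fix b' assume b': "b' \<in> B"
  then have bA': "b' \<in> carrier A" using B_subset by blast
  show "b \<otimes>\<^bsub>A\<^esub> b' \<in> B"
    by (rule mem_B) (simp_all add: bA bA' r_B_mult[OF b] r_B[OF b'] C.lact_mult r_closed)
  show "b \<oplus>\<^bsub>A\<^esub> b' \<in> B"
    by (rule mem_B) (simp_all add: bA bA' r_add r_B[OF b] r_B[OF b'] C.lact_add_left r_closed)
qed

lemma comult_left_linear: "left_linear A C (tens A C C) \<Delta>"
  using comult_bimodule_map by (simp add: bimodule_map_def)

lemma comult_closed: "c \<in> carrier C \<Longrightarrow> \<Delta> c \<in> carrier (rtens A C C)"
  using comult_left_linear by (auto simp: left_linear_def additive_map_def)

lemma counit_closed: "c \<in> carrier C \<Longrightarrow> \<epsilon> c \<in> carrier A"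
  and counit_add: "c \<in> carrier C \<Longrightarrow> c' \<in> carrier C \<Longrightarrow> \<epsilon> (c \<oplus>\<^bsub>C\<^esub> c') = \<epsilon> c \<oplus>\<^bsub>A\<^esub> \<epsilon> c'"
  and counit_lact: "c \<in> carrier C \<Longrightarrow> a \<in> carrier A \<Longrightarrow> \<epsilon> (lact C a c) = a \<otimes>\<^bsub>A\<^esub> \<epsilon> c"
  and counit_ract: "c \<in> carrier C \<Longrightarrow> a \<in> carrier A \<Longrightarrow> \<epsilon> (ract C c a) = \<epsilon> c \<otimes>\<^bsub>A\<^esub> a"
  using counit_bimodule_map
  by (auto simp: bimodule_map_def left_linear_def right_linear_def additive_map_def)

lemma comodule_overI:
  assumes "right_comodule A C \<Delta> \<epsilon> M \<sigma>"
  shows "comodule_over A C \<Delta> \<epsilon> M \<sigma>"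
proof -
  interpret right_module A M using assms by (simp add: right_comodule_def)
  show ?thesis by unfold_locales (rule comult_left_linear assms)+
qed

end

section \<open>The induced comodule of a module over the coinvariants\<close>

locale induced_comodule = grouplike_coring A C \<Delta> \<epsilon> r B + N: right_module "A\<lparr>carrier := B\<rparr>" N
  for A :: "('k, 'a) module" and C :: "('c, 'a, 'a) bimod"
    and \<Delta> :: "'c \<Rightarrow> ('c \<times> 'c) list" and \<epsilon> :: "'c \<Rightarrow> 'a" and r :: "'a \<Rightarrow> 'c" and B :: "'a set"
    and N :: "(('x, 'a) univ, 'a) rmod"
begin

sublocale Ind: induced A B N
  by unfold_locales (use B_subset in auto)

sublocale FC: tensor_right A A "ind_mod A B N" C ..

sublocale FCC: tensor3 A A "ind_mod A B N" C C ..

abbreviation "F \<equiv> ind_mod A B N"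

abbreviation "coact_F \<equiv> ind_coact A B C coact_A N"

abbreviation "ind_pure n a \<equiv> Tensor (tpure (A\<lparr>carrier := B\<rparr>) N (alg_bimod A id id) n a)"

sublocale AC: tensor A "alg_bimod A id id" C
  by (intro tensor.intro A.right_module_regular C.left_module_axioms)

lemma ind_pure_balanced:
  assumes "n \<in> carrier N" "b \<in> B"
  shows "ind_pure (ract N n b) \<one>\<^bsub>A\<^esub> = ract F (ind_pure n \<one>\<^bsub>A\<^esub>) b"
proof -
  have b: "b \<in> carrier A" using assms(2) B_subset by blast
  have "ind_pure (ract N n b) \<one>\<^bsub>A\<^esub> = ind_pure n (b \<otimes>\<^bsub>A\<^esub> \<one>\<^bsub>A\<^esub>)"
    using balanced_mapD(4)[OF Ind.balanced_ind_pure, of n b "\<one>\<^bsub>A\<^esub>"] assms by simp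
  then show ?thesis using assms b by (simp add: Ind.ind_pure_ract)
qed

text \<open>The defining property of \<open>B\<close> is exactly what is needed: n b \<otimes> a
  goes to (n \<otimes> 1) b \<otimes> r(a) = (n \<otimes> 1) \<otimes> b r(a), and b r(a) = r(b
  a).\<close>

lemma balanced_coact_F:
  "balanced_map BR N (alg_bimod A id id) (rtens A F C) (\<lambda>n a. tpure A F C (ind_pure n \<one>\<^bsub>A\<^esub>) (r a))"
proof (rule balanced_mapI)
  note b = balanced_mapD[OF Ind.balanced_ind_pure]
  fix m s n assume a: "m \<in> carrier N" "s \<in> carrier BR" "n \<in> carrier (alg_bimod A id id)"
  then have s: "s \<in> carrier A" "s \<in> B" using B_subset by auto
  show "tpure A F C (ind_pure (ract N m s) \<one>\<^bsub>A\<^esub>) (r n) =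
      tpure A F C (ind_pure m \<one>\<^bsub>A\<^esub>) (r (lact (alg_bimod A id id) s n))"
    using a s by (simp add: ind_pure_balanced r_B_mult FC.tpure_balanced Ind.ind_pure_closed r_closed)
qed (use balanced_mapD[OF Ind.balanced_ind_pure] in
    \<open>simp_all add: FC.tpure_closed FC.tpure_add_left FC.tpure_add_right r_closed r_add\<close>)

text \<open>The coaction of \<open>A\<close> sends a to the single pure tensor 1 \<otimes> r(a), so
  the inner sum in \<open>ind_coact\<close> collapses to one term.\<close>

lemma coact_F_eq:
  assumes "z \<in> carrier F"
  shows "coact_F z = tsum (rtens A F C) (\<lambda>n a. tpure A F C (ind_pure n \<one>\<^bsub>A\<^esub>) (r a)) (summands z)"
  unfolding ind_coact_def Let_def
proof (rule Ind.NA.tsum_cong_carrier[OF Ind.summands_closed[OF assms]])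
  fix n a assume n: "n \<in> carrier N" and a: "a \<in> carrier (alg_bimod A id id)"
  have "balanced_map A (alg_bimod A id id) C (rtens A F C) (\<lambda>a0 c. tpure A F C (ind_pure n a0) c)"
  proof (rule balanced_mapI)
    fix m s c assume "m \<in> carrier (alg_bimod A id id)" "s \<in> carrier A" "c \<in> carrier C"
    then show "tpure A F C (ind_pure n (ract (alg_bimod A id id) m s)) c =
        tpure A F C (ind_pure n m) (lact C s c)"
      using n FC.tpure_balanced[of "ind_pure n m" s c] by (simp add: Ind.ind_pure_ract Ind.ind_pure_closed)
  qed (use n balanced_mapD[OF Ind.balanced_ind_pure] in
      \<open>simp_all add: FC.tpure_closed FC.tpure_add_left FC.tpure_add_right\<close>)
  from AC.tsum_tpure[OF FC.abelian_group_rtens this]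
  show "tsum (rtens A F C) (\<lambda>a0 c. tpure A F C (ind_pure n a0) c) (coact_A a) =
      tpure A F C (ind_pure n \<one>\<^bsub>A\<^esub>) (r a)"
    using a by (simp add: r_closed)
qed

lemma coact_F_pure:
  "n \<in> carrier N \<Longrightarrow> a \<in> carrier A \<Longrightarrow>
    coact_F (ind_pure n a) = tpure A F C (ind_pure n \<one>\<^bsub>A\<^esub>) (r a)"
  using coact_F_eq[OF Ind.ind_pure_closed] Ind.tsum_ind_pure[OF FC.abelian_group_rtens balanced_coact_F]
  by simp

lemma right_linear_coact_F: "right_linear A F (rtens A F C) coact_F"
  by (subst right_linear_cong[where f = coact_F, OF coact_F_eq Ind.right_module_ind])
    (auto intro!: Ind.right_linear_tsum_ind[OF FC.right_module_rtens balanced_coact_F]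
      simp: FC.tpure_ract Ind.ind_pure_closed r_closed r_mult)

lemma additive_coact_F: "additive_map F (rtens A F C) coact_F"
  using right_linear_coact_F by (simp add: right_linear_def)

text \<open>On n \<otimes> a, coassociativity says that both sides are (n \<otimes> 1) \<otimes> (g
  \<otimes> r(a)), by \<open>comult_r\<close>; the counit law is (n \<otimes> 1) \<epsilon>(r(a)) =
  n \<otimes> a, by \<open>counit_r\<close>.\<close>

lemma right_comodule_ind: "right_comodule A C \<Delta> \<epsilon> F coact_F"
  unfolding right_comodule_def
proof (intro conjI ballI)
  show "right_module A F" by (rule Ind.right_module_ind)
  show "right_linear A F (rtens A F C) coact_F" by (rule right_linear_coact_F)
  interpret l: tensor_map_left A F "rtens A F C" C coact_F
    by unfold_locales (rule right_linear_coact_F)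
  interpret rr: tensor_map_right A F C "tens A C C" \<Delta>
    by unfold_locales (rule comult_left_linear)
  fix z assume z: "z \<in> carrier F"
  show "tassoc A A F C C (tmap A (rtens A F C) C coact_F id (coact_F z)) =
      tmap A F (tens A C C) id \<Delta> (coact_F z)"
  proof (rule Ind.ind_eqI[OF FCC.MNP.abelian_group_rtens _ _ _ z])
    show "additive_map F (rtens A F (tens A C C))
        (\<lambda>z. tassoc A A F C C (tmap A (rtens A F C) C coact_F id (coact_F z)))"
      by (rule additive_map_comp[OF additive_map_comp[OF additive_coact_F l.additive_tmap] FCC.additive_tassoc])
    show "additive_map F (rtens A F (tens A C C)) (\<lambda>z. tmap A F (tens A C C) id \<Delta> (coact_F z))"
      by (rule additive_map_comp[OF additive_coact_F rr.additive_tmap])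
    fix n a assume na: "n \<in> carrier N" "a \<in> carrier A"
    then show "tassoc A A F C C (tmap A (rtens A F C) C coact_F id (coact_F (ind_pure n a))) =
        tmap A F (tens A C C) id \<Delta> (coact_F (ind_pure n a))"
      by (simp add: coact_F_pure l.tmap_tpure rr.tmap_tpure FCC.tassoc_tpure comult_r r_closed Ind.ind_pure_closed)
  qed
  have b: "balanced_map A F C F (\<lambda>y c. ract F y (\<epsilon> c))"
    by (rule balanced_mapI)
      (simp_all add: Ind.F.ract_closed Ind.F.ract_add_left Ind.F.ract_add_right Ind.F.ract_mult
        counit_closed counit_add counit_lact)
  have i: "additive_map F F (\<lambda>z. z)" by (rule additive_mapI) simp_all
  show "tsum F (\<lambda>y c. ract F y (\<epsilon> c)) (coact_F z) = z"
    by (rule Ind.ind_eqI[OF Ind.abelian_group_ind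
          additive_map_comp[OF additive_coact_F FC.additive_tsum[OF Ind.abelian_group_ind b]] i _ z])
      (simp add: coact_F_pure FC.tsum_tpure[OF Ind.abelian_group_ind b] Ind.ind_pure_closed r_closed
        counit_r Ind.ind_pure_ract)
qed

end

section \<open>The adjunction between induction and coinvariants\<close>

lemma right_linear_compose:
  assumes "right_module S M" "right_linear S M N f" "right_linear S N P h"
  shows "right_linear S M P (compose (carrier M) h f)"
  by (subst right_linear_cong[where g = "\<lambda>x. h (f x)", OF _ assms(1)])
    (simp_all add: compose_def right_linear_comp[OF assms(2,3)])

lemma right_linear_restrict_id:
  assumes "right_module S M"
  shows "right_linear S M M (\<lambda>x\<in>carrier M. x)"
  by (subst right_linear_cong[where g = "\<lambda>x. x", OF _ assms])
    (simp_all add: right_linear_def additive_map_def)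

lemma compose_extensional_id:
  "f \<in> extensional X \<Longrightarrow> compose X f (\<lambda>x\<in>X. x) = f"
  by (rule extensionalityI[of _ X]) (auto simp: compose_def)

lemma id_compose_extensional:
  "f \<in> extensional X \<Longrightarrow> f \<in> X \<rightarrow> Y \<Longrightarrow> compose X (\<lambda>x\<in>Y. x) f = f"
  by (rule extensionalityI[of _ X]) (auto simp: compose_def)

lemma category_mod_cat:
  fixes S :: "('s, 'e) ring_scheme"
  shows "category (mod_cat S :: (('m, 's) rmod, _) cat)"
proof
  fix X Y :: "('m, 's) rmod" and f assume "f \<in> Hom (mod_cat S) X Y"
  then have f: "f \<in> extensional (carrier X)" "f \<in> carrier X \<rightarrow> carrier Y"
    by (auto simp: mod_cat_def right_linear_def additive_map_def)
  show "Comp (mod_cat S) X X Y f (Id (mod_cat S) X) = f"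
    using f by (simp add: mod_cat_def compose_extensional_id)
  show "Comp (mod_cat S) X Y Y (Id (mod_cat S) Y) f = f"
    using f by (simp add: mod_cat_def id_compose_extensional)
  fix Z W :: "('m, 's) rmod" and f' f''
  assume "f' \<in> Hom (mod_cat S) Y Z" "f'' \<in> Hom (mod_cat S) Z W"
  show "Comp (mod_cat S) X Y W (Comp (mod_cat S) Y Z W f'' f') f =
      Comp (mod_cat S) X Z W f'' (Comp (mod_cat S) X Y Z f' f)"
    using f(2) by (auto simp: mod_cat_def compose_def restrict_def fun_eq_iff)
qed (auto simp: mod_cat_def right_linear_restrict_id right_linear_compose compose_extensional)

text \<open>Reduces the unit of the adjunction to bijectivity; \<open>comodules_isoI\<close> does
  the same for the counit.\<close>

lemma mod_cat_isoI:
  assumes "right_module S X" "right_module S Y" "f \<in> Hom (mod_cat S) X Y"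
    and "bij_betw f (carrier X) (carrier Y)"
  shows "f \<in> isos (mod_cat S) X Y"
  unfolding isos_def
proof (intro CollectI conjI bexI)
  let ?g = "\<lambda>y\<in>carrier Y. inv_into (carrier X) f y"
  show "f \<in> Hom (mod_cat S) X Y" by fact
  show "?g \<in> Hom (mod_cat S) Y X"
    using assms by (simp add: mod_cat_def right_linear_inv)
  show "Comp (mod_cat S) X Y X ?g f = Id (mod_cat S) X"
    using assms(4) by (auto simp: mod_cat_def compose_def bij_betw_def restrict_def fun_eq_iff)
  show "Comp (mod_cat S) Y X Y f ?g = Id (mod_cat S) Y"
    using bij_betw_inv_into_right[OF assms(4)]
    by (auto simp: mod_cat_def compose_def restrict_def fun_eq_iff)
qed

context grouplike_coring
begin

abbreviation "comodules \<equiv> comod_cat A C \<Delta> \<epsilon>"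

lemma tensor_C: "right_module A M \<Longrightarrow> tensor A M C"
  by (intro tensor.intro C.left_module_axioms)

lemma tensor_map_leftI:
  "right_module A M \<Longrightarrow> right_module A M' \<Longrightarrow> right_linear A M M' f \<Longrightarrow> tensor_map_left A M M' C f"
  by (intro tensor_map_left.intro tensor_map_left_axioms.intro tensor_C)

lemma comoduleD:
  assumes "right_comodule A C \<Delta> \<epsilon> M \<sigma>"
  shows "right_module A M" "right_linear A M (rtens A M C) \<sigma>"
    "\<And>x. x \<in> carrier M \<Longrightarrow> \<sigma> x \<in> carrier (rtens A M C)"
  using assms by (auto simp: right_comodule_def right_linear_def additive_map_def)

lemma comodule_map_cong:
  assumes "right_comodule A C \<Delta> \<epsilon> M \<sigma>" "\<And>x. x \<in> carrier M \<Longrightarrow> f x = h x"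
  shows "comodule_map A C M \<sigma> N \<tau> f \<longleftrightarrow> comodule_map A C M \<sigma> N \<tau> h"
proof -
  note M = comoduleD[OF assms(1)]
  interpret MC: tensor A M C by (rule tensor_C[OF M(1)])
  have "tmap A N C f id (\<sigma> x) = tmap A N C h id (\<sigma> x)" if "x \<in> carrier M" for x
    using tmap_cong[OF MC.rtens_carrierD(1)[OF M(3)[OF that]]] assms(2) by blast
  then show ?thesis
    using right_linear_cong[where N = N, OF assms(2) M(1)] assms(2) by (auto simp: comodule_map_def)
qed

lemma comodule_map_id:
  assumes "right_comodule A C \<Delta> \<epsilon> M \<sigma>"
  shows "comodule_map A C M \<sigma> M \<sigma> (\<lambda>x\<in>carrier M. x)"
proof -
  note M = comoduleD[OF assms]
  interpret MC: tensor A M C by (rule tensor_C[OF M(1)])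
  have "comodule_map A C M \<sigma> M \<sigma> id"
    using MC.tmap_id M(3) by (simp add: comodule_map_def right_linear_def additive_map_def)
  then show ?thesis using comodule_map_cong[where N = M and \<tau> = \<sigma>, OF assms, of "\<lambda>x\<in>carrier M. x" id] by simp
qed

lemma comodule_map_compose:
  assumes "right_comodule A C \<Delta> \<epsilon> M \<sigma>" "right_comodule A C \<Delta> \<epsilon> M' \<sigma>'" "right_comodule A C \<Delta> \<epsilon> M'' \<sigma>''"
    and "comodule_map A C M \<sigma> M' \<sigma>' f" "comodule_map A C M' \<sigma>' M'' \<sigma>'' h"
  shows "comodule_map A C M \<sigma> M'' \<sigma>'' (compose (carrier M) h f)"
proof -
  note M = comoduleD[OF assms(1)] and M' = comoduleD[OF assms(2)] and M'' = comoduleD[OF assms(3)]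
  have l: "right_linear A M M' f" "right_linear A M' M'' h" using assms(4,5) by (auto simp: comodule_map_def)
  then have cl: "f x \<in> carrier M'" if "x \<in> carrier M" for x
    using that by (auto simp: right_linear_def additive_map_def)
  have "comodule_map A C M \<sigma> M'' \<sigma>'' (\<lambda>x. h (f x))"
    using assms(4,5) right_linear_comp[OF l] cl
      tmap_tmap[OF tensor_map_leftI[OF M(1) M'(1) l(1)] tensor_map_leftI[OF M'(1) M''(1) l(2)] M(3)]
    by (simp add: comodule_map_def)
  then show ?thesis
    using comodule_map_cong[where N = M'' and \<tau> = \<sigma>'', OF assms(1), of "compose (carrier M) h f" "\<lambda>x. h (f x)"]
    by (simp add: compose_def)
qed

text \<open>Write y = f(x) and apply the inverse of f, tensored with \<open>C\<close>, to
  \<sigma>'(f x), which is the image of \<sigma>(x) under f tensored with \<open>C\<close>;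
  functoriality (\<open>tmap_tmap\<close>) leaves \<sigma>(x).\<close>

lemma comodule_map_inv:
  assumes "right_comodule A C \<Delta> \<epsilon> M \<sigma>" "right_comodule A C \<Delta> \<epsilon> M' \<sigma>'"
    and "comodule_map A C M \<sigma> M' \<sigma>' f" "bij_betw f (carrier M) (carrier M')"
  shows "comodule_map A C M' \<sigma>' M \<sigma> (\<lambda>y\<in>carrier M'. inv_into (carrier M) f y)"
proof -
  note M = comoduleD[OF assms(1)] and M' = comoduleD[OF assms(2)]
  let ?h = "\<lambda>y\<in>carrier M'. inv_into (carrier M) f y"
  have l: "right_linear A M M' f" using assms(3) by (auto simp: comodule_map_def)
  note l' = right_linear_inv[OF l M(1) assms(4)]
  have hf: "?h (f x) = x" if "x \<in> carrier M" for x
    using assms(4) that by (auto simp: bij_betw_def)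
  interpret MC: tensor A M C by (rule tensor_C[OF M(1)])
  have "\<sigma> (?h y) = tmap A M C ?h id (\<sigma>' y)" if "y \<in> carrier M'" for y
  proof -
    obtain x where x: "x \<in> carrier M" "y = f x" using assms(4) \<open>y \<in> carrier M'\<close> by (auto simp: bij_betw_def)
    have "tmap A M C ?h id (\<sigma>' y) = tmap A M C ?h id (tmap A M' C f id (\<sigma> x))"
      using assms(3) x by (simp add: comodule_map_def)
    also have "\<dots> = tmap A M C (\<lambda>x. ?h (f x)) id (\<sigma> x)"
      by (rule tmap_tmap[OF tensor_map_leftI[OF M(1) M'(1) l] tensor_map_leftI[OF M'(1) M(1) l'] M(3)[OF x(1)]])
    also have "\<dots> = tmap A M C id id (\<sigma> x)"
      by (rule tmap_cong[OF MC.rtens_carrierD(1)[OF M(3)[OF x(1)]]]) (simp only: hf id_apply)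
    also have "\<dots> = \<sigma> (?h y)" using MC.tmap_id[OF M(3)] x hf by simp
    finally show ?thesis by simp
  qed
  with l' show ?thesis by (simp add: comodule_map_def)
qed

lemma comodule_map_closed: "comodule_map A C M \<sigma> N \<tau> f \<Longrightarrow> x \<in> carrier M \<Longrightarrow> f x \<in> carrier N"
  by (auto simp: comodule_map_def right_linear_def additive_map_def)

lemma category_comodules: "category comodules"
proof
  fix X Y :: "('m, 'a) rmod \<times> ('m \<Rightarrow> ('m \<times> 'c) list)" and f
  assume X: "X \<in> Obj comodules" and Y: "Y \<in> Obj comodules" and fH: "f \<in> Hom comodules X Y"
  then have f: "f \<in> extensional (carrier (fst X))" "f \<in> carrier (fst X) \<rightarrow> carrier (fst Y)"
    by (auto simp: comod_cat_def dest: comodule_map_closed)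
  show "Comp comodules X X Y f (Id comodules X) = f"
    using f by (cases X) (simp add: comod_cat_def compose_extensional_id)
  show "Comp comodules X Y Y (Id comodules Y) f = f"
    using f by (cases X; cases Y) (simp add: comod_cat_def id_compose_extensional)
  fix Z :: "('m, 'a) rmod \<times> ('m \<Rightarrow> ('m \<times> 'c) list)" and f'
  assume Z: "Z \<in> Obj comodules" and f'H: "f' \<in> Hom comodules Y Z"
  show "Comp comodules X Y Z f' f \<in> Hom comodules X Z"
    using X Y Z fH f'H by (auto simp: comod_cat_def comodule_map_compose)
  fix W :: "('m, 'a) rmod \<times> ('m \<Rightarrow> ('m \<times> 'c) list)" and f''
  show "Comp comodules X Y W (Comp comodules Y Z W f'' f') f =
      Comp comodules X Z W f'' (Comp comodules X Y Z f' f)"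
    using f(2) by (auto simp: comod_cat_def compose_def restrict_def fun_eq_iff split: prod.splits)
qed (auto simp: comod_cat_def comodule_map_id)

lemma comodules_isoI:
  assumes "(M, \<sigma>) \<in> Obj comodules" "(M', \<sigma>') \<in> Obj comodules" "f \<in> Hom comodules (M, \<sigma>) (M', \<sigma>')"
    and "bij_betw f (carrier M) (carrier M')"
  shows "f \<in> isos comodules (M, \<sigma>) (M', \<sigma>')"
  unfolding isos_def
proof (intro CollectI conjI bexI)
  let ?g = "\<lambda>y\<in>carrier M'. inv_into (carrier M) f y"
  show "f \<in> Hom comodules (M, \<sigma>) (M', \<sigma>')" by fact
  show "?g \<in> Hom comodules (M', \<sigma>') (M, \<sigma>)"
    using assms by (simp add: comod_cat_def comodule_map_inv)
  show "Comp comodules (M, \<sigma>) (M', \<sigma>') (M, \<sigma>) ?g f = Id comodules (M, \<sigma>)"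
    using assms(4) by (auto simp: comod_cat_def compose_def bij_betw_def restrict_def fun_eq_iff)
  show "Comp comodules (M', \<sigma>') (M, \<sigma>) (M', \<sigma>') f ?g = Id comodules (M', \<sigma>')"
    using bij_betw_inv_into_right[OF assms(4)]
    by (auto simp: comod_cat_def compose_def restrict_def fun_eq_iff)
qed

lemma induced_comoduleI:
  fixes N :: "(('x, 'a) univ, 'a) rmod"
  assumes "right_module BR N"
  shows "induced_comodule A C \<Delta> \<epsilon> r B N"
  by (intro induced_comodule.intro grouplike_coring_axioms assms)

lemma induced_mapI:
  fixes N N' :: "(('x, 'a) univ, 'a) rmod"
  assumes "right_module BR N" "right_module BR N'" "right_linear BR N N' f"
  shows "induced_map A B N N' f"
  using assms by (intro induced_map.intro induced.intro induced_axioms.intro induced_map_axioms.intro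
      A.ring_axioms ring_BR B_subset)

lemma comodule_map_ind_map:
  fixes N N' :: "(('x, 'a) univ, 'a) rmod"
  assumes "right_module BR N" "right_module BR N'" "right_linear BR N N' f"
  shows "comodule_map A C (ind_mod A B N) (ind_coact A B C coact_A N)
    (ind_mod A B N') (ind_coact A B C coact_A N') (ind_map A B N N' f)"
  unfolding comodule_map_def
proof (intro conjI ballI)
  interpret N: induced_comodule A C \<Delta> \<epsilon> r B N by (rule induced_comoduleI[OF assms(1)])
  interpret N': induced_comodule A C \<Delta> \<epsilon> r B N' by (rule induced_comoduleI[OF assms(2)])
  interpret f: induced_map A B N N' f by (rule induced_mapI[OF assms])
  show lin: "right_linear A N.F N'.F (ind_map A B N N' f)" by (rule f.right_linear_ind_map)
  interpret t: tensor_map_left A N.F N'.F C "ind_map A B N N' f"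
    by (rule tensor_map_leftI[OF N.Ind.right_module_ind N'.Ind.right_module_ind lin])
  fix z assume z: "z \<in> carrier N.F"
  show "N'.coact_F (ind_map A B N N' f z) = tmap A N'.F C (ind_map A B N N' f) id (N.coact_F z)"
    by (rule N.Ind.ind_eqI[OF N'.FC.abelian_group_rtens
          additive_map_comp[OF f.additive_ind_map N'.additive_coact_F]
          additive_map_comp[OF N.additive_coact_F t.additive_tmap] _ z])
      (simp add: f.ind_map_pure f.closed N.coact_F_pure N'.coact_F_pure t.tmap_tpure
        N.Ind.ind_pure_closed r_closed)
qed

lemma functor_induction:
  "functor_between (mod_cat BR :: ((('x, 'a) univ, 'a) rmod, _) cat) comodules
    (ind_obj A B C coact_A) (ind_map A B)"
proof (intro functor_between.intro functor_between_axioms.intro category_mod_cat category_comodules)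
  fix X :: "(('x, 'a) univ, 'a) rmod" assume "X \<in> Obj (mod_cat BR)"
  then have X: "right_module BR X" by (simp add: mod_cat_def)
  interpret X: induced_comodule A C \<Delta> \<epsilon> r B X by (rule induced_comoduleI[OF X])
  show "ind_obj A B C coact_A X \<in> Obj comodules"
    by (simp add: ind_obj_def comod_cat_def X.right_comodule_ind)
  interpret i: induced_map A B X X "\<lambda>x\<in>carrier X. x"
    by (rule induced_mapI[OF X X right_linear_restrict_id[OF X]])
  have "additive_map X.F X.F (\<lambda>z. z)" by (rule additive_mapI) simp_all
  then have i: "ind_map A B X X (\<lambda>x\<in>carrier X. x) z = z" if "z \<in> carrier X.F" for z
    using X.Ind.ind_eqI[OF X.Ind.abelian_group_ind i.additive_ind_map _ _ that] i.ind_map_pure by simp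
  show "ind_map A B X X (Id (mod_cat BR) X) = Id comodules (ind_obj A B C coact_A X)"
    by (rule extensionalityI[of _ "carrier X.F"])
      (simp_all add: i mod_cat_def comod_cat_def ind_obj_def, simp add: ind_map_def)
  fix Y :: "(('x, 'a) univ, 'a) rmod" and f assume "Y \<in> Obj (mod_cat BR)" and f: "f \<in> Hom (mod_cat BR) X Y"
  then have Y: "right_module BR Y" by (simp add: mod_cat_def)
  interpret Y: induced_comodule A C \<Delta> \<epsilon> r B Y by (rule induced_comoduleI[OF Y])
  have lf: "right_linear BR X Y f" using f by (simp add: mod_cat_def)
  interpret f: induced_map A B X Y f by (rule induced_mapI[OF X Y lf])
  show "ind_map A B X Y f \<in> Hom comodules (ind_obj A B C coact_A X) (ind_obj A B C coact_A Y)"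
    using comodule_map_ind_map[OF X Y lf] by (simp add: comod_cat_def ind_obj_def ind_map_def)
  fix Z :: "(('x, 'a) univ, 'a) rmod" and h assume "Z \<in> Obj (mod_cat BR)" and h: "h \<in> Hom (mod_cat BR) Y Z"
  then have Z: "right_module BR Z" by (simp add: mod_cat_def)
  interpret Z: induced_comodule A C \<Delta> \<epsilon> r B Z by (rule induced_comoduleI[OF Z])
  have lh: "right_linear BR Y Z h" using h by (simp add: mod_cat_def)
  interpret h: induced_map A B Y Z h by (rule induced_mapI[OF Y Z lh])
  interpret hf: induced_map A B X Z "compose (carrier X) h f"
    by (rule induced_mapI[OF X Z right_linear_compose[OF X lf lh]])
  have "ind_map A B X Z (compose (carrier X) h f) z = ind_map A B Y Z h (ind_map A B X Y f z)"
    if z: "z \<in> carrier X.F" for z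
    by (rule X.Ind.ind_eqI[OF Z.Ind.abelian_group_ind hf.additive_ind_map
          additive_map_comp[OF f.additive_ind_map h.additive_ind_map] _ z])
      (simp add: f.ind_map_pure h.ind_map_pure hf.ind_map_pure f.closed compose_eq)
  then show "ind_map A B X Z (Comp (mod_cat BR) X Y Z h f) =
      Comp comodules (ind_obj A B C coact_A X) (ind_obj A B C coact_A Y) (ind_obj A B C coact_A Z)
        (ind_map A B Y Z h) (ind_map A B X Y f)"
    by (intro extensionalityI[of _ "carrier X.F"])
      (simp_all add: mod_cat_def comod_cat_def ind_obj_def compose_def, simp add: ind_map_def)
qed

end

section \<open>The coinvariants functor\<close>

abbreviation (in grouplike_coring) coinv_mod ::
  "('m, 'a) rmod \<Rightarrow> ('m \<Rightarrow> ('m \<times> 'c) list) \<Rightarrow> ('m, 'a) rmod"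
  where "coinv_mod M \<sigma> \<equiv> M\<lparr>carrier := coinv A C g M \<sigma>\<rparr>"

locale grouplike_comodule = grouplike_coring A C \<Delta> \<epsilon> r B + M: comodule_over A C \<Delta> \<epsilon> M \<sigma>
  for A :: "('k, 'a) module" and C :: "('c, 'a, 'a) bimod"
    and \<Delta> :: "'c \<Rightarrow> ('c \<times> 'c) list" and \<epsilon> :: "'c \<Rightarrow> 'a" and r :: "'a \<Rightarrow> 'c" and B :: "'a set"
    and M :: "('m, 'a) rmod" and \<sigma> :: "'m \<Rightarrow> ('m \<times> 'c) list"
begin

abbreviation "Mco \<equiv> coinv A C g M \<sigma>"

lemma Mco_subset: "Mco \<subseteq> carrier M"
  by (auto simp: coinv_def)

text \<open>Right linearity gives (m \<otimes> g) a = m \<otimes> g a, and g a = r(a). For a in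
  \<open>B\<close> the element r(a) = a g can be moved back across the tensor sign, which is why
  \<open>B\<close> acts on the coinvariants (\<open>Mco_ract\<close>).\<close>

lemma coact_Mco_ract:
  assumes "m \<in> Mco" "a \<in> carrier A"
  shows "\<sigma> (ract M m a) = tpure A M C m (r a)"
  using assms by (simp add: coinv_def M.coact_ract M.MCC.tpure_ract r_closed r_eq[of a])

lemma Mco_ract:
  assumes m: "m \<in> Mco" and b: "b \<in> B"
  shows "ract M m b \<in> Mco"
proof -
  have bA: "b \<in> carrier A" using b B_subset by blast
  have mM: "m \<in> carrier M" using m Mco_subset by blast
  have "\<sigma> (ract M m b) = tpure A M C (ract M m b) g"
    using coact_Mco_ract[OF m bA] r_B[OF b] M.MCC.tpure_balanced[OF mM bA] r_closed by simp
  then show ?thesis using mM bA by (simp add: coinv_def M.ract_closed)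
qed

lemma right_module_Mco: "right_module BR (coinv_mod M \<sigma>)"
proof -
  interpret BR: ring BR by (rule ring_BR)
  have bA: "b \<in> carrier A" if "b \<in> B" for b using that B_subset by blast
  have mM: "m \<in> carrier M" if "m \<in> Mco" for m using that Mco_subset by blast
  have add: "m \<oplus>\<^bsub>M\<^esub> m' \<in> Mco" if "m \<in> Mco" "m' \<in> Mco" for m m'
    using that M.MCC.tpure_add_left[of m m' g] r_closed
    by (simp add: coinv_def additive_mapD(2)[OF M.additive_coact])
  have zero: "\<zero>\<^bsub>M\<^esub> \<in> Mco"
    using additive_map_zero[OF M.M.abelian_group_axioms M.MCC.abelian_group_rtens M.additive_coact]
      additive_map_zero[OF M.M.abelian_group_axioms M.MCC.abelian_group_rtens
        balanced_mapD(5)[OF M.MCC.balanced_tpure], of g] r_closed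
    by (simp add: coinv_def)
  have minus: "\<ominus>\<^bsub>M\<^esub> m \<in> Mco" if "m \<in> Mco" for m
    using that additive_map_minus[OF M.M.abelian_group_axioms M.MCC.abelian_group_rtens M.additive_coact]
      additive_map_minus[OF M.M.abelian_group_axioms M.MCC.abelian_group_rtens
        balanced_mapD(5)[OF M.MCC.balanced_tpure], of g] r_closed
    by (simp add: coinv_def)
  interpret Mco: abelian_group "coinv_mod M \<sigma>"
  proof (rule abelian_groupI)
    fix x assume "x \<in> carrier (coinv_mod M \<sigma>)"
    then show "\<exists>y\<in>carrier (coinv_mod M \<sigma>). y \<oplus>\<^bsub>coinv_mod M \<sigma>\<^esub> x = \<zero>\<^bsub>coinv_mod M \<sigma>\<^esub>"
      using minus M.M.l_neg mM by auto
  qed (simp_all add: add zero mM M.M.a_ac)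
  show ?thesis
    by unfold_locales
      (simp_all add: Mco_ract bA mM M.ract_add_left M.ract_add_right M.ract_mult M.ract_one)
qed

end

context grouplike_coring
begin

lemma grouplike_comoduleI:
  "right_comodule A C \<Delta> \<epsilon> M \<sigma> \<Longrightarrow> grouplike_comodule A C \<Delta> \<epsilon> r B M \<sigma>"
  by (intro grouplike_comodule.intro grouplike_coring_axioms comodule_overI)

lemma comodule_map_coinv:
  assumes "right_comodule A C \<Delta> \<epsilon> M \<sigma>" "right_comodule A C \<Delta> \<epsilon> M' \<sigma>'" "comodule_map A C M \<sigma> M' \<sigma>' f"
    and m: "m \<in> coinv A C g M \<sigma>"
  shows "f m \<in> coinv A C g M' \<sigma>'"
proof -
  have l: "right_linear A M M' f" using assms(3) by (simp add: comodule_map_def)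
  interpret f: tensor_map_left A M M' C f
    by (rule tensor_map_leftI[OF comoduleD(1)[OF assms(1)] comoduleD(1)[OF assms(2)] l])
  show ?thesis
    using assms(3) m by (simp add: coinv_def comodule_map_def f.tmap_tpure f.closed r_closed)
qed

abbreviation coinv_obj ::
  "('m, 'a) rmod \<times> ('m \<Rightarrow> ('m \<times> 'c) list) \<Rightarrow> ('m, 'a) rmod"
  where "coinv_obj X \<equiv> coinv_mod (fst X) (snd X)"

abbreviation coinv_map ::
  "('m, 'a) rmod \<times> ('m \<Rightarrow> ('m \<times> 'c) list) \<Rightarrow> ('m, 'a) rmod \<times> ('m \<Rightarrow> ('m \<times> 'c) list) \<Rightarrow>
    ('m \<Rightarrow> 'm) \<Rightarrow> 'm \<Rightarrow> 'm"
  where "coinv_map X Y f \<equiv> restrict f (coinv A C g (fst X) (snd X))"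

lemma right_linear_coinv:
  assumes "right_comodule A C \<Delta> \<epsilon> M \<sigma>" "right_comodule A C \<Delta> \<epsilon> M' \<sigma>'" "comodule_map A C M \<sigma> M' \<sigma>' f"
  shows "right_linear BR (coinv_mod M \<sigma>) (coinv_mod M' \<sigma>') (restrict f (coinv A C g M \<sigma>))"
proof -
  interpret M: grouplike_comodule A C \<Delta> \<epsilon> r B M \<sigma> by (rule grouplike_comoduleI[OF assms(1)])
  have "right_linear BR (coinv_mod M \<sigma>) (coinv_mod M' \<sigma>') f"
    using assms(3) B_subset M.Mco_subset comodule_map_coinv[OF assms]
    by (auto simp: comodule_map_def right_linear_def additive_map_def subset_iff)
  then show ?thesis
    by (subst right_linear_cong[where g = f, OF _ M.right_module_Mco]) simp_all
qed

lemma functor_coinv: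
  "functor_between (comodules :: (('m, 'a) rmod \<times> _, _) cat) (mod_cat BR) coinv_obj coinv_map"
proof (intro functor_between.intro functor_between_axioms.intro category_mod_cat category_comodules)
  fix X :: "('m, 'a) rmod \<times> ('m \<Rightarrow> ('m \<times> 'c) list)" assume "X \<in> Obj comodules"
  then have X: "right_comodule A C \<Delta> \<epsilon> (fst X) (snd X)" by (auto simp: comod_cat_def)
  interpret X: grouplike_comodule A C \<Delta> \<epsilon> r B "fst X" "snd X" by (rule grouplike_comoduleI[OF X])
  show "coinv_obj X \<in> Obj (mod_cat BR)"
    by (simp add: mod_cat_def X.right_module_Mco)
  show "coinv_map X X (Id comodules X) = Id (mod_cat BR) (coinv_obj X)"
    using X.Mco_subset by (cases X) (auto simp: mod_cat_def comod_cat_def restrict_def fun_eq_iff)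
  fix Y :: "('m, 'a) rmod \<times> ('m \<Rightarrow> ('m \<times> 'c) list)" and f
  assume "Y \<in> Obj comodules" and "f \<in> Hom comodules X Y"
  then have Y: "right_comodule A C \<Delta> \<epsilon> (fst Y) (snd Y)"
    and f: "comodule_map A C (fst X) (snd X) (fst Y) (snd Y) f" by (cases X; auto simp: comod_cat_def)+
  show "coinv_map X Y f \<in> Hom (mod_cat BR) (coinv_obj X) (coinv_obj Y)"
    using right_linear_coinv[OF X Y f] by (simp add: mod_cat_def)
  fix Z :: "('m, 'a) rmod \<times> ('m \<Rightarrow> ('m \<times> 'c) list)" and h
  show "coinv_map X Z (Comp comodules X Y Z h f) =
      Comp (mod_cat BR) (coinv_obj X) (coinv_obj Y) (coinv_obj Z) (coinv_map Y Z h) (coinv_map X Y f)"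
    using X.Mco_subset comodule_map_coinv[OF X Y f]
    by (cases X) (auto simp: mod_cat_def comod_cat_def compose_def restrict_def fun_eq_iff subset_iff)
qed

section \<open>Unit and counit of the adjunction\<close>

definition ind_unit :: "(('x, 'a) univ, 'a) rmod \<Rightarrow> ('x, 'a) univ \<Rightarrow> ('x, 'a) univ"
  where "ind_unit N = (\<lambda>n\<in>carrier N. Tensor (tpure BR N (alg_bimod A id id) n \<one>\<^bsub>A\<^esub>))"

definition ind_counit ::
  "(('x, 'a) univ, 'a) rmod \<times> (('x, 'a) univ \<Rightarrow> (('x, 'a) univ \<times> 'c) list) \<Rightarrow> ('x, 'a) univ \<Rightarrow> ('x, 'a) univ"
  where "ind_counit X = (\<lambda>z\<in>carrier (ind_mod A B (coinv_obj X)). tsum (fst X) (ract (fst X)) (summands z))"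

end

context induced_comodule
begin

lemma ind_unit_coinv: "n \<in> carrier N \<Longrightarrow> ind_pure n \<one>\<^bsub>A\<^esub> \<in> coinv A C g F coact_F"
  by (simp add: coinv_def Ind.ind_pure_closed coact_F_pure)

lemma right_linear_ind_unit: "right_linear BR N (coinv_mod F coact_F) (ind_unit N)"
proof -
  have "right_linear BR N (coinv_mod F coact_F) (\<lambda>n. ind_pure n \<one>\<^bsub>A\<^esub>)"
    using balanced_mapD(2)[OF Ind.balanced_ind_pure] ind_pure_balanced
    by (simp add: right_linear_def additive_map_def ind_unit_coinv)
  then show ?thesis
    by (subst right_linear_cong[where g = "\<lambda>n. ind_pure n \<one>\<^bsub>A\<^esub>", OF _ N.right_module_axioms])
      (simp_all add: ind_unit_def)
qed

end

locale induced_coinv = grouplike_comodule A C \<Delta> \<epsilon> r B M \<sigma>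
  for A :: "('k, 'a) module" and C :: "('c, 'a, 'a) bimod"
    and \<Delta> :: "'c \<Rightarrow> ('c \<times> 'c) list" and \<epsilon> :: "'c \<Rightarrow> 'a" and r :: "'a \<Rightarrow> 'c" and B :: "'a set"
    and M :: "(('x, 'a) univ, 'a) rmod" and \<sigma> :: "('x, 'a) univ \<Rightarrow> (('x, 'a) univ \<times> 'c) list"
begin

sublocale G: induced_comodule A C \<Delta> \<epsilon> r B "coinv_mod M \<sigma>"
  by (intro induced_comodule.intro grouplike_coring_axioms right_module_Mco)

lemma balanced_ract_Mco: "balanced_map BR (coinv_mod M \<sigma>) (alg_bimod A id id) M (ract M)"
proof (rule balanced_mapI)
  have bA: "b \<in> carrier A" if "b \<in> B" for b using that B_subset by blast
  have mM: "m \<in> carrier M" if "m \<in> Mco" for m using that Mco_subset by blast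
  fix m s n
  assume "m \<in> carrier (coinv_mod M \<sigma>)" "s \<in> carrier BR" "n \<in> carrier (alg_bimod A id id)"
  then show "ract M (ract (coinv_mod M \<sigma>) m s) n = ract M m (lact (alg_bimod A id id) s n)"
    by (simp add: bA mM M.ract_mult)
qed (use Mco_subset in \<open>simp_all add: subset_iff M.ract_closed M.ract_add_left M.ract_add_right\<close>)

lemma ind_counit_eq: "z \<in> carrier G.F \<Longrightarrow> ind_counit (M, \<sigma>) z = tsum M (ract M) (summands z)"
  by (simp add: ind_counit_def)

lemma right_linear_ind_counit: "right_linear A G.F M (ind_counit (M, \<sigma>))"
  by (subst right_linear_cong[where f = "ind_counit (M, \<sigma>)", OF ind_counit_eq G.Ind.right_module_ind])
    (use Mco_subset in \<open>auto intro!: G.Ind.right_linear_tsum_ind[OF M.right_module_axioms balanced_ract_Mco]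
      simp: M.ract_mult subset_iff\<close>)

lemma additive_ind_counit: "additive_map G.F M (ind_counit (M, \<sigma>))"
  using right_linear_ind_counit by (simp add: right_linear_def)

lemma ind_counit_pure:
  "m \<in> Mco \<Longrightarrow> a \<in> carrier A \<Longrightarrow> ind_counit (M, \<sigma>) (G.ind_pure m a) = ract M m a"
  using G.Ind.tsum_ind_pure[OF M.M.abelian_group_axioms balanced_ract_Mco, of m a]
  by (simp add: ind_counit_eq G.Ind.ind_pure_closed)

lemma comodule_map_ind_counit: "comodule_map A C G.F G.coact_F M \<sigma> (ind_counit (M, \<sigma>))"
  unfolding comodule_map_def
proof (intro conjI ballI right_linear_ind_counit)
  interpret t: tensor_map_left A G.F M C "ind_counit (M, \<sigma>)"
    by (rule tensor_map_leftI[OF G.Ind.right_module_ind M.right_module_axioms right_linear_ind_counit])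
  fix z assume z: "z \<in> carrier G.F"
  show "\<sigma> (ind_counit (M, \<sigma>) z) = tmap A M C (ind_counit (M, \<sigma>)) id (G.coact_F z)"
  proof (rule G.Ind.ind_eqI[OF M.MCC.abelian_group_rtens
        additive_map_comp[OF additive_ind_counit M.additive_coact]
        additive_map_comp[OF G.additive_coact_F t.additive_tmap] _ z])
    fix m a assume "m \<in> carrier (coinv_mod M \<sigma>)" and a: "a \<in> carrier A"
    then have m: "m \<in> Mco" by simp
    then have mM: "m \<in> carrier M" using Mco_subset by blast
    show "\<sigma> (ind_counit (M, \<sigma>) (G.ind_pure m a)) =
        tmap A M C (ind_counit (M, \<sigma>)) id (G.coact_F (G.ind_pure m a))"
      using m a mM
      by (simp add: ind_counit_pure coact_Mco_ract G.coact_F_pure t.tmap_tpure G.Ind.ind_pure_closed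
          r_closed M.ract_one)
  qed
qed

end

context grouplike_coring
begin

text \<open>Linearity, colinearity and naturality of unit and counit hold for any coring with a
  grouplike element, by evaluation at n and at pure tensors m \<otimes> a. Only bijectivity depends
  on the cleaving, and the two hypotheses isolate it.\<close>

lemma cat_equivalence_inductionI:
  assumes unit: "\<And>N :: (('x, 'a) univ, 'a) rmod. right_module BR N \<Longrightarrow>
      bij_betw (ind_unit N) (carrier N) (coinv A C g (ind_mod A B N) (ind_coact A B C coact_A N))"
    and counit: "\<And>(M :: (('x, 'a) univ, 'a) rmod) \<sigma>. right_comodule A C \<Delta> \<epsilon> M \<sigma> \<Longrightarrow>
      bij_betw (ind_counit (M, \<sigma>)) (carrier (ind_mod A B (coinv_mod M \<sigma>))) (carrier M)"
  shows "cat_equivalence (mod_cat BR :: ((('x, 'a) univ, 'a) rmod, _) cat) comodules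
    (ind_obj A B C coact_A) (ind_map A B)"
  unfolding cat_equivalence_def
proof (intro conjI functor_induction exI)
  show "functor_between (comodules :: ((('x, 'a) univ, 'a) rmod \<times> _, _) cat) (mod_cat BR) coinv_obj coinv_map"
    by (rule functor_coinv)
  show "natural_iso (mod_cat BR :: ((('x, 'a) univ, 'a) rmod, _) cat) (mod_cat BR) (\<lambda>X. X) (\<lambda>X Y f. f)
      (\<lambda>X. coinv_obj (ind_obj A B C coact_A X))
      (\<lambda>X Y f. coinv_map (ind_obj A B C coact_A X) (ind_obj A B C coact_A Y) (ind_map A B X Y f)) ind_unit"
    unfolding natural_iso_def
  proof (intro conjI ballI)
    fix X :: "(('x, 'a) univ, 'a) rmod" assume "X \<in> Obj (mod_cat BR)"
    then have X: "right_module BR X" by (simp add: mod_cat_def)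
    interpret X: induced_comodule A C \<Delta> \<epsilon> r B X by (rule induced_comoduleI[OF X])
    interpret FX: grouplike_comodule A C \<Delta> \<epsilon> r B X.F X.coact_F
      by (rule grouplike_comoduleI[OF X.right_comodule_ind])
    show "ind_unit X \<in> isos (mod_cat BR) X (coinv_obj (ind_obj A B C coact_A X))"
      using mod_cat_isoI[OF X FX.right_module_Mco, of "ind_unit X"] X.right_linear_ind_unit unit[OF X]
      by (simp add: mod_cat_def ind_obj_def) (simp add: ind_unit_def)
    fix Y :: "(('x, 'a) univ, 'a) rmod" and f
    assume "Y \<in> Obj (mod_cat BR)" and f: "f \<in> Hom (mod_cat BR) X Y"
    then have Y: "right_module BR Y" and lf: "right_linear BR X Y f" by (simp_all add: mod_cat_def)
    interpret f: induced_map A B X Y f by (rule induced_mapI[OF X Y lf])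
    show "Comp (mod_cat BR) X Y (coinv_obj (ind_obj A B C coact_A Y)) (ind_unit Y) f =
        Comp (mod_cat BR) X (coinv_obj (ind_obj A B C coact_A X)) (coinv_obj (ind_obj A B C coact_A Y))
          (coinv_map (ind_obj A B C coact_A X) (ind_obj A B C coact_A Y) (ind_map A B X Y f)) (ind_unit X)"
      by (rule extensionalityI[of _ "carrier X"])
        (simp_all add: mod_cat_def ind_obj_def compose_def ind_unit_def f.closed f.ind_map_pure X.ind_unit_coinv)
  qed
  show "natural_iso (comodules :: ((('x, 'a) univ, 'a) rmod \<times> _, _) cat) comodules
      (\<lambda>X. ind_obj A B C coact_A (coinv_obj X))
      (\<lambda>X Y f. ind_map A B (coinv_obj X) (coinv_obj Y) (coinv_map X Y f)) (\<lambda>X. X) (\<lambda>X Y f. f) ind_counit"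
    unfolding natural_iso_def
  proof (intro conjI ballI)
    fix X :: "(('x, 'a) univ, 'a) rmod \<times> (('x, 'a) univ \<Rightarrow> (('x, 'a) univ \<times> 'c) list)"
    assume XO: "X \<in> Obj comodules"
    obtain M \<sigma> where XM: "X = (M, \<sigma>)" by (cases X)
    have X: "right_comodule A C \<Delta> \<epsilon> M \<sigma>" using XO XM by (simp add: comod_cat_def)
    interpret X: induced_coinv A C \<Delta> \<epsilon> r B M \<sigma>
      by (intro induced_coinv.intro grouplike_comoduleI[OF X])
    show "ind_counit X \<in> isos comodules (ind_obj A B C coact_A (coinv_obj X)) X"
      using comodules_isoI[of X.G.F X.G.coact_F M \<sigma> "ind_counit (M, \<sigma>)"] counit[OF X]
        X.G.right_comodule_ind X.comodule_map_ind_counit X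
      by (simp add: XM ind_obj_def comod_cat_def) (simp add: ind_counit_def)
    fix Y :: "(('x, 'a) univ, 'a) rmod \<times> (('x, 'a) univ \<Rightarrow> (('x, 'a) univ \<times> 'c) list)" and f
    assume YO: "Y \<in> Obj comodules" and fH: "f \<in> Hom comodules X Y"
    obtain M' \<sigma>' where YM: "Y = (M', \<sigma>')" by (cases Y)
    have Y: "right_comodule A C \<Delta> \<epsilon> M' \<sigma>'" using YO YM by (simp add: comod_cat_def)
    interpret Y: induced_coinv A C \<Delta> \<epsilon> r B M' \<sigma>'
      by (intro induced_coinv.intro grouplike_comoduleI[OF Y])
    have f: "comodule_map A C M \<sigma> M' \<sigma>' f" using fH by (simp add: XM YM comod_cat_def)
    interpret cf: induced_map A B "coinv_mod M \<sigma>" "coinv_mod M' \<sigma>'" "restrict f X.Mco"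
      by (rule induced_mapI[OF X.right_module_Mco Y.right_module_Mco right_linear_coinv[OF X Y f]])
    have fa: "additive_map M M' f" and fr: "\<And>m a. m \<in> carrier M \<Longrightarrow> a \<in> carrier A \<Longrightarrow> f (ract M m a) = ract M' (f m) a"
      using f by (auto simp: comodule_map_def right_linear_def)
    have "ind_counit (M', \<sigma>') (ind_map A B (coinv_mod M \<sigma>) (coinv_mod M' \<sigma>') (restrict f X.Mco) z) =
        f (ind_counit (M, \<sigma>) z)" if z: "z \<in> carrier X.G.F" for z
    proof (rule X.G.Ind.ind_eqI[OF Y.M.M.abelian_group_axioms
          additive_map_comp[OF cf.additive_ind_map Y.additive_ind_counit]
          additive_map_comp[OF X.additive_ind_counit fa] _ z])
      fix m a assume "m \<in> carrier (coinv_mod M \<sigma>)" and a: "a \<in> carrier A"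
      then have m: "m \<in> X.Mco" by simp
      then have mM: "m \<in> carrier M" using X.Mco_subset by blast
      show "ind_counit (M', \<sigma>') (ind_map A B (coinv_mod M \<sigma>) (coinv_mod M' \<sigma>') (restrict f X.Mco)
          (X.G.ind_pure m a)) = f (ind_counit (M, \<sigma>) (X.G.ind_pure m a))"
        using m a mM comodule_map_coinv[OF X Y f m]
        by (simp add: cf.ind_map_pure X.ind_counit_pure Y.ind_counit_pure fr)
    qed
    then show "Comp comodules (ind_obj A B C coact_A (coinv_obj X)) (ind_obj A B C coact_A (coinv_obj Y)) Y
          (ind_counit Y) (ind_map A B (coinv_obj X) (coinv_obj Y) (coinv_map X Y f)) =
        Comp comodules (ind_obj A B C coact_A (coinv_obj X)) X Y f (ind_counit X)"
      by (intro extensionalityI[of _ "carrier X.G.F"])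
        (simp_all add: XM YM comod_cat_def ind_obj_def compose_def)
  qed
qed

end

section \<open>The unit for a cleft coring\<close>

text \<open>\<open>J\<close> stands for c |-> j'(c)(1), and \<open>J_comult\<close> is the identity
  between \<open>j'\<close> and the coproduct taken at 1. This is the part of the cleaving that
  speaks of the \<open>A\<close>-coring only, without \<open>D\<close> and \<open>j\<close>.\<close>

locale cleft_coring = grouplike_coring A C \<Delta> \<epsilon> r B
  for A :: "('k, 'a) module" and C :: "('c, 'a, 'a) bimod"
    and \<Delta> :: "'c \<Rightarrow> ('c \<times> 'c) list" and \<epsilon> :: "'c \<Rightarrow> 'a" and r :: "'a \<Rightarrow> 'c" and B :: "'a set" +
  fixes J :: "'c \<Rightarrow> 'a"
  assumes additive_J: "additive_map C A J"
    and J_lact: "a \<in> carrier A \<Longrightarrow> c \<in> carrier C \<Longrightarrow> J (lact C a c) = a \<otimes>\<^bsub>A\<^esub> J c"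
    and J_comult: "c \<in> carrier C \<Longrightarrow> tsum C (\<lambda>c1 c2. ract C c1 (J c2)) (\<Delta> c) = lact C (J c) (r \<one>\<^bsub>A\<^esub>)"
begin

lemmas J_closed = additive_mapD(1)[OF additive_J]
  and J_add = additive_mapD(2)[OF additive_J]

sublocale CC: tensor_right A A C C ..

lemma balanced_ract_J: "balanced_map A C C C (\<lambda>c1 c2. ract C c1 (J c2))"
  by (rule balanced_mapI)
    (simp_all add: C.ract_closed J_closed C.ract_add_left C.ract_add_right J_add J_lact C.ract_mult)

lemma J_r_closed: "a \<in> carrier A \<Longrightarrow> J (r a) \<in> carrier A"
  by (simp add: J_closed r_closed)

text \<open>Since \<Delta>(r a) = g \<otimes> r(a), \<open>J_comult\<close> at r(a) reads g J(r a) =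
  J(r a) g, and the left side is r(J(r a)); \<open>mem_B\<close> concludes.\<close>

lemma J_r_B: "a \<in> carrier A \<Longrightarrow> J (r a) \<in> B"
proof (rule mem_B)
  assume a: "a \<in> carrier A"
  then show q: "J (r a) \<in> carrier A" by (rule J_r_closed)
  have "ract C g (J (r a)) = lact C (J (r a)) g"
    using J_comult[of "r a"] CC.tsum_tpure[OF C.N.abelian_group_axioms balanced_ract_J] a
    by (simp add: comult_r r_closed)
  then show "r (J (r a)) = lact C (J (r a)) g" using r_eq[OF q] by simp
qed

lemma J_r_B_mult: "b \<in> B \<Longrightarrow> a \<in> carrier A \<Longrightarrow> J (r (b \<otimes>\<^bsub>A\<^esub> a)) = b \<otimes>\<^bsub>A\<^esub> J (r a)"
  using B_subset by (auto simp: r_B_mult J_lact r_closed)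

end

section \<open>The map \<open>p\<close> from a comodule into its coinvariants\<close>

locale cleft_comodule = cleft_coring A C \<Delta> \<epsilon> r B J + grouplike_comodule A C \<Delta> \<epsilon> r B M \<sigma>
  for A :: "('k, 'a) module" and C :: "('c, 'a, 'a) bimod"
    and \<Delta> :: "'c \<Rightarrow> ('c \<times> 'c) list" and \<epsilon> :: "'c \<Rightarrow> 'a" and r :: "'a \<Rightarrow> 'c" and B :: "'a set"
    and J :: "'c \<Rightarrow> 'a" and M :: "('m, 'a) rmod" and \<sigma> :: "'m \<Rightarrow> ('m \<times> 'c) list"
begin

definition p :: "'m \<Rightarrow> 'm" where "p m = tsum M (\<lambda>m' c. ract M m' (J c)) (\<sigma> m)"

lemma balanced_p: "balanced_map A M C M (\<lambda>m c. ract M m (J c))"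
  by (rule balanced_mapI)
    (simp_all add: M.ract_closed J_closed M.ract_add_left M.ract_add_right J_add J_lact M.ract_mult)

lemma additive_p: "additive_map M M p"
  unfolding p_def
  by (rule additive_map_comp[OF M.additive_coact M.MCC.additive_tsum[OF M.M.abelian_group_axioms balanced_p]])

lemmas p_closed = additive_mapD(1)[OF additive_p]

text \<open>The factor a acts on the last tensor factor of \<sigma>(m) and stays inside
  \<open>J\<close>, which is not assumed right \<open>A\<close>-linear.\<close>

lemma p_ract:
  assumes m: "m \<in> carrier M" and a: "a \<in> carrier A"
  shows "p (ract M m a) = tsum M (\<lambda>m' c. ract M m' (J (ract C c a))) (\<sigma> m)"
proof -
  have "p (ract M m a) = tsum M (\<lambda>m' c. tsum M (\<lambda>m c. ract M m (J c)) (tpure A M C m' (ract C c a))) (\<sigma> m)"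
    unfolding p_def M.coact_ract[OF m a] M.MCC.rtens_ract[OF M.coact_closed[OF m] a]
    by (rule M.MCC.additive_map_tsum_carrier[OF M.MCC.abelian_group_rtens M.M.abelian_group_axioms
          M.MCC.additive_tsum[OF M.M.abelian_group_axioms balanced_p] M.coact_closed[OF m]])
      (simp add: M.MCC.tpure_closed C.ract_closed a)
  also have "\<dots> = tsum M (\<lambda>m' c. ract M m' (J (ract C c a))) (\<sigma> m)"
    by (rule M.MCC.tsum_cong_carrier[OF M.coact_closed[OF m]])
      (simp add: M.MCC.tsum_tpure[OF M.M.abelian_group_axioms balanced_p] C.ract_closed a)
  finally show ?thesis .
qed

lemma p_Mco_ract:
  assumes "m \<in> Mco" "a \<in> carrier A"
  shows "p (ract M m a) = ract M m (J (r a))"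
  using M.MCC.tsum_tpure[OF M.M.abelian_group_axioms balanced_p, of m "r a"] assms Mco_subset
  by (auto simp: p_def coact_Mco_ract r_closed)

text \<open>In Sweedler notation: \<sigma>(m0 J(m1)) = m0 \<otimes> m1 J(m2) = m0 \<otimes> J(m1) g
  = m0 J(m1) \<otimes> g. The steps are right linearity of \<open>\<sigma>\<close> with
  coassociativity, then \<open>J_comult\<close>, then balancing.\<close>

lemma p_Mco:
  assumes m: "m \<in> carrier M"
  shows "p m \<in> Mco"
proof -
  let ?P = "rtens A M C"
  let ?f = "\<lambda>m c1 c2. tpure A M C m (ract C c1 (J c2))"
  note ag = M.MCC.abelian_group_rtens
  note bJ = balanced_mapD[OF balanced_ract_J]
  have f3: "balanced_map3 A A M C C ?P ?f"
    unfolding balanced_map3_def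
    by (intro conjI ballI balanced_mapI)
      (simp_all add: bJ M.MCC.tpure_closed M.MCC.tpure_add_left M.MCC.tpure_add_right
        M.MCC.tpure_balanced C.lact_ract J_closed)
  have "\<sigma> (p m) = tsum ?P (\<lambda>m' c. \<sigma> (ract M m' (J c))) (\<sigma> m)"
    unfolding p_def
    by (rule M.MCC.additive_map_tsum_carrier[OF M.M.abelian_group_axioms ag M.additive_coact
          M.coact_closed[OF m]]) (simp add: M.ract_closed J_closed)
  also have "\<dots> = tsum ?P (\<lambda>m' c. tsum ?P (\<lambda>m'' c'. ?f m'' c' c) (\<sigma> m')) (\<sigma> m)"
    by (rule M.MCC.tsum_cong_carrier[OF M.coact_closed[OF m]])
      (simp add: M.coact_ract J_closed M.MCC.rtens_ract M.coact_closed)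
  also have "\<dots> = tsum ?P (\<lambda>m c. tsum ?P (?f m) (\<Delta> c)) (\<sigma> m)"
    by (rule M.coassoc[OF ag f3 m])
  also have "\<dots> = tsum ?P (\<lambda>m c. tpure A M C (ract M m (J c)) g) (\<sigma> m)"
  proof (rule M.MCC.tsum_cong_carrier[OF M.coact_closed[OF m]])
    fix m c assume m: "m \<in> carrier M" and c: "c \<in> carrier C"
    have "tsum ?P (?f m) (\<Delta> c) = tpure A M C m (tsum C (\<lambda>c1 c2. ract C c1 (J c2)) (\<Delta> c))"
      by (rule CC.additive_map_tsum_carrier[OF C.N.abelian_group_axioms ag
            balanced_mapD(6)[OF M.MCC.balanced_tpure m] comult_closed[OF c], symmetric])
        (rule bJ(1))
    also have "\<dots> = tpure A M C (ract M m (J c)) g"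
      using m c by (simp add: J_comult M.MCC.tpure_balanced J_closed r_closed)
    finally show "tsum ?P (?f m) (\<Delta> c) = tpure A M C (ract M m (J c)) g" .
  qed
  also have "\<dots> = tpure A M C (p m) g"
    unfolding p_def
    by (rule M.MCC.additive_map_tsum_carrier[OF M.M.abelian_group_axioms ag
          balanced_mapD(5)[OF M.MCC.balanced_tpure] M.coact_closed[OF m], symmetric])
      (simp_all add: M.ract_closed J_closed r_closed)
  finally show ?thesis using p_closed[OF m] by (simp add: coinv_def)
qed

end

text \<open>\<open>a \<mapsto> \<Sum>\<^sub>l J(r(a a\<^sub>l)) u\<^sub>l\<close> is a left \<open>B\<close>-linear retraction of the inclusion of \<open>B\<close> into \<open>A\<close>;
  tensored with \<open>N\<close>, it inverts the unit of the adjunction.\<close>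

locale cleft_unit = cleft_coring A C \<Delta> \<epsilon> r B J + induced_comodule A C \<Delta> \<epsilon> r B N
  for A :: "('k, 'a) module" and C :: "('c, 'a, 'a) bimod"
    and \<Delta> :: "'c \<Rightarrow> ('c \<times> 'c) list" and \<epsilon> :: "'c \<Rightarrow> 'a" and r :: "'a \<Rightarrow> 'c" and B :: "'a set"
    and J :: "'c \<Rightarrow> 'a" and N :: "(('x, 'a) univ, 'a) rmod" +
  fixes L :: "('a \<times> 'a) list"
  assumes L: "L \<in> lists (carrier A \<times> B)"
    and L_one: "tsum A (\<lambda>a u. J (r a) \<otimes>\<^bsub>A\<^esub> u) L = \<one>\<^bsub>A\<^esub>"
begin

sublocale cleft_comodule A C \<Delta> \<epsilon> r B J F coact_F
  by (intro cleft_comodule.intro cleft_coring_axioms grouplike_comoduleI right_comodule_ind)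

definition retract :: "'a \<Rightarrow> 'a" where "retract a = tsum A (\<lambda>x u. J (r (a \<otimes>\<^bsub>A\<^esub> x)) \<otimes>\<^bsub>A\<^esub> u) L"

lemma BA: "b \<in> B \<Longrightarrow> b \<in> carrier A"
  using B_subset by blast

text \<open>Each summand is a product of J(r(a x)), which lies in \<open>B\<close> by
  \<open>J_r_B\<close>, and of u in \<open>B\<close>; summing in the subring instead of
  \<open>A\<close> gives membership at once.\<close>

lemma retract_B:
  assumes "a \<in> carrier A"
  shows "retract a \<in> B"
proof -
  have "tsum BR (\<lambda>x u. J (r (a \<otimes>\<^bsub>A\<^esub> x)) \<otimes>\<^bsub>A\<^esub> u) L \<in> carrier BR"
    by (rule tsum_closed[OF N.S.abelian_group_axioms L]) (use N.S.m_closed assms J_r_B in simp)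
  moreover have "tsum BR f L = tsum A f L" for f by (rule tsum_cong_target) simp_all
  ultimately show ?thesis by (simp add: retract_def)
qed

lemma retract_add:
  assumes "a \<in> carrier A" "a' \<in> carrier A"
  shows "retract (a \<oplus>\<^bsub>A\<^esub> a') = retract a \<oplus>\<^bsub>A\<^esub> retract a'"
proof -
  have "retract (a \<oplus>\<^bsub>A\<^esub> a') =
      tsum A (\<lambda>x u. J (r (a \<otimes>\<^bsub>A\<^esub> x)) \<otimes>\<^bsub>A\<^esub> u \<oplus>\<^bsub>A\<^esub> J (r (a' \<otimes>\<^bsub>A\<^esub> x)) \<otimes>\<^bsub>A\<^esub> u) L"
    unfolding retract_def
    by (rule tsum_cong[OF L])
      (simp add: assms BA A.l_distr r_add J_add J_closed r_closed)
  also have "\<dots> = retract a \<oplus>\<^bsub>A\<^esub> retract a'"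
    unfolding retract_def
    by (rule tsum_add_fun[OF A.abelian_group_axioms L]) (simp_all add: assms J_r_closed BA)
  finally show ?thesis .
qed

lemma additive_mult: "a \<in> carrier A \<Longrightarrow> additive_map A A (\<lambda>x. a \<otimes>\<^bsub>A\<^esub> x)"
  by (rule additive_mapI) (simp_all add: A.r_distr)

lemma retract_B_mult:
  assumes b: "b \<in> B" and a: "a \<in> carrier A"
  shows "retract (b \<otimes>\<^bsub>A\<^esub> a) = b \<otimes>\<^bsub>A\<^esub> retract a"
proof -
  have "retract (b \<otimes>\<^bsub>A\<^esub> a) = tsum A (\<lambda>x u. b \<otimes>\<^bsub>A\<^esub> (J (r (a \<otimes>\<^bsub>A\<^esub> x)) \<otimes>\<^bsub>A\<^esub> u)) L"
    unfolding retract_def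
    by (rule tsum_cong[OF L]) (simp add: a b BA A.m_assoc J_r_B_mult J_r_closed)
  also have "\<dots> = b \<otimes>\<^bsub>A\<^esub> retract a"
    unfolding retract_def
    by (rule additive_map_tsum[OF A.abelian_group_axioms A.abelian_group_axioms
          additive_mult[OF BA[OF b]] L, symmetric]) (simp add: a BA J_r_closed)
  finally show ?thesis .
qed

lemma retract_one: "retract \<one>\<^bsub>A\<^esub> = \<one>\<^bsub>A\<^esub>"
proof -
  have "retract \<one>\<^bsub>A\<^esub> = tsum A (\<lambda>a u. J (r a) \<otimes>\<^bsub>A\<^esub> u) L"
    unfolding retract_def by (rule tsum_cong[OF L]) simp
  then show ?thesis by (simp add: L_one)
qed

text \<open>Left \<open>B\<close>-linearity of \<open>retract\<close> is what allows n \<otimes> a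
  |-> n retract(a) to be defined on the tensor product over \<open>B\<close>.\<close>

lemma balanced_retract: "balanced_map BR N (alg_bimod A id id) N (\<lambda>n a. ract N n (retract a))"
  by (rule balanced_mapI)
    (simp_all add: N.ract_closed N.ract_add_left N.ract_mult[simplified] retract_B retract_add
      retract_B_mult N.ract_add_right[simplified] BA)

definition unit_inv :: "('x, 'a) univ \<Rightarrow> ('x, 'a) univ"
  where "unit_inv z = tsum N (\<lambda>n a. ract N n (retract a)) (summands z)"

lemma additive_unit_inv: "additive_map F N unit_inv"
  unfolding unit_inv_def by (rule Ind.additive_tsum_ind[OF N.M.abelian_group_axioms balanced_retract])

lemma unit_inv_pure: "n \<in> carrier N \<Longrightarrow> a \<in> carrier A \<Longrightarrow> unit_inv (ind_pure n a) = ract N n (retract a)"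
  unfolding unit_inv_def by (rule Ind.tsum_ind_pure[OF N.M.abelian_group_axioms balanced_retract])

lemma p_pure:
  assumes "n \<in> carrier N" "a \<in> carrier A"
  shows "p (ind_pure n a) = ind_pure n (J (r a))"
  using p_Mco_ract[OF ind_unit_coinv[OF assms(1)] assms(2)] assms
  by (simp add: Ind.ind_pure_ract J_r_closed)

text \<open>On n \<otimes> a both sides are n \<otimes> retract(a): the right one because p(n
  \<otimes> a x) u = n \<otimes> J(r(a x)) u, the left one because retract(a) lies in
  \<open>B\<close> and crosses the tensor sign. No coinvariance of z is assumed, so that pure
  tensors suffice.\<close>

lemma ind_pure_unit_inv:
  assumes z: "z \<in> carrier F"
  shows "ind_pure (unit_inv z) \<one>\<^bsub>A\<^esub> = tsum F (\<lambda>x u. ract F (p (ract F z x)) u) L"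
proof (rule Ind.ind_eqI[OF Ind.abelian_group_ind _ _ _ z])
  note b = balanced_mapD[OF Ind.balanced_ind_pure]
  show "additive_map F F (\<lambda>z. ind_pure (unit_inv z) \<one>\<^bsub>A\<^esub>)"
    using additive_map_comp[OF additive_unit_inv b(5)] by simp
  show "additive_map F F (\<lambda>z. tsum F (\<lambda>x u. ract F (p (ract F z x)) u) L)"
  proof (rule additive_mapI)
    fix z z' assume z: "z \<in> carrier F" and z': "z' \<in> carrier F"
    have cl: "ract F (p (ract F z x)) u \<in> carrier F" if "z \<in> carrier F" "x \<in> carrier A" "u \<in> B" for z x u
      using that by (simp add: p_closed Ind.F.ract_closed BA)
    show "tsum F (\<lambda>x u. ract F (p (ract F z x)) u) L \<in> carrier F"
      by (rule tsum_closed[OF Ind.abelian_group_ind L]) (simp add: cl z)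
    have "tsum F (\<lambda>x u. ract F (p (ract F (z \<oplus>\<^bsub>F\<^esub> z') x)) u) L =
        tsum F (\<lambda>x u. ract F (p (ract F z x)) u \<oplus>\<^bsub>F\<^esub> ract F (p (ract F z' x)) u) L"
      by (rule tsum_cong[OF L])
        (simp add: z z' Ind.F.ract_add_left Ind.F.ract_closed p_closed BA additive_mapD(2)[OF additive_p])
    also have "\<dots> = tsum F (\<lambda>x u. ract F (p (ract F z x)) u) L \<oplus>\<^bsub>F\<^esub>
        tsum F (\<lambda>x u. ract F (p (ract F z' x)) u) L"
      by (rule tsum_add_fun[OF Ind.abelian_group_ind L]) (simp_all add: cl z z')
    finally show "tsum F (\<lambda>x u. ract F (p (ract F (z \<oplus>\<^bsub>F\<^esub> z') x)) u) L =
        tsum F (\<lambda>x u. ract F (p (ract F z x)) u) L \<oplus>\<^bsub>F\<^esub>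
        tsum F (\<lambda>x u. ract F (p (ract F z' x)) u) L" .
  qed
  fix n a assume n: "n \<in> carrier N" and a: "a \<in> carrier A"
  have additive_n: "additive_map A F (\<lambda>a. ind_pure n a)"
    by (rule additive_mapI)
      (use additive_mapD[OF balanced_mapD(6)[OF Ind.balanced_ind_pure n]] in \<open>simp_all only: alg_bimod_simps\<close>)
  have "tsum F (\<lambda>x u. ract F (p (ract F (ind_pure n a) x)) u) L =
      tsum F (\<lambda>x u. ind_pure n (J (r (a \<otimes>\<^bsub>A\<^esub> x)) \<otimes>\<^bsub>A\<^esub> u)) L"
    by (rule tsum_cong[OF L]) (simp add: n a Ind.ind_pure_ract p_pure J_r_closed BA)
  also have "\<dots> = ind_pure n (retract a)"
    unfolding retract_def
    by (rule additive_map_tsum[OF A.abelian_group_axioms Ind.abelian_group_ind _ L, symmetric])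
      (simp_all only: additive_n a J_r_closed BA A.m_closed)
  also have "\<dots> = ind_pure (ract N n (retract a)) \<one>\<^bsub>A\<^esub>"
    using ind_pure_balanced[OF n retract_B[OF a]] n BA[OF retract_B[OF a]] by (simp add: Ind.ind_pure_ract)
  finally show "ind_pure (unit_inv (ind_pure n a)) \<one>\<^bsub>A\<^esub> =
      tsum F (\<lambda>x u. ract F (p (ract F (ind_pure n a) x)) u) L"
    using n a by (simp add: unit_inv_pure)
qed

lemma bij_ind_unit: "bij_betw (ind_unit N) (carrier N) (coinv A C g F coact_F)"
proof (rule bij_betw_byWitness[where f' = unit_inv])
  show "\<forall>n\<in>carrier N. unit_inv (ind_unit N n) = n"
    using N.ract_one by (simp add: ind_unit_def unit_inv_pure retract_one)
  show "ind_unit N ` carrier N \<subseteq> coinv A C g F coact_F"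
    by (auto simp: ind_unit_def ind_unit_coinv)
  show "unit_inv ` coinv A C g F coact_F \<subseteq> carrier N"
    using additive_mapD(1)[OF additive_unit_inv] Mco_subset by blast
  show "\<forall>z\<in>coinv A C g F coact_F. ind_unit N (unit_inv z) = z"
  proof
    fix z assume z: "z \<in> coinv A C g F coact_F"
    then have zF: "z \<in> carrier F" using Mco_subset by blast
    \<comment> \<open>Coinvariance of z enters here, as p(z x) = z J(r x); what remains is z times
      the sum \<open>L_one\<close>.\<close>
    have "tsum F (\<lambda>x u. ract F (p (ract F z x)) u) L = tsum F (\<lambda>x u. ract F z (J (r x) \<otimes>\<^bsub>A\<^esub> u)) L"
      by (rule tsum_cong[OF L]) (simp add: p_Mco_ract[OF z] Ind.F.ract_mult zF J_r_closed BA)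
    also have "\<dots> = ract F z (tsum A (\<lambda>x u. J (r x) \<otimes>\<^bsub>A\<^esub> u) L)"
      by (rule additive_map_tsum[OF A.abelian_group_axioms Ind.abelian_group_ind _ L, symmetric])
        (auto intro!: additive_mapI simp: J_r_closed BA zF Ind.F.ract_closed Ind.F.ract_add_right)
    also have "\<dots> = z" by (simp add: L_one Ind.F.ract_one zF)
    finally show "ind_unit N (unit_inv z) = z"
      using ind_pure_unit_inv[OF zF] additive_mapD(1)[OF additive_unit_inv zF] by (simp add: ind_unit_def)
  qed
qed

end

section \<open>Cleft extensions\<close>

locale cleft_setup =
  fixes k :: "('k, 'e) ring_scheme"
    and R :: "('k, 'r) module"
    and D :: "('d, 'r, 'r) bimod" and \<Delta> :: "'d \<Rightarrow> ('d \<times> 'd) list" and \<epsilon> :: "'d \<Rightarrow> 'r"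
    and A :: "('k, 'a) module" and \<eta> :: "'r \<Rightarrow> 'a" and \<rho> :: "'a \<Rightarrow> ('a \<times> 'd) list"
    and B :: "'a set"
    and \<alpha> :: "('a \<times> 'd) list \<Rightarrow> 'a \<Rightarrow> ('a \<times> 'd) list"
    and j :: "'d \<Rightarrow> 'a" and j' :: "('a \<times> 'd) list \<Rightarrow> 'a \<Rightarrow> 'a"
  assumes coring: "coring k R D \<Delta> \<epsilon>"
    and cleft: "cleft_extension k R D \<Delta> \<epsilon> A \<eta> \<rho> B \<alpha>"
    and cleaving: "cleaving R D \<Delta> \<epsilon> A \<eta> \<rho> \<alpha> j j'"
begin

abbreviation "C \<equiv> ADbi R D A \<eta> \<alpha>"
abbreviation "CR \<equiv> AD R D A \<eta>"
abbreviation "\<Delta>C \<equiv> AD_comult R D \<Delta> A \<eta> \<alpha>"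
abbreviation "\<epsilon>C \<equiv> AD_counit \<epsilon> A \<eta>"
abbreviation "A' \<equiv> alg_bimod A id \<eta>"
abbreviation "AA \<equiv> alg_bimod A id id"
abbreviation "J \<equiv> \<lambda>c. j' c \<one>\<^bsub>A\<^esub>"
abbreviation "pure_C \<equiv> AD_pure R D A \<eta>"

lemma extension: "extension_by_coring k R D \<Delta> \<epsilon> A \<eta> \<rho> B"
  and C_coring: "AD_is_coring k R D \<Delta> \<epsilon> A \<eta> \<alpha>"
  and A_comodule: "right_comodule A C \<Delta>C \<epsilon>C AA (A_coact R D A \<eta> \<rho> \<alpha>)"
  and A_coact_left: "left_linear R (alg_bimod A \<eta> id) (tens A (alg_bimod A \<eta> id) C) (A_coact R D A \<eta> \<rho> \<alpha>)"
  using cleft by (simp_all add: cleft_extension_def)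

sublocale R: ring R
  using coring k_algebra.axioms(2) by (auto simp: coring_def)

sublocale A: ring A
  using extension k_algebra.axioms(2) by (auto simp: extension_by_coring_def)

sublocale D: lr_bimodule R R D
  using coring bimodule.lr_bimodule by (auto simp: coring_def)

sublocale C: lr_bimodule A A C
  using C_coring bimodule.lr_bimodule by (fastforce simp: AD_is_coring_def coring_def Let_def)

sublocale A': right_module R A'
  using extension by (auto simp: extension_by_coring_def right_comodule_def)

lemma eta_hom: "\<eta> \<in> ring_hom R A"
  using extension by (auto simp: extension_by_coring_def algebra_map_def)

lemma eta_closed: "x \<in> carrier R \<Longrightarrow> \<eta> x \<in> carrier A"
  by (rule ring_hom_closed[OF eta_hom])

sublocale A': lr_bimodule A R A'
  by unfold_locales
    (simp_all add: A.r_distr A.l_distr A.m_assoc eta_closed)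

sublocale AD: tensor_left A R A' D ..

sublocale AD: tensor_right R R A' D ..

lemma C_simps:
  "carrier C = carrier (rtens R A' D)" "zero C = zero (rtens R A' D)" "add C = add (rtens R A' D)"
  "lact C = lact (tens R A' D)"
  by (simp_all add: ADbi_def AD_def)

lemma CR_simps:
  "carrier CR = carrier (rtens R A' D)" "zero CR = zero (rtens R A' D)" "add CR = add (rtens R A' D)"
  "ract CR = ract (rtens R A' D)"
  by (simp_all add: AD_def)

lemma pure_closed: "a \<in> carrier A \<Longrightarrow> x \<in> carrier D \<Longrightarrow> pure_C a x \<in> carrier C"
  by (simp add: C_simps AD.tpure_closed)

lemma ract_eta: "c \<in> carrier C \<Longrightarrow> s \<in> carrier R \<Longrightarrow> ract C c (\<eta> s) = ract CR c s"
  using C_coring by (simp add: AD_is_coring_def Let_def)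

lemma comult_left_linear_D: "left_linear R D (tens R D D) \<Delta>"
  using coring by (simp add: coring_def bimodule_map_def)

lemma comult_D_closed: "x \<in> carrier D \<Longrightarrow> \<Delta> x \<in> carrier (rtens R D D)"
  using comult_left_linear_D by (auto simp: left_linear_def additive_map_def)

sublocale AAC: tensor_right A A AA C
  by (intro tensor_right.intro tensor.intro A.right_module_regular C.left_module_axioms C.lr_bimodule_axioms)

lemma balanced_lact_C: "balanced_map A AA C C (lact C)"
  by (rule balanced_mapI)
    (simp_all add: C.lact_closed C.lact_add_left C.lact_add_right C.lact_mult)

text \<open>The map a \<otimes> c |-> a c undoes c |-> 1 \<otimes> c. Thus equations about
  \<open>A_coact\<close>, which takes values in the tensor product of \<open>A\<close> and
  \<open>C\<close> over \<open>A\<close>, descend to equations about \<open>\<rho>\<close> in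
  \<open>C\<close>.\<close>

lemma tpure_one_inj:
  assumes "c \<in> carrier C" "c' \<in> carrier C" "tpure A AA C \<one>\<^bsub>A\<^esub> c = tpure A AA C \<one>\<^bsub>A\<^esub> c'"
  shows "c = c'"
proof -
  have "tsum C (lact C) (tpure A AA C \<one>\<^bsub>A\<^esub> x) = x" if "x \<in> carrier C" for x
    using AAC.tsum_tpure[OF C.N.abelian_group_axioms balanced_lact_C, of "\<one>\<^bsub>A\<^esub>" x] that
    by (simp add: C.lact_one)
  then show ?thesis using assms by metis
qed

lemma additive_rho: "additive_map A C \<rho>"
  using extension by (simp add: extension_by_coring_def right_comodule_def right_linear_def additive_map_def C_simps)

lemmas rho_closed = additive_mapD(1)[OF additive_rho]

text \<open>Right \<open>A\<close>-linearity of the coaction a |-> 1 \<otimes> \<rho>(a), with the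
  factor 1 cancelled. The action on the right is the given one of \<open>A\<close> on
  \<open>C\<close>.\<close>

lemma rho_mult:
  assumes a: "a \<in> carrier A" and x: "x \<in> carrier A"
  shows "\<rho> (a \<otimes>\<^bsub>A\<^esub> x) = ract C (\<rho> a) x"
proof (rule tpure_one_inj)
  have "right_linear A AA (rtens A AA C) (A_coact R D A \<eta> \<rho> \<alpha>)"
    using A_comodule by (simp add: right_comodule_def)
  then show "tpure A AA C \<one>\<^bsub>A\<^esub> (\<rho> (a \<otimes>\<^bsub>A\<^esub> x)) = tpure A AA C \<one>\<^bsub>A\<^esub> (ract C (\<rho> a) x)"
    using a x AAC.tpure_ract[of "\<one>\<^bsub>A\<^esub>" "\<rho> a" x] rho_closed
    by (simp add: right_linear_def A_coact_def)
qed (simp_all add: rho_closed a x C.ract_closed)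

sublocale CC: tensor_right A A C C ..

sublocale CC: tensor_left A A C C ..

sublocale A_com: comodule_over A C \<Delta>C \<epsilon>C AA "A_coact R D A \<eta> \<rho> \<alpha>"
proof -
  interpret AA: right_module A AA by (rule A.right_module_regular)
  show "comodule_over A C \<Delta>C \<epsilon>C AA (A_coact R D A \<eta> \<rho> \<alpha>)"
    by unfold_locales
      (use A_comodule C_coring in \<open>simp_all add: AD_is_coring_def coring_def bimodule_map_def Let_def\<close>)
qed

text \<open>Coassociativity of \<open>A\<close>, evaluated on (m, c1, c2) |-> m c1 \<otimes> c2:
  applying the coaction twice to a gives \<rho>(1) \<otimes> \<rho>(a), applying
  \<open>\<Delta>C\<close> gives \<Delta>(\<rho>(a)). At a = 1 it says that \<rho>(1) is
  grouplike.\<close>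

lemma comult_rho:
  assumes a: "a \<in> carrier A"
  shows "\<Delta>C (\<rho> a) = tpure A C C (\<rho> \<one>\<^bsub>A\<^esub>) (\<rho> a)"
proof -
  let ?f = "\<lambda>m c1 c2. tpure A C C (lact C m c1) c2"
  note ag = CC.abelian_group_rtens
  have f3: "balanced_map3 A A AA C C (rtens A C C) ?f"
    unfolding balanced_map3_def
    by (intro conjI ballI balanced_mapI)
      (simp_all add: CC.tpure_closed CC.tpure_add_left CC.tpure_add_right CC.tpure_balanced
        C.lact_closed C.lact_add_left C.lact_add_right C.lact_mult C.lact_ract[symmetric] C.ract_closed
        flip: CC.tpure_balanced)
  have 1: "tsum (rtens A C C) (\<lambda>m c. tsum (rtens A C C) (\<lambda>m' c'. ?f m' c' c) (A_coact R D A \<eta> \<rho> \<alpha> m))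
      (A_coact R D A \<eta> \<rho> \<alpha> a) = tpure A C C (\<rho> \<one>\<^bsub>A\<^esub>) (\<rho> a)"
    using AAC.tsum_tpure[OF ag A_com.balanced_coact[OF ag f3], of "\<one>\<^bsub>A\<^esub>" "\<rho> a"]
      AAC.tsum_tpure[OF ag f3[unfolded balanced_map3_def, THEN conjunct1, rule_format], of "\<rho> a" "\<one>\<^bsub>A\<^esub>" "\<rho> \<one>\<^bsub>A\<^esub>"]
      rho_closed a by (simp add: A_coact_def C.lact_one)
  have 2: "tsum (rtens A C C) (\<lambda>m c. tsum (rtens A C C) (?f m) (\<Delta>C c)) (A_coact R D A \<eta> \<rho> \<alpha> a) =
      tsum (rtens A C C) (?f \<one>\<^bsub>A\<^esub>) (\<Delta>C (\<rho> a))"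
    using AAC.tsum_tpure[OF ag A_com.balanced_comult[OF ag f3], of "\<one>\<^bsub>A\<^esub>" "\<rho> a"] rho_closed a
    by (simp add: A_coact_def)
  have cl: "\<Delta>C (\<rho> a) \<in> carrier (rtens A C C)"
    using A_com.comult_closed rho_closed a by simp
  have "tsum (rtens A C C) (?f \<one>\<^bsub>A\<^esub>) (\<Delta>C (\<rho> a)) = tsum (rtens A C C) (tpure A C C) (\<Delta>C (\<rho> a))"
    by (rule CC.tsum_cong_carrier[OF cl]) (simp add: C.lact_one)
  then show ?thesis
    using A_com.coassoc[OF ag f3, of a] 1 2 a CC.tsum_tpure_self[OF cl] by simp
qed

lemma C_bimodule_maps:
  "bimodule_map A A C (tens A C C) \<Delta>C" "bimodule_map A A C (alg_bimod A id id) \<epsilon>C"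
  "\<And>c. c \<in> carrier C \<Longrightarrow> tsum C (\<lambda>x y. lact C (\<epsilon>C x) y) (\<Delta>C c) = c"
  using C_coring by (auto simp: AD_is_coring_def coring_def Let_def)

lemma counit_closed: "c \<in> carrier C \<Longrightarrow> \<epsilon>C c \<in> carrier A"
  and counit_add: "c \<in> carrier C \<Longrightarrow> c' \<in> carrier C \<Longrightarrow> \<epsilon>C (c \<oplus>\<^bsub>C\<^esub> c') = \<epsilon>C c \<oplus>\<^bsub>A\<^esub> \<epsilon>C c'"
  and counit_lact: "c \<in> carrier C \<Longrightarrow> a \<in> carrier A \<Longrightarrow> \<epsilon>C (lact C a c) = a \<otimes>\<^bsub>A\<^esub> \<epsilon>C c"
  and counit_ract: "c \<in> carrier C \<Longrightarrow> a \<in> carrier A \<Longrightarrow> \<epsilon>C (ract C c a) = \<epsilon>C c \<otimes>\<^bsub>A\<^esub> a"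
  using C_bimodule_maps(2)
  by (auto simp: bimodule_map_def left_linear_def right_linear_def additive_map_def)

lemma counit_rho:
  assumes a: "a \<in> carrier A"
  shows "\<epsilon>C (\<rho> a) = a"
proof -
  have b: "balanced_map A AA C A (\<lambda>y c. ract AA y (\<epsilon>C c))"
    by (rule balanced_mapI)
      (simp_all add: counit_closed counit_add counit_lact A.l_distr A.r_distr A.m_assoc)
  have "tsum A (\<lambda>y c. ract AA y (\<epsilon>C c)) (A_coact R D A \<eta> \<rho> \<alpha> a) = a"
    using A_com.counit[of a] a by simp
  then show ?thesis
    using AAC.tsum_tpure[OF A.abelian_group_axioms b, of "\<one>\<^bsub>A\<^esub>" "\<rho> a"] a rho_closed
    by (simp add: A_coact_def counit_closed)
qed

sublocale G: grouplike_coring A C \<Delta>C \<epsilon>C \<rho> B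
proof
  show "B = {b \<in> carrier A. \<forall>a\<in>carrier A. \<rho> (b \<otimes>\<^bsub>A\<^esub> a) = lact C b (\<rho> a)}"
    using extension by (simp add: extension_by_coring_def coinvariants_def C_simps)
qed (fact C_bimodule_maps additive_rho rho_mult comult_rho counit_rho)+

lemma A_coact_eq: "A_coact R D A \<eta> \<rho> \<alpha> = G.coact_A"
  by (simp add: A_coact_def fun_eq_iff)

text \<open>Left \<open>R\<close>-linearity of the coaction, at 1, equates the images of \<eta>(s)
  and of \<eta>(s) \<otimes> \<rho>(1) in the tensor product of \<open>A\<close> and
  \<open>C\<close>; multiplying out gives \<rho>(\<eta> s) = \<eta>(s) \<rho>(1), which is the test
  of \<open>mem_B\<close>.\<close>

lemma eta_B:
  assumes s: "s \<in> carrier R"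
  shows "\<eta> s \<in> B"
proof (rule G.mem_B)
  have e: "\<eta> s \<in> carrier A" by (rule eta_closed[OF s])
  then show "\<eta> s \<in> carrier A" .
  \<comment> \<open>\<open>A_coact_left\<close> is stated for \<open>A\<close> with left action
    through \<open>\<eta>\<close>, which is formally another first factor than \<open>AA\<close>.
    Both sides are therefore compared after multiplication into \<open>C\<close>.\<close>
  interpret E: tensor A "alg_bimod A \<eta> id" C
    by (intro tensor.intro right_module_cong[OF A.right_module_regular] C.left_module_axioms)
      (auto simp: fun_eq_iff)
  let ?u = "A_coact R D A \<eta> \<rho> \<alpha> \<one>\<^bsub>A\<^esub>"
  have u: "?u \<in> carrier (rtens A AA C)" by (rule A_com.coact_closed) simp
  have bE: "balanced_map A (alg_bimod A \<eta> id) C C (lact C)"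
    using balanced_lact_C by (simp add: balanced_map_def additive_map_def)
  have bA: "balanced_map A AA C C (\<lambda>m c. lact C (\<eta> s \<otimes>\<^bsub>A\<^esub> m) c)"
    by (rule balanced_mapI)
      (simp_all add: e C.lact_closed C.lact_add_left C.lact_add_right C.lact_mult A.r_distr)
  have l: "map (\<lambda>(m, n). (\<eta> s \<otimes>\<^bsub>A\<^esub> m, n)) ?u \<in> lists (carrier (alg_bimod A \<eta> id) \<times> carrier C)"
    using AAC.rtens_carrierD(1)[OF u] by (induction rule: lists.induct) (auto simp: e)
  have "A_coact R D A \<eta> \<rho> \<alpha> (\<eta> s) = trep A (alg_bimod A \<eta> id) C (map (\<lambda>(m, n). (\<eta> s \<otimes>\<^bsub>A\<^esub> m, n)) ?u)"
    using A_coact_left s e by (auto simp: left_linear_def dest!: bspec[of _ _ s] bspec[of _ _ "\<one>\<^bsub>A\<^esub>"])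
  then have "tsum C (lact C) (A_coact R D A \<eta> \<rho> \<alpha> (\<eta> s)) =
      tsum C (lact C) (map (map_prod (\<lambda>m. \<eta> s \<otimes>\<^bsub>A\<^esub> m) (\<lambda>n. n)) ?u)"
    using E.tsum_trep[OF C.N.abelian_group_axioms bE l] by (simp add: map_prod_def)
  then have "tsum C (lact C) (A_coact R D A \<eta> \<rho> \<alpha> (\<eta> s)) = tsum C (\<lambda>m c. lact C (\<eta> s \<otimes>\<^bsub>A\<^esub> m) c) ?u"
    by (simp add: tsum_map)
  then show "\<rho> (\<eta> s) = lact C (\<eta> s) (\<rho> \<one>\<^bsub>A\<^esub>)"
    using AAC.tsum_tpure[OF C.N.abelian_group_axioms balanced_lact_C, of "\<one>\<^bsub>A\<^esub>" "\<rho> (\<eta> s)"]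
      AAC.tsum_tpure[OF C.N.abelian_group_axioms bA, of "\<one>\<^bsub>A\<^esub>" "\<rho> \<one>\<^bsub>A\<^esub>"] e rho_closed
    by (simp add: A_coact_def C.lact_one)
qed

section \<open>The cleaving maps \<open>j\<close> and \<open>j'\<close>\<close>

lemma j'_right_linear: "c \<in> carrier C \<Longrightarrow> right_linear A AA AA (j' c)"
  and j'_add: "c \<in> carrier C \<Longrightarrow> c' \<in> carrier C \<Longrightarrow> x \<in> carrier A \<Longrightarrow> j' (c \<oplus>\<^bsub>C\<^esub> c') x = j' c x \<oplus>\<^bsub>A\<^esub> j' c' x"
  and j'_lact: "a \<in> carrier A \<Longrightarrow> c \<in> carrier C \<Longrightarrow> x \<in> carrier A \<Longrightarrow> j' (lact C a c) x = a \<otimes>\<^bsub>A\<^esub> j' c x"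
  and j'_ract: "c \<in> carrier C \<Longrightarrow> s \<in> carrier R \<Longrightarrow> x \<in> carrier A \<Longrightarrow> j' (ract CR c s) x = j' c (\<eta> s \<otimes>\<^bsub>A\<^esub> x)"
  and j'_comult: "c \<in> carrier C \<Longrightarrow> x \<in> carrier A \<Longrightarrow>
    tsum C (\<lambda>c1 c2. ract C c1 (j' c2 x)) (\<Delta>C c) =
    tsum C (\<lambda>x0 x1. lact C (j' c x0) x1) (A_coact R D A \<eta> \<rho> \<alpha> x)"
  and j'_j: "y \<in> carrier D \<Longrightarrow> a \<in> carrier A \<Longrightarrow>
    tsum A (\<lambda>b c. b \<otimes>\<^bsub>A\<^esub> j' c a) (A_coact R D A \<eta> \<rho> \<alpha> (j y)) = \<eta> (\<epsilon> y) \<otimes>\<^bsub>A\<^esub> a"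
  and j_j': "c \<in> carrier C \<Longrightarrow>
    tsum C (\<lambda>c1 c2. ract C c1 (tsum A (\<lambda>y e. j' y (j e)) (AD_coact R D \<Delta> A \<eta> c2))) (\<Delta>C c) = c"
  using cleaving by (simp_all add: cleaving_def Let_def)

lemma j_left_linear: "left_linear R D (alg_bimod A \<eta> \<eta>) j"
  using cleaving by (simp add: cleaving_def Let_def)

lemma j_closed: "x \<in> carrier D \<Longrightarrow> j x \<in> carrier A"
  and j_add: "x \<in> carrier D \<Longrightarrow> y \<in> carrier D \<Longrightarrow> j (x \<oplus>\<^bsub>D\<^esub> y) = j x \<oplus>\<^bsub>A\<^esub> j y"
  and j_lact: "x \<in> carrier D \<Longrightarrow> s \<in> carrier R \<Longrightarrow> j (lact D s x) = \<eta> s \<otimes>\<^bsub>A\<^esub> j x"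
  using j_left_linear by (auto simp: left_linear_def additive_map_def)

text \<open>A right linear endomorphism of \<open>A\<close> is left multiplication by its value at
  1, so \<open>J\<close> determines \<open>j'\<close>.\<close>

lemma j'_mult:
  assumes "c \<in> carrier C" "x \<in> carrier A"
  shows "j' c x = J c \<otimes>\<^bsub>A\<^esub> x"
proof -
  have "\<forall>x\<in>carrier A. \<forall>s\<in>carrier A. j' c (x \<otimes>\<^bsub>A\<^esub> s) = j' c x \<otimes>\<^bsub>A\<^esub> s"
    using j'_right_linear[OF assms(1)] by (simp add: right_linear_def)
  then have "j' c (\<one>\<^bsub>A\<^esub> \<otimes>\<^bsub>A\<^esub> x) = J c \<otimes>\<^bsub>A\<^esub> x" using assms(2) A.one_closed by blast
  then show ?thesis using assms(2) by simp
qed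

lemma j'_closed: "c \<in> carrier C \<Longrightarrow> x \<in> carrier A \<Longrightarrow> j' c x \<in> carrier A"
  using j'_right_linear[of c] by (auto simp: right_linear_def additive_map_def)

lemma j'_j_mult: "c \<in> carrier C \<Longrightarrow> x \<in> carrier D \<Longrightarrow> j' c (j x) = J c \<otimes>\<^bsub>A\<^esub> j x"
  by (rule j'_mult[OF _ j_closed])

lemma additive_J: "additive_map C A J"
  by (rule additive_mapI)
    (simp_all add: j'_closed j'_add)

text \<open>Right \<open>R\<close>-linearity of \<open>j'\<close> at 1 gives j'(c)(\<eta> s), which
  is J(c) \<eta>(s); \<open>ract_eta\<close> identifies the two right \<open>R\<close>-actions on
  \<open>C\<close>. It is the source of every balancedness over \<open>R\<close> below.\<close>

lemma J_ract_eta: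
  assumes "c \<in> carrier C" "s \<in> carrier R"
  shows "J (ract C c (\<eta> s)) = J c \<otimes>\<^bsub>A\<^esub> \<eta> s"
  using assms j'_mult[of c "\<eta> s"] by (simp add: ract_eta j'_ract eta_closed)

sublocale K: cleft_coring A C \<Delta>C \<epsilon>C \<rho> B J
proof
  fix c assume c: "c \<in> carrier C"
  have b: "balanced_map A AA C C (\<lambda>x0 x1. lact C (j' c x0) x1)"
    using j'_right_linear[OF c]
    by (intro balanced_mapI)
      (auto simp: right_linear_def additive_map_def C.lact_closed C.lact_add_left C.lact_add_right
        C.lact_mult Pi_iff)
  \<comment> \<open>\<open>j'_comult\<close> at x = 1: the coaction of 1 is the pure tensor 1
    \<otimes> \<rho>(1), so the right side collapses to J(c) \<rho>(1).\<close>
  show "tsum C (\<lambda>c1 c2. ract C c1 (J c2)) (\<Delta>C c) = lact C (J c) (\<rho> \<one>\<^bsub>A\<^esub>)"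
    using j'_comult[OF c, of "\<one>\<^bsub>A\<^esub>"] AAC.tsum_tpure[OF C.N.abelian_group_axioms b, of "\<one>\<^bsub>A\<^esub>" "\<rho> \<one>\<^bsub>A\<^esub>"]
      rho_closed by (simp add: A_coact_def)
qed (simp_all add: additive_J j'_lact)

text \<open>The first cleaving identity at 1, where the coaction of j(x) is the pure tensor 1
  \<otimes> \<rho>(j x).\<close>

lemma J_rho_j:
  assumes x: "x \<in> carrier D"
  shows "J (\<rho> (j x)) = \<eta> (\<epsilon> x)"
proof -
  have b: "balanced_map A AA C A (\<lambda>b c. b \<otimes>\<^bsub>A\<^esub> J c)"
    by (rule balanced_mapI)
      (simp_all add: K.J_closed K.J_add K.J_lact A.l_distr A.r_distr A.m_assoc)
  have "\<epsilon> x \<in> carrier R"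
    using coring x by (auto simp: coring_def bimodule_map_def left_linear_def additive_map_def)
  then show ?thesis
    using j'_j[OF x, of "\<one>\<^bsub>A\<^esub>"] AAC.tsum_tpure[OF A.abelian_group_axioms b, of "\<one>\<^bsub>A\<^esub>" "\<rho> (j x)"] x
    by (simp add: A_coact_def j_closed rho_closed K.J_closed eta_closed)
qed

section \<open>The convolution of \<open>J\<close> with \<open>j\<close>\<close>

lemma tsum_AD_comult:
  assumes Z: "abelian_group Z" and h: "balanced_map A C C Z h" and c: "c \<in> carrier C"
  shows "tsum Z h (\<Delta>C c) =
    tsum Z (\<lambda>a x. tsum Z (\<lambda>x1 x2. h (pure_C a x1) (pure_C \<one>\<^bsub>A\<^esub> x2)) (\<Delta> x)) c"
proof -
  interpret DD: tensor R D D ..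
  let ?P = "rtens A C C"
  let ?t = "\<lambda>a x1 x2. tpure A C C (pure_C a x1) (pure_C \<one>\<^bsub>A\<^esub> x2)"
  have ag: "abelian_group ?P" by (rule CC.abelian_group_rtens)
  have t: "?t a x1 x2 \<in> carrier ?P" if "a \<in> carrier A" "x1 \<in> carrier D" "x2 \<in> carrier D" for a x1 x2
    using that by (simp add: CC.tpure_closed pure_closed)
  have "tsum Z h (\<Delta>C c) = tsum Z h (tsum ?P (\<lambda>a x. tsum ?P (?t a) (\<Delta> x)) c)"
    by (simp add: AD_comult_def Let_def)
  also have "\<dots> = tsum Z (\<lambda>a x. tsum Z h (tsum ?P (?t a) (\<Delta> x))) c"
    by (rule AD.additive_map_tsum_carrier[OF ag Z CC.additive_tsum[OF Z h]])
      (use c in \<open>simp_all add: C_simps tsum_closed[OF ag DD.rtens_carrierD(1)[OF comult_D_closed] t]\<close>)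
  also have "\<dots> = tsum Z (\<lambda>a x. tsum Z (\<lambda>x1 x2. h (pure_C a x1) (pure_C \<one>\<^bsub>A\<^esub> x2)) (\<Delta> x)) c"
  proof (rule AD.tsum_cong_carrier)
    show "c \<in> carrier (rtens R A' D)" using c by (simp add: C_simps)
    fix a x assume a: "a \<in> carrier A'" and x: "x \<in> carrier D"
    have "tsum Z h (tsum ?P (?t a) (\<Delta> x)) = tsum Z (\<lambda>x1 x2. tsum Z h (?t a x1 x2)) (\<Delta> x)"
      by (rule DD.additive_map_tsum_carrier[OF ag Z CC.additive_tsum[OF Z h] comult_D_closed[OF x]])
        (use a t in simp)
    also have "\<dots> = tsum Z (\<lambda>x1 x2. h (pure_C a x1) (pure_C \<one>\<^bsub>A\<^esub> x2)) (\<Delta> x)"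
      by (rule DD.tsum_cong_carrier[OF comult_D_closed[OF x]])
        (use a in \<open>simp add: CC.tsum_tpure[OF Z h] pure_closed\<close>)
    finally show "tsum Z h (tsum ?P (?t a) (\<Delta> x)) =
        tsum Z (\<lambda>x1 x2. h (pure_C a x1) (pure_C \<one>\<^bsub>A\<^esub> x2)) (\<Delta> x)" .
  qed
  finally show ?thesis .
qed

text \<open>The left \<open>A\<close>-linear extension to A \<otimes> D of the convolution product
  of d |-> J(1 \<otimes> d) with \<open>j\<close>.\<close>

definition conv :: "('a \<times> 'd) list \<Rightarrow> 'a"
  where "conv c = tsum A (\<lambda>a x. tsum A (\<lambda>x1 x2. J (pure_C a x1) \<otimes>\<^bsub>A\<^esub> j x2) (\<Delta> x)) c"

text \<open>Identifies the expression in the last cleaving identity, which then reads: the sum of c1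
  conv(c2) over the coproduct of c is c.\<close>

lemma tsum_AD_coact:
  assumes c: "c \<in> carrier C"
  shows "tsum A (\<lambda>y e. j' y (j e)) (AD_coact R D \<Delta> A \<eta> c) = conv c"
proof -
  interpret DD: tensor R D D ..
  interpret CD: tensor R CR D
    by (intro tensor.intro right_module_cong[OF AD.right_module_rtens] D.left_module_axioms)
      (simp_all add: CR_simps)
  let ?P = "rtens R CR D" and ?h = "\<lambda>y e. j' y (j e)"
  let ?t = "\<lambda>a x1 x2. tpure R CR D (pure_C a x1) x2"
  have CR_C: "carrier CR = carrier C" by (simp add: CR_simps C_simps)
  have CR_add: "add CR = add C" by (simp add: CR_simps C_simps)
  have h: "balanced_map R CR D A ?h"
  proof (rule balanced_mapI)
    fix m s n assume a: "m \<in> carrier CR" "s \<in> carrier R" "n \<in> carrier D"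
    then show "j' (ract CR m s) (j n) = j' m (j (lact D s n))"
      by (simp add: CR_C j'_ract j_closed j_lact)
  next
    fix m n assume a: "m \<in> carrier CR" "n \<in> carrier D"
    then show "j' m (j n) \<in> carrier A" by (simp add: CR_C j'_j_mult j_closed K.J_closed)
    show "j' m (j (n \<oplus>\<^bsub>D\<^esub> n')) = j' m (j n) \<oplus>\<^bsub>A\<^esub> j' m (j n')" if "n' \<in> carrier D" for n'
      using a that j'_mult[of m "j n \<oplus>\<^bsub>A\<^esub> j n'"]
      by (simp add: CR_C j'_j_mult j_closed j_add K.J_closed A.r_distr)
    show "j' (m \<oplus>\<^bsub>CR\<^esub> m') (j n) = j' m (j n) \<oplus>\<^bsub>A\<^esub> j' m' (j n)" if "m' \<in> carrier CR" for m'
      using a that by (simp add: CR_C CR_add j'_add j_closed)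
  qed
  have ag: "abelian_group ?P" by (rule CD.abelian_group_rtens)
  have t: "?t a x1 x2 \<in> carrier ?P" if "a \<in> carrier A" "x1 \<in> carrier D" "x2 \<in> carrier D" for a x1 x2
    using that by (simp add: CD.tpure_closed pure_closed CR_C)
  note ah = CD.additive_tsum[OF A.abelian_group_axioms h]
  have "tsum A ?h (AD_coact R D \<Delta> A \<eta> c) = tsum A ?h (tsum ?P (\<lambda>a x. tsum ?P (?t a) (\<Delta> x)) c)"
    by (simp add: AD_coact_def Let_def)
  also have "\<dots> = tsum A (\<lambda>a x. tsum A ?h (tsum ?P (?t a) (\<Delta> x))) c"
    by (rule AD.additive_map_tsum_carrier[OF ag A.abelian_group_axioms ah])
      (use c in \<open>simp_all add: C_simps tsum_closed[OF ag DD.rtens_carrierD(1)[OF comult_D_closed] t]\<close>)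
  also have "\<dots> = conv c"
    unfolding conv_def
  proof (rule AD.tsum_cong_carrier)
    show "c \<in> carrier (rtens R A' D)" using c by (simp add: C_simps)
    fix a x assume a: "a \<in> carrier A'" and x: "x \<in> carrier D"
    have "tsum A ?h (tsum ?P (?t a) (\<Delta> x)) = tsum A (\<lambda>x1 x2. tsum A ?h (?t a x1 x2)) (\<Delta> x)"
      by (rule DD.additive_map_tsum_carrier[OF ag A.abelian_group_axioms ah comult_D_closed[OF x]])
        (use a t in simp)
    also have "\<dots> = tsum A (\<lambda>x1 x2. J (pure_C a x1) \<otimes>\<^bsub>A\<^esub> j x2) (\<Delta> x)"
      by (rule DD.tsum_cong_carrier[OF comult_D_closed[OF x]])
        (use a in \<open>simp add: CD.tsum_tpure[OF A.abelian_group_axioms h] pure_closed CR_C j'_j_mult j_closed\<close>)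
    finally show "tsum A ?h (tsum ?P (?t a) (\<Delta> x)) =
        tsum A (\<lambda>x1 x2. J (pure_C a x1) \<otimes>\<^bsub>A\<^esub> j x2) (\<Delta> x)" .
  qed
  finally show ?thesis .
qed

text \<open>Sends c' and a \<otimes> x to J(c' a) j(x). It is balanced over \<open>A\<close> in c'
  and c, and its sum over the coproduct of \<open>C\<close> is \<open>conv\<close>; the convolution
  thereby becomes a function to which coassociativity over \<open>A\<close> applies.\<close>

definition kap :: "('a \<times> 'd) list \<Rightarrow> ('a \<times> 'd) list \<Rightarrow> 'a"
  where "kap c' c = tsum A (\<lambda>a x. J (ract C c' a) \<otimes>\<^bsub>A\<^esub> j x) c"

text \<open>The scalar passes through \<open>J\<close> by \<open>J_ract_eta\<close> and into
  \<open>j\<close> by its left linearity: J(c' a \<eta>(s)) j(x) = J(c' a) \<eta>(s) j(x) = J(c' a)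
  j(s x).\<close>

lemma balanced_kap_inner:
  "c' \<in> carrier C \<Longrightarrow> balanced_map R A' D A (\<lambda>a x. J (ract C c' a) \<otimes>\<^bsub>A\<^esub> j x)"
  by (rule balanced_mapI)
    (simp_all add: K.J_closed C.ract_closed j_closed C.ract_add_right K.J_add A.l_distr j_add A.r_distr
      C.ract_mult eta_closed J_ract_eta A.m_assoc j_lact)

lemma kap_closed: "c' \<in> carrier C \<Longrightarrow> c \<in> carrier C \<Longrightarrow> kap c' c \<in> carrier A"
  unfolding kap_def
  by (rule AD.tsum_in_carrier[OF A.abelian_group_axioms balanced_kap_inner]) (simp_all add: C_simps)

lemma kap_add_left:
  assumes "c' \<in> carrier C" "c'' \<in> carrier C" "c \<in> carrier C"
  shows "kap (c' \<oplus>\<^bsub>C\<^esub> c'') c = kap c' c \<oplus>\<^bsub>A\<^esub> kap c'' c"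
proof -
  have c: "c \<in> carrier (rtens R A' D)" using assms(3) by (simp add: C_simps)
  have "kap (c' \<oplus>\<^bsub>C\<^esub> c'') c =
      tsum A (\<lambda>a x. J (ract C c' a) \<otimes>\<^bsub>A\<^esub> j x \<oplus>\<^bsub>A\<^esub> J (ract C c'' a) \<otimes>\<^bsub>A\<^esub> j x) c"
    unfolding kap_def
    by (rule AD.tsum_cong_carrier[OF c])
      (simp add: assms C.ract_add_left C.ract_closed K.J_add K.J_closed A.l_distr j_closed)
  also have "\<dots> = kap c' c \<oplus>\<^bsub>A\<^esub> kap c'' c"
    unfolding kap_def
    by (rule tsum_add_fun[OF A.abelian_group_axioms AD.rtens_carrierD(1)[OF c]])
      (simp_all add: assms K.J_closed C.ract_closed j_closed)
  finally show ?thesis .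
qed

lemma kap_lact:
  assumes "b \<in> carrier A" "c' \<in> carrier C" "c \<in> carrier C"
  shows "kap (lact C b c') c = b \<otimes>\<^bsub>A\<^esub> kap c' c"
proof -
  have c: "c \<in> carrier (rtens R A' D)" using assms(3) by (simp add: C_simps)
  have b: "additive_map A A (\<lambda>x. b \<otimes>\<^bsub>A\<^esub> x)" by (rule additive_mapI) (simp_all add: assms A.r_distr)
  have "kap (lact C b c') c = tsum A (\<lambda>a x. b \<otimes>\<^bsub>A\<^esub> (J (ract C c' a) \<otimes>\<^bsub>A\<^esub> j x)) c"
    unfolding kap_def
    by (rule AD.tsum_cong_carrier[OF c])
      (simp add: assms C.lact_ract[symmetric] K.J_lact C.ract_closed K.J_closed A.m_assoc j_closed)
  also have "\<dots> = b \<otimes>\<^bsub>A\<^esub> kap c' c"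
    unfolding kap_def
    by (rule AD.additive_map_tsum_carrier[OF A.abelian_group_axioms A.abelian_group_axioms b c, symmetric])
      (simp add: assms K.J_closed C.ract_closed j_closed)
  finally show ?thesis .
qed

lemma kap_balanced:
  assumes "c' \<in> carrier C" "b \<in> carrier A" "c \<in> carrier C"
  shows "kap (ract C c' b) c = kap c' (lact C b c)"
proof -
  have c: "c \<in> carrier (rtens R A' D)" using assms(3) by (simp add: C_simps)
  have "kap c' (lact C b c) = tsum A (\<lambda>a x. J (ract C c' (lact A' b a)) \<otimes>\<^bsub>A\<^esub> j x) c"
    unfolding kap_def C_simps
    by (rule AD.tsum_lact[OF A.abelian_group_axioms balanced_kap_inner c assms(2)])
      (use assms(1) in \<open>simp add: C_simps\<close>)
  also have "\<dots> = kap (ract C c' b) c"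
    unfolding kap_def by (rule AD.tsum_cong_carrier[OF c]) (simp add: assms C.ract_mult)
  finally show ?thesis by simp
qed

lemma additive_kap: "c' \<in> carrier C \<Longrightarrow> additive_map C A (kap c')"
  using AD.additive_tsum[OF A.abelian_group_axioms balanced_kap_inner]
  by (simp add: kap_def[abs_def] additive_map_def C_simps)

lemma balanced_kap: "balanced_map A C C A kap"
  by (rule balanced_mapI)
    (simp_all add: kap_closed kap_add_left kap_balanced additive_mapD(2)[OF additive_kap])

lemma kap_pure:
  assumes "c' \<in> carrier C" "a \<in> carrier A" "x \<in> carrier D"
  shows "kap c' (pure_C a x) = J (ract C c' a) \<otimes>\<^bsub>A\<^esub> j x"
  unfolding kap_def
  using AD.tsum_tpure[OF A.abelian_group_axioms balanced_kap_inner[OF assms(1)]] assms by simp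

lemma tsum_kap_comult:
  assumes c: "c \<in> carrier C"
  shows "tsum A kap (\<Delta>C c) = conv c"
proof -
  interpret DD: tensor R D D ..
  show ?thesis
    unfolding tsum_AD_comult[OF A.abelian_group_axioms balanced_kap c] conv_def
  proof (rule AD.tsum_cong_carrier)
    show "c \<in> carrier (rtens R A' D)" using c by (simp add: C_simps)
    fix a x assume a: "a \<in> carrier A'" and x: "x \<in> carrier D"
    show "tsum A (\<lambda>x1 x2. kap (pure_C a x1) (pure_C \<one>\<^bsub>A\<^esub> x2)) (\<Delta> x) =
        tsum A (\<lambda>x1 x2. J (pure_C a x1) \<otimes>\<^bsub>A\<^esub> j x2) (\<Delta> x)"
      by (rule DD.tsum_cong_carrier[OF comult_D_closed[OF x]])
        (use a in \<open>simp add: kap_pure pure_closed C.ract_one\<close>)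
  qed
qed

text \<open>Applying the counit to the second cleaving identity shows that \<open>j\<close> is a right convolution
  inverse of the map \<open>d \<mapsto> J (1 \<otimes> d)\<close>.\<close>

lemma conv_eq_counit:
  assumes c: "c \<in> carrier C"
  shows "conv c = \<epsilon>C c"
proof -
  have \<Delta>: "left_linear A C (tens A C C) \<Delta>C" using C_bimodule_maps(1) by (simp add: bimodule_map_def)
  have \<Delta>c: "\<Delta>C c \<in> carrier (rtens A C C)" using G.comult_closed[OF c] .
  have "additive_map C (rtens A C C) \<Delta>C" using \<Delta> by (simp add: left_linear_def additive_map_def)
  then have ad: "additive_map C A (\<lambda>c. tsum A kap (\<Delta>C c))"
    by (rule additive_map_comp[OF _ CC.additive_tsum[OF A.abelian_group_axioms balanced_kap]])
  have conv_cl: "conv c \<in> carrier A" if "c \<in> carrier C" for c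
    using additive_mapD(1)[OF ad that] tsum_kap_comult[OF that] by simp
  have ad: "additive_map C A conv"
    using ad tsum_kap_comult by (simp add: additive_map_def Pi_iff)
  \<comment> \<open>Left linearity is needed below to absorb the factor \<epsilon>(c1) into the
    argument of \<open>conv\<close>.\<close>
  have lin: "conv (lact C b c) = b \<otimes>\<^bsub>A\<^esub> conv c" if b: "b \<in> carrier A" and c: "c \<in> carrier C" for b c
  proof -
    have b': "additive_map A A (\<lambda>x. b \<otimes>\<^bsub>A\<^esub> x)" by (rule additive_mapI) (simp_all add: b A.r_distr)
    have \<Delta>c: "\<Delta>C c \<in> carrier (rtens A C C)" using G.comult_closed[OF c] .
    have "conv (lact C b c) = tsum A kap (lact (tens A C C) b (\<Delta>C c))"
      using \<Delta> b c by (simp add: tsum_kap_comult[symmetric] C.lact_closed left_linear_def)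
    also have "\<dots> = tsum A (\<lambda>c1 c2. kap (lact C b c1) c2) (\<Delta>C c)"
      by (rule CC.tsum_lact[OF A.abelian_group_axioms balanced_kap \<Delta>c b])
    also have "\<dots> = tsum A (\<lambda>c1 c2. b \<otimes>\<^bsub>A\<^esub> kap c1 c2) (\<Delta>C c)"
      by (rule CC.tsum_cong_carrier[OF \<Delta>c]) (simp add: kap_lact b)
    also have "\<dots> = b \<otimes>\<^bsub>A\<^esub> tsum A kap (\<Delta>C c)"
      by (rule CC.additive_map_tsum_carrier[OF A.abelian_group_axioms A.abelian_group_axioms b' \<Delta>c, symmetric])
        (rule kap_closed)
    finally show ?thesis by (simp add: tsum_kap_comult c)
  qed
  have \<epsilon>: "additive_map C A \<epsilon>C" by (rule additive_mapI) (simp_all add: counit_closed counit_add)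
  \<comment> \<open>With c = c1 conv(c2), the counit gives \<epsilon>(c) = \<epsilon>(c1) conv(c2) =
    conv(\<epsilon>(c1) c2) = conv(c).\<close>
  have "\<epsilon>C c = \<epsilon>C (tsum C (\<lambda>c1 c2. ract C c1 (conv c2)) (\<Delta>C c))"
    using j_j'[OF c] CC.tsum_cong_carrier[OF \<Delta>c, of
        "\<lambda>c1 c2. ract C c1 (tsum A (\<lambda>y e. j' y (j e)) (AD_coact R D \<Delta> A \<eta> c2))"
        "\<lambda>c1 c2. ract C c1 (conv c2)" C]
    by (simp add: tsum_AD_coact)
  also have "\<dots> = tsum A (\<lambda>c1 c2. \<epsilon>C (ract C c1 (conv c2))) (\<Delta>C c)"
    by (rule CC.additive_map_tsum_carrier[OF C.N.abelian_group_axioms A.abelian_group_axioms \<epsilon> \<Delta>c])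
      (simp add: C.ract_closed conv_cl)
  also have "\<dots> = tsum A (\<lambda>c1 c2. conv (lact C (\<epsilon>C c1) c2)) (\<Delta>C c)"
    by (rule CC.tsum_cong_carrier[OF \<Delta>c]) (simp add: counit_ract conv_cl lin counit_closed)
  also have "\<dots> = conv (tsum C (\<lambda>x y. lact C (\<epsilon>C x) y) (\<Delta>C c))"
    by (rule CC.additive_map_tsum_carrier[OF C.N.abelian_group_axioms A.abelian_group_axioms ad \<Delta>c, symmetric])
      (simp add: C.lact_closed counit_closed)
  also have "\<dots> = conv c" by (simp add: C_bimodule_maps(3) c)
  finally show ?thesis by simp
qed

lemma tsum_kap_counit: "c \<in> carrier C \<Longrightarrow> tsum A kap (\<Delta>C c) = \<epsilon>C c"
  by (simp add: tsum_kap_comult conv_eq_counit)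

text \<open>By coassociativity m0 kap(m1, m2) is m0 times the \<open>kap\<close>-sum over the
  coproduct of m1, that is m0 \<epsilon>(m1) = m. The two balancedness clauses serve to evaluate the
  sum for the regular comodule.\<close>

lemma tsum_kap_coact:
  fixes M :: "('m, 'a, 'f) rmod_scheme"
  assumes "comodule_over A C \<Delta>C \<epsilon>C M \<sigma>" and m: "m \<in> carrier M"
  shows "tsum M (\<lambda>m c. tsum M (\<lambda>m' c'. ract M m' (kap c' c)) (\<sigma> m)) (\<sigma> m) = m"
    and "balanced_map A M C M (\<lambda>m c. tsum M (\<lambda>m' c'. ract M m' (kap c' c)) (\<sigma> m))"
    and "c \<in> carrier C \<Longrightarrow> balanced_map A M C M (\<lambda>m' c'. ract M m' (kap c' c))"
proof -
  interpret M: comodule_over A C \<Delta>C \<epsilon>C M \<sigma> by fact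
  note ag = M.M.abelian_group_axioms
  note bk = balanced_mapD[OF balanced_kap]
  have f3: "balanced_map3 A A M C C M (\<lambda>m c1 c2. ract M m (kap c1 c2))"
    unfolding balanced_map3_def
    by (intro conjI ballI balanced_mapI)
      (simp_all add: bk M.ract_closed M.ract_add_left M.ract_add_right M.ract_mult kap_lact)
  have "tsum M (\<lambda>m c. tsum M (\<lambda>m' c'. ract M m' (kap c' c)) (\<sigma> m)) (\<sigma> m) =
      tsum M (\<lambda>m c. tsum M (\<lambda>c1 c2. ract M m (kap c1 c2)) (\<Delta>C c)) (\<sigma> m)"
    by (rule M.coassoc[OF ag f3 m])
  also have "\<dots> = tsum M (\<lambda>m c. ract M m (\<epsilon>C c)) (\<sigma> m)"
  proof (rule M.MCC.tsum_cong_carrier[OF M.coact_closed[OF m]])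
    fix m c assume m: "m \<in> carrier M" and c: "c \<in> carrier C"
    have ad: "additive_map A M (ract M m)"
      by (rule additive_mapI) (simp_all add: M.ract_closed M.ract_add_right m)
    have "tsum M (\<lambda>c1 c2. ract M m (kap c1 c2)) (\<Delta>C c) = ract M m (tsum A kap (\<Delta>C c))"
      by (rule CC.additive_map_tsum_carrier[OF A.abelian_group_axioms ag ad G.comult_closed[OF c], symmetric])
        (rule kap_closed)
    then show "tsum M (\<lambda>c1 c2. ract M m (kap c1 c2)) (\<Delta>C c) = ract M m (\<epsilon>C c)"
      by (simp add: tsum_kap_counit c)
  qed
  finally show "tsum M (\<lambda>m c. tsum M (\<lambda>m' c'. ract M m' (kap c' c)) (\<sigma> m)) (\<sigma> m) = m"
    by (simp add: M.counit m)
  show "balanced_map A M C M (\<lambda>m c. tsum M (\<lambda>m' c'. ract M m' (kap c' c)) (\<sigma> m))"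
    by (rule M.balanced_coact[OF ag f3])
  show "balanced_map A M C M (\<lambda>m' c'. ract M m' (kap c' c))" if "c \<in> carrier C"
    using f3 that by (simp add: balanced_map3_def)
qed

text \<open>The comodule \<open>A\<close> itself in \<open>tsum_kap_coact\<close>: its coaction
  consists of one pure tensor, which leaves kap(\<rho>(1), \<rho>(a)) = a; then \<rho>(1) x =
  \<rho>(x) inside \<open>J\<close>.\<close>

lemma tsum_rho_J_j:
  assumes a: "a \<in> carrier A"
  shows "tsum A (\<lambda>x y. J (\<rho> x) \<otimes>\<^bsub>A\<^esub> j y) (\<rho> a) = a"
proof -
  note k = tsum_kap_coact[OF A_com.comodule_over_axioms]
  have ag: "abelian_group AA" by (rule abelian_group_cong[OF A.abelian_group_axioms]) simp_all
  have ra: "\<rho> a \<in> carrier C" and r1: "\<rho> \<one>\<^bsub>A\<^esub> \<in> carrier C" using a by (simp_all add: rho_closed)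
  have "kap (\<rho> \<one>\<^bsub>A\<^esub>) (\<rho> a) = a"
    using k(1)[of a] a AAC.tsum_tpure[OF ag k(2), of a "\<one>\<^bsub>A\<^esub>" "\<rho> a"]
      AAC.tsum_tpure[OF ag k(3)[OF _ ra], of a "\<one>\<^bsub>A\<^esub>" "\<rho> \<one>\<^bsub>A\<^esub>"] ra r1
    by (simp add: A_coact_def kap_closed)
  moreover have "kap (\<rho> \<one>\<^bsub>A\<^esub>) (\<rho> a) = tsum A (\<lambda>x y. J (\<rho> x) \<otimes>\<^bsub>A\<^esub> j y) (\<rho> a)"
    unfolding kap_def
    by (rule AD.tsum_cong_carrier) (use ra in \<open>simp_all add: C_simps G.r_eq[symmetric]\<close>)
  ultimately show ?thesis by simp
qed

end

section \<open>Inverting the counit\<close>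

locale cleft_setup_comodule = cleft_setup k R D \<Delta> \<epsilon> A \<eta> \<rho> B \<alpha> j j'
  for k :: "('k, 'e) ring_scheme"
    and R :: "('k, 'r) module"
    and D :: "('d, 'r, 'r) bimod" and \<Delta> :: "'d \<Rightarrow> ('d \<times> 'd) list" and \<epsilon> :: "'d \<Rightarrow> 'r"
    and A :: "('k, 'a) module" and \<eta> :: "'r \<Rightarrow> 'a" and \<rho> :: "'a \<Rightarrow> ('a \<times> 'd) list"
    and B :: "'a set"
    and \<alpha> :: "('a \<times> 'd) list \<Rightarrow> 'a \<Rightarrow> ('a \<times> 'd) list"
    and j :: "'d \<Rightarrow> 'a" and j' :: "('a \<times> 'd) list \<Rightarrow> 'a \<Rightarrow> 'a" +
  fixes M :: "(('x, 'a) univ, 'a) rmod"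
    and \<sigma> :: "('x, 'a) univ \<Rightarrow> (('x, 'a) univ \<times> ('a \<times> 'd) list) list"
  assumes comodule: "right_comodule A (ADbi R D A \<eta> \<alpha>) (AD_comult R D \<Delta> A \<eta> \<alpha>) (AD_counit \<epsilon> A \<eta>) M \<sigma>"
begin

sublocale P: cleft_comodule A C \<Delta>C \<epsilon>C \<rho> B J M \<sigma>
  by (intro cleft_comodule.intro K.cleft_coring_axioms G.grouplike_comoduleI comodule)

sublocale IC: induced_coinv A C \<Delta>C \<epsilon>C \<rho> B M \<sigma>
  by (intro induced_coinv.intro P.grouplike_comodule_axioms)

abbreviation "F \<equiv> ind_mod A B (G.coinv_mod M \<sigma>)"

abbreviation "\<tau> \<equiv> G.ind_counit (M, \<sigma>)"

text \<open>\<open>J_ract_eta\<close> under the sum defining \<open>p\<close>: m0 J(m1 \<eta>(s)) =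
  m0 J(m1) \<eta>(s).\<close>

lemma p_eta:
  assumes m: "m \<in> carrier M" and s: "s \<in> carrier R"
  shows "P.p (ract M m (\<eta> s)) = ract M (P.p m) (\<eta> s)"
proof -
  note e = eta_closed[OF s]
  have ad: "additive_map M M (\<lambda>m. ract M m (\<eta> s))"
    by (rule additive_mapI) (simp_all add: P.M.ract_closed P.M.ract_add_left e)
  have "P.p (ract M m (\<eta> s)) = tsum M (\<lambda>m' c. ract M (ract M m' (J c)) (\<eta> s)) (\<sigma> m)"
    unfolding P.p_ract[OF m e]
    by (rule P.M.MCC.tsum_cong_carrier[OF P.M.coact_closed[OF m]])
      (simp add: J_ract_eta s e P.M.ract_mult K.J_closed)
  also have "\<dots> = ract M (P.p m) (\<eta> s)"
    unfolding P.p_def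
    by (rule P.M.MCC.additive_map_tsum_carrier[OF P.M.M.abelian_group_axioms P.M.M.abelian_group_axioms
          ad P.M.coact_closed[OF m], symmetric]) (simp add: P.M.ract_closed K.J_closed)
  finally show ?thesis .
qed

lemma p_in: "m \<in> carrier M \<Longrightarrow> P.p m \<in> carrier (G.coinv_mod M \<sigma>)"
  using P.p_Mco by simp

lemmas ip = balanced_mapD[OF IC.G.Ind.balanced_ind_pure, unfolded alg_bimod_simps]

lemma ip_balanced:
  assumes "m \<in> P.Mco" "b \<in> B" "a \<in> carrier A"
  shows "IC.G.ind_pure (ract M m b) a = IC.G.ind_pure m (b \<otimes>\<^bsub>A\<^esub> a)"
  using ip(4)[of m b a] assms by simp

text \<open>A scalar s of \<open>R\<close> leaves \<open>p\<close> by \<open>p_eta\<close>, crosses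
  the tensor sign over \<open>B\<close> because \<eta>(s) lies in \<open>B\<close>, and enters
  \<open>j\<close> by left linearity.\<close>

lemma balanced_inner:
  assumes m: "m \<in> carrier M"
  shows "balanced_map R A' D F (\<lambda>a x. IC.G.ind_pure (P.p (ract M m a)) (j x))"
proof (rule balanced_mapI)
  note pm = additive_mapD(2)[OF P.additive_p]
  fix a x assume "a \<in> carrier A'" and x: "x \<in> carrier D"
  then have a: "a \<in> carrier A" by simp
  have ma: "ract M m a \<in> carrier M" using m a by (simp add: P.M.ract_closed)
  show "IC.G.ind_pure (P.p (ract M m a)) (j x) \<in> carrier F"
    by (rule ip(1)[OF p_in[OF ma] j_closed[OF x]])
  show "IC.G.ind_pure (P.p (ract M m a)) (j (x \<oplus>\<^bsub>D\<^esub> y)) =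
      IC.G.ind_pure (P.p (ract M m a)) (j x) \<oplus>\<^bsub>F\<^esub> IC.G.ind_pure (P.p (ract M m a)) (j y)"
    if y: "y \<in> carrier D" for y
    using ip(3)[OF p_in[OF ma] j_closed[OF x] j_closed[OF y]] by (simp add: j_add x y)
  show "IC.G.ind_pure (P.p (ract M m (a \<oplus>\<^bsub>A'\<^esub> a'))) (j x) =
      IC.G.ind_pure (P.p (ract M m a)) (j x) \<oplus>\<^bsub>F\<^esub> IC.G.ind_pure (P.p (ract M m a')) (j x)"
    if "a' \<in> carrier A'" for a'
    using ip(2)[OF p_in[OF ma] p_in[of "ract M m a'"] j_closed[OF x]] m a that
    by (simp add: P.M.ract_add_right pm P.M.ract_closed)
  show "IC.G.ind_pure (P.p (ract M m (ract A' a s))) (j x) =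
      IC.G.ind_pure (P.p (ract M m a)) (j (lact D s x))" if s: "s \<in> carrier R" for s
    using ip_balanced[OF P.p_Mco[OF ma] eta_B[OF s] j_closed[OF x]] m a
    by (simp add: P.M.ract_mult eta_closed s p_eta ma j_lact x)
qed

text \<open>The map m \<otimes> d |-> p(m) \<otimes> j(d) read through the isomorphism of M
  \<otimes> (A \<otimes> D) with M \<otimes> D, that is m \<otimes> (a \<otimes> x) |-> p(m a)
  \<otimes> j(x). Summed over the coaction of m it inverts the counit.\<close>

definition \<phi> :: "('x, 'a) univ \<Rightarrow> ('a \<times> 'd) list \<Rightarrow> ('x, 'a) univ"
  where "\<phi> m c = tsum F (\<lambda>a x. IC.G.ind_pure (P.p (ract M m a)) (j x)) c"

lemma abelian_F: "abelian_group F"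
  by (rule IC.G.Ind.abelian_group_ind)

lemma balanced_phi: "balanced_map A M C F \<phi>"
proof (rule balanced_mapI)
  fix m c assume m: "m \<in> carrier M" and "c \<in> carrier C"
  then have c: "c \<in> carrier (rtens R A' D)" by (simp add: C_simps)
  note in_F = balanced_mapD(1)[OF balanced_inner]
  show "\<phi> m c \<in> carrier F"
    unfolding \<phi>_def by (rule AD.tsum_in_carrier[OF abelian_F balanced_inner[OF m] c])
  show "\<phi> m (c \<oplus>\<^bsub>C\<^esub> c') = \<phi> m c \<oplus>\<^bsub>F\<^esub> \<phi> m c'" if "c' \<in> carrier C" for c'
    using additive_mapD(2)[OF AD.additive_tsum[OF abelian_F balanced_inner[OF m]] c, of c'] that
    by (simp add: \<phi>_def C_simps)
  show "\<phi> (m \<oplus>\<^bsub>M\<^esub> m') c = \<phi> m c \<oplus>\<^bsub>F\<^esub> \<phi> m' c" if m': "m' \<in> carrier M" for m'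
  proof -
    have "\<phi> (m \<oplus>\<^bsub>M\<^esub> m') c = tsum F (\<lambda>a x. IC.G.ind_pure (P.p (ract M m a)) (j x) \<oplus>\<^bsub>F\<^esub>
        IC.G.ind_pure (P.p (ract M m' a)) (j x)) c"
      unfolding \<phi>_def
    proof (rule AD.tsum_cong_carrier[OF c])
      fix a x assume "a \<in> carrier A'" and x: "x \<in> carrier D"
      then have a: "a \<in> carrier A" by simp
      show "IC.G.ind_pure (P.p (ract M (m \<oplus>\<^bsub>M\<^esub> m') a)) (j x) =
          IC.G.ind_pure (P.p (ract M m a)) (j x) \<oplus>\<^bsub>F\<^esub> IC.G.ind_pure (P.p (ract M m' a)) (j x)"
        using ip(2)[OF p_in[of "ract M m a"] p_in[of "ract M m' a"] j_closed[OF x]] m m' a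
        by (simp add: P.M.ract_add_left additive_mapD(2)[OF P.additive_p] P.M.ract_closed)
    qed
    also have "\<dots> = \<phi> m c \<oplus>\<^bsub>F\<^esub> \<phi> m' c"
      unfolding \<phi>_def
      by (rule tsum_add_fun[OF abelian_F AD.rtens_carrierD(1)[OF c] in_F[OF m] in_F[OF m']])
    finally show ?thesis .
  qed
  show "\<phi> (ract M m b) c = \<phi> m (lact C b c)" if b: "b \<in> carrier A" for b
    unfolding \<phi>_def C_simps AD.tsum_lact[OF abelian_F balanced_inner[OF m] c b]
    by (rule AD.tsum_cong_carrier[OF c]) (simp add: P.M.ract_mult m b)
qed

lemma additive_counit_inv: "additive_map M F (\<lambda>m. tsum F \<phi> (\<sigma> m))"
  by (rule additive_map_comp[OF P.M.additive_coact P.M.MCC.additive_tsum[OF abelian_F balanced_phi]])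

text \<open>The counit of \<phi>(m, c) is the sum of m0 kap(m1, c), so the composite is m0 kap(m1,
  m2), which is m by \<open>tsum_kap_coact\<close>.\<close>

lemma counit_counit_inv:
  assumes m: "m \<in> carrier M"
  shows "\<tau> (tsum F \<phi> (\<sigma> m)) = m"
proof -
  note agM = P.M.M.abelian_group_axioms
  note at = IC.additive_ind_counit
  have "\<tau> (tsum F \<phi> (\<sigma> m)) = tsum M (\<lambda>m c. \<tau> (\<phi> m c)) (\<sigma> m)"
    by (rule P.M.MCC.additive_map_tsum_carrier[OF abelian_F agM at P.M.coact_closed[OF m]])
      (rule balanced_mapD(1)[OF balanced_phi])
  also have "\<dots> = tsum M (\<lambda>m c. tsum M (\<lambda>m' c'. ract M m' (kap c' c)) (\<sigma> m)) (\<sigma> m)"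
  proof (rule P.M.MCC.tsum_cong_carrier[OF P.M.coact_closed[OF m]])
    fix m c assume m: "m \<in> carrier M" and cC: "c \<in> carrier C"
    then have c: "c \<in> carrier (rtens R A' D)" by (simp add: C_simps)
    note sm = P.M.coact_closed[OF m]
    have "\<tau> (\<phi> m c) = tsum M (\<lambda>a x. \<tau> (IC.G.ind_pure (P.p (ract M m a)) (j x))) c"
      unfolding \<phi>_def
      by (rule AD.additive_map_tsum_carrier[OF abelian_F agM at c])
        (rule balanced_mapD(1)[OF balanced_inner[OF m]])
    also have "\<dots> = tsum M (\<lambda>a x. tsum M (\<lambda>m' c'. ract M m' (J (ract C c' a) \<otimes>\<^bsub>A\<^esub> j x)) (\<sigma> m)) c"
    proof (rule AD.tsum_cong_carrier[OF c])
      fix a x assume "a \<in> carrier A'" and x: "x \<in> carrier D"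
      then have a: "a \<in> carrier A" by simp
      have ma: "ract M m a \<in> carrier M" using m a by (simp add: P.M.ract_closed)
      have ad: "additive_map M M (\<lambda>m. ract M m (j x))"
        by (rule additive_mapI) (simp_all add: P.M.ract_closed P.M.ract_add_left j_closed x)
      have "\<tau> (IC.G.ind_pure (P.p (ract M m a)) (j x)) = ract M (P.p (ract M m a)) (j x)"
        by (rule IC.ind_counit_pure[OF P.p_Mco[OF ma] j_closed[OF x]])
      also have "\<dots> = tsum M (\<lambda>m' c'. ract M (ract M m' (J (ract C c' a))) (j x)) (\<sigma> m)"
        unfolding P.p_ract[OF m a]
        by (rule P.M.MCC.additive_map_tsum_carrier[OF agM agM ad sm])
          (simp add: P.M.ract_closed K.J_closed C.ract_closed a)
      also have "\<dots> = tsum M (\<lambda>m' c'. ract M m' (J (ract C c' a) \<otimes>\<^bsub>A\<^esub> j x)) (\<sigma> m)"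
        by (rule P.M.MCC.tsum_cong_carrier[OF sm])
          (simp add: P.M.ract_mult K.J_closed C.ract_closed a j_closed x)
      finally show "\<tau> (IC.G.ind_pure (P.p (ract M m a)) (j x)) =
          tsum M (\<lambda>m' c'. ract M m' (J (ract C c' a) \<otimes>\<^bsub>A\<^esub> j x)) (\<sigma> m)" .
    qed
    \<comment> \<open>The two sums are interchanged so that the inner one, over the word c, becomes
      \<open>kap\<close>.\<close>
    also have "\<dots> = tsum M (\<lambda>m' c'. tsum M (\<lambda>a x. ract M m' (J (ract C c' a) \<otimes>\<^bsub>A\<^esub> j x)) c) (\<sigma> m)"
      by (rule tsum_swap[OF agM AD.rtens_carrierD(1)[OF c] P.M.MCC.rtens_carrierD(1)[OF sm]])
        (simp add: P.M.ract_closed K.J_closed C.ract_closed j_closed)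
    also have "\<dots> = tsum M (\<lambda>m' c'. ract M m' (kap c' c)) (\<sigma> m)"
    proof (rule P.M.MCC.tsum_cong_carrier[OF sm])
      fix m' c' assume m': "m' \<in> carrier M" and c': "c' \<in> carrier C"
      have ad: "additive_map A M (ract M m')"
        by (rule additive_mapI) (simp_all add: P.M.ract_closed P.M.ract_add_right m')
      show "tsum M (\<lambda>a x. ract M m' (J (ract C c' a) \<otimes>\<^bsub>A\<^esub> j x)) c = ract M m' (kap c' c)"
        unfolding kap_def
        by (rule AD.additive_map_tsum_carrier[OF A.abelian_group_axioms agM ad c, symmetric])
          (simp add: K.J_closed C.ract_closed c' j_closed)
    qed
    finally show "\<tau> (\<phi> m c) = tsum M (\<lambda>m' c'. ract M m' (kap c' c)) (\<sigma> m)" .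
  qed
  also have "\<dots> = m" by (rule tsum_kap_coact(1)[OF P.M.comodule_over_axioms m])
  finally show ?thesis .
qed

text \<open>For a coinvariant m the coaction of m a is m \<otimes> \<rho>(a), and p(m x) = m
  J(\<rho> x) with J(\<rho> x) in \<open>B\<close>. So m \<otimes> a goes to the sum of m \<otimes>
  J(\<rho> x) j(y) over \<rho>(a), which \<open>tsum_rho_J_j\<close> evaluates.\<close>

lemma counit_inv_counit:
  assumes z: "z \<in> carrier F"
  shows "tsum F \<phi> (\<sigma> (\<tau> z)) = z"
proof (rule IC.G.Ind.ind_eqI[OF abelian_F additive_map_comp[OF IC.additive_ind_counit additive_counit_inv] _ _ z])
  show "additive_map F F (\<lambda>z. z)" by (rule additive_mapI) simp_all
  fix m a assume "m \<in> carrier (G.coinv_mod M \<sigma>)" and a: "a \<in> carrier A"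
  then have m: "m \<in> P.Mco" by simp
  then have mM: "m \<in> carrier M" using P.Mco_subset by blast
  have ra: "\<rho> a \<in> carrier C" using a by (rule rho_closed)
  then have c: "\<rho> a \<in> carrier (rtens R A' D)" by (simp add: C_simps)
  have ad: "additive_map A F (\<lambda>a. IC.G.ind_pure m a)"
    by (rule additive_mapI) (use ip(1,3) m in simp_all)
  have "tsum F \<phi> (\<sigma> (\<tau> (IC.G.ind_pure m a))) = \<phi> m (\<rho> a)"
    using P.M.MCC.tsum_tpure[OF abelian_F balanced_phi mM ra] m a
    by (simp add: IC.ind_counit_pure P.coact_Mco_ract)
  also have "\<dots> = tsum F (\<lambda>x y. IC.G.ind_pure m (J (\<rho> x) \<otimes>\<^bsub>A\<^esub> j y)) (\<rho> a)"
    unfolding \<phi>_def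
    by (rule AD.tsum_cong_carrier[OF c]) (simp add: P.p_Mco_ract m ip_balanced K.J_r_B j_closed)
  also have "\<dots> = IC.G.ind_pure m (tsum A (\<lambda>x y. J (\<rho> x) \<otimes>\<^bsub>A\<^esub> j y) (\<rho> a))"
    by (rule AD.additive_map_tsum_carrier[OF A.abelian_group_axioms abelian_F ad c, symmetric])
      (simp add: K.J_r_closed j_closed)
  also have "\<dots> = IC.G.ind_pure m a" by (simp add: tsum_rho_J_j a)
  finally show "tsum F \<phi> (\<sigma> (\<tau> (IC.G.ind_pure m a))) = IC.G.ind_pure m a" .
qed

lemma bij_ind_counit: "bij_betw \<tau> (carrier F) (carrier M)"
  by (rule bij_betw_byWitness[where f' = "\<lambda>m. tsum F \<phi> (\<sigma> m)"])
    (use additive_mapD(1)[OF IC.additive_ind_counit] additive_mapD(1)[OF additive_counit_inv] in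
      \<open>auto simp: counit_counit_inv counit_inv_counit\<close>)

end

section \<open>The finite family that makes the unit bijective\<close>

context cleft_setup
begin

text \<open>Induction on \<open>I\<close>, one block of pairs for each index. A block contributes
  v(d), as J(\<rho>(j x)) v(y) = \<eta>(\<epsilon> x) v(y) = v(\<epsilon>(x) y) and the counit law
  of \<open>D\<close> sums the arguments to d.\<close>

lemma ex_unit_family:
  assumes "finite I"
    and v: "\<And>i. i \<in> I \<Longrightarrow> bimodule_map R R D (alg_bimod (A\<lparr>carrier := B\<rparr>) \<eta> \<eta>) (v i)"
    and d: "\<And>i. i \<in> I \<Longrightarrow> d i \<in> carrier D"
  shows "\<exists>L\<in>lists (carrier A \<times> B). tsum A (\<lambda>a u. J (\<rho> a) \<otimes>\<^bsub>A\<^esub> u) L =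
    (\<Oplus>\<^bsub>A\<lparr>carrier := B\<rparr>\<^esub>i\<in>I. v i (d i))"
  using assms
proof (induction I rule: finite_induct)
  interpret BR: ring G.BR by (rule G.ring_BR)
  case empty
  show ?case by (rule bexI[of _ "[]"]) simp_all
next
  interpret BR: ring G.BR by (rule G.ring_BR)
  interpret DD: tensor R D D ..
  case (insert i I)
  have vB: "v l (d l) \<in> B" if "l \<in> insert i I" for l
    using insert.prems(1)[OF that] insert.prems(2)[OF that]
    by (auto simp: bimodule_map_def left_linear_def additive_map_def)
  obtain L where L: "L \<in> lists (carrier A \<times> B)"
    "tsum A (\<lambda>a u. J (\<rho> a) \<otimes>\<^bsub>A\<^esub> u) L = (\<Oplus>\<^bsub>A\<lparr>carrier := B\<rparr>\<^esub>i\<in>I. v i (d i))"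
    using insert.IH insert.prems by auto
  have vi: "left_linear R D (alg_bimod (A\<lparr>carrier := B\<rparr>) \<eta> \<eta>) (v i)" and di: "d i \<in> carrier D"
    using insert.prems by (auto simp: bimodule_map_def)
  have viB: "v i x \<in> B" if "x \<in> carrier D" for x
    using vi that by (auto simp: left_linear_def additive_map_def)
  have BA: "b \<in> carrier A" if "b \<in> B" for b using that G.B_subset by blast
  have v_add: "additive_map D A (v i)"
    using vi viB BA by (auto simp: left_linear_def additive_map_def)
  have v_lact: "v i (lact D s x) = \<eta> s \<otimes>\<^bsub>A\<^esub> v i x" if "s \<in> carrier R" "x \<in> carrier D" for s x
    using vi that by (simp add: left_linear_def)
  have eps: "\<epsilon> x \<in> carrier R" if "x \<in> carrier D" for x
    using coring that by (auto simp: coring_def bimodule_map_def left_linear_def additive_map_def)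
  note \<Delta> = comult_D_closed[OF di]
  \<comment> \<open>The word chosen for \<Delta>(d) is itself a list of pairs, so applying
    \<open>j\<close> and \<open>v i\<close> entrywise gives the new block.\<close>
  let ?L = "map (map_prod j (v i)) (\<Delta> (d i))"
  have L': "?L \<in> lists (carrier A \<times> B)"
    using DD.rtens_carrierD(1)[OF \<Delta>] by (induction rule: lists.induct) (auto simp: j_closed viB)
  have "tsum A (\<lambda>a u. J (\<rho> a) \<otimes>\<^bsub>A\<^esub> u) ?L = tsum A (\<lambda>x y. v i (lact D (\<epsilon> x) y)) (\<Delta> (d i))"
    unfolding tsum_map by (rule DD.tsum_cong_carrier[OF \<Delta>]) (simp add: J_rho_j v_lact eps)
  also have "\<dots> = v i (tsum D (\<lambda>x y. lact D (\<epsilon> x) y) (\<Delta> (d i)))"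
    by (rule DD.additive_map_tsum_carrier[OF D.N.abelian_group_axioms A.abelian_group_axioms v_add \<Delta>, symmetric])
      (simp add: D.lact_closed eps)
  also have "\<dots> = v i (d i)" using coring di by (simp add: coring_def)
  finally have "tsum A (\<lambda>a u. J (\<rho> a) \<otimes>\<^bsub>A\<^esub> u) (?L @ L) = v i (d i) \<oplus>\<^bsub>A\<^esub> (\<Oplus>\<^bsub>A\<lparr>carrier := B\<rparr>\<^esub>i\<in>I. v i (d i))"
    using tsum_append[OF A.abelian_group_axioms L' L(1), of "\<lambda>a u. J (\<rho> a) \<otimes>\<^bsub>A\<^esub> u"] L(2)
    by (simp add: K.J_r_closed BA)
  also have "\<dots> = (\<Oplus>\<^bsub>A\<lparr>carrier := B\<rparr>\<^esub>i\<in>insert i I. v i (d i))"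
    using BR.finsum_insert[of I i "\<lambda>i. v i (d i)"] insert.hyps vB by simp
  finally show ?case using L' L(1) by (intro bexI[of _ "?L @ L"]) simp_all
qed

end

theorem theorem3p18:
  fixes k :: "('k, 'e) ring_scheme"
    and R :: "('k, 'r) module"
    and D :: "('d, 'r, 'r) bimod" and \<Delta> :: "'d \<Rightarrow> ('d \<times> 'd) list" and \<epsilon> :: "'d \<Rightarrow> 'r"
    and A :: "('k, 'a) module" and \<eta> :: "'r \<Rightarrow> 'a" and \<rho> :: "'a \<Rightarrow> ('a \<times> 'd) list"
    and B :: "'a set"
    and \<alpha> :: "('a \<times> 'd) list \<Rightarrow> 'a \<Rightarrow> ('a \<times> 'd) list"
    and I :: "'i set" and v :: "'i \<Rightarrow> 'd \<Rightarrow> 'a" and d :: "'i \<Rightarrow> 'd"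
  assumes "coring k R D \<Delta> \<epsilon>"
    and "cleft_extension k R D \<Delta> \<epsilon> A \<eta> \<rho> B \<alpha>"
    and "finite I"
    and "\<And>i. i \<in> I \<Longrightarrow> bimodule_map R R D (alg_bimod (A\<lparr>carrier := B\<rparr>) \<eta> \<eta>) (v i)"
    and "\<And>i. i \<in> I \<Longrightarrow> d i \<in> carrier D"
    and "(\<Oplus>\<^bsub>A\<lparr>carrier := B\<rparr>\<^esub>i\<in>I. v i (d i)) = \<one>\<^bsub>A\<lparr>carrier := B\<rparr>\<^esub>"
  shows "cat_equivalence
    (mod_cat (A\<lparr>carrier := B\<rparr>) :: ((('x, 'a) univ, 'a) rmod, _) cat)
    (comod_cat A (ADbi R D A \<eta> \<alpha>) (AD_comult R D \<Delta> A \<eta> \<alpha>) (AD_counit \<epsilon> A \<eta>))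
    (ind_obj A B (ADbi R D A \<eta> \<alpha>) (A_coact R D A \<eta> \<rho> \<alpha>))
    (ind_map A B)"
proof -
  obtain j j' where "cleaving R D \<Delta> \<epsilon> A \<eta> \<rho> \<alpha> j j'"
    using assms(2) unfolding cleft_extension_def by blast
  then interpret cleft_setup k R D \<Delta> \<epsilon> A \<eta> \<rho> B \<alpha> j j'
    by (intro cleft_setup.intro assms(1,2))
  obtain L where L: "L \<in> lists (carrier A \<times> B)" "tsum A (\<lambda>a u. J (\<rho> a) \<otimes>\<^bsub>A\<^esub> u) L = \<one>\<^bsub>A\<^esub>"
    using ex_unit_family[where v = v and d = d, OF assms(3-5)] assms(6) by auto
  show ?thesis
    unfolding A_coact_eq
  proof (rule G.cat_equivalence_inductionI)
    fix N :: "(('x, 'a) univ, 'a) rmod" assume N: "right_module G.BR N"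
    interpret U: cleft_unit A C \<Delta>C \<epsilon>C \<rho> B J N L
      by (intro cleft_unit.intro cleft_unit_axioms.intro K.cleft_coring_axioms G.induced_comoduleI[OF N] L)
    show "bij_betw (G.ind_unit N) (carrier N) (coinv A C G.g (ind_mod A B N) (ind_coact A B C G.coact_A N))"
      by (rule U.bij_ind_unit)
  next
    fix M :: "(('x, 'a) univ, 'a) rmod" and \<sigma> assume M: "right_comodule A C \<Delta>C \<epsilon>C M \<sigma>"
    interpret cleft_setup_comodule k R D \<Delta> \<epsilon> A \<eta> \<rho> B \<alpha> j j' M \<sigma>
      by (intro cleft_setup_comodule.intro cleft_setup_comodule_axioms.intro cleft_setup_axioms M)
    show "bij_betw (G.ind_counit (M, \<sigma>)) (carrier (ind_mod A B (G.coinv_mod M \<sigma>))) (carrier M)"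
      by (rule bij_ind_counit)
  qed
qed

end
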